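(* Let $p,q,n,m$ be positive integers, $\mathcal{Y}\subset\mathbb{R}^m$ closed, $G(\boldsymbol{x},\boldsymbol{y})\in\mathbb{S}[\boldsymbol{x},\boldsymbol{y}]^q$, and $$\mathcal{X}=\{\boldsymbol{x}\in\mathbb{R}^n\mid G(\boldsymbol{x},\boldsymbol{y})\succeq 0,\ \forall\,\boldsymbol{y}\in\mathcal{Y}\}.$$ Let $\nu$ be a Borel measure on $\mathbb{R}^m$ with $\mathrm{supp}(\nu)=\mathcal{Y}$ and $\int_{\mathcal{Y}}|h(\boldsymbol{y})|\,\mathrm{d}\nu(\boldsymbol{y})<\infty$ for all $h\in\mathbb{R}[\boldsymbol{y}]$. Suppose that: (1) (Archimedean condition) there is $C>0$ such that $C-\Vert\boldsymbol{x}\Vert^2\in\mathcal{Q}^1(G,\nu)$; (2) (Carleman condition) $\sum_{d=1}^{\infty}\left(\int_{\mathcal{Y}}y_j^{2d}\,\mathrm{d}\nu(\boldsymbol{y})\right)^{-\frac{1}{2d}}=\infty$ for every $j\in\{1,\ldots,m\}$. If $F(\boldsymbol{x})\in\mathbb{S}[\boldsymbol{x}]^p$ is positive definite at every point of $\mathcal{X}$, then $F\in\mathcal{Q}^p(G,\nu)$, i.e. there exist SOS matrices $S_0\in\mathbb{S}[\boldsymbol{x}]^p$ and $S\in\mathbb{S}[\boldsymbol{x},\boldsymbol{y}]^{pq}$ such that $$F(\boldsymbol{x})=S_0(\boldsymbol{x})+\int_{\mathcal{Y}}\langle S(\boldsymbol{x},\boldsymbol{y}),G(\boldsymbol{x}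,\boldsymbol{y})\rangle_p\,\mathrm{d}\nu(\boldsymbol{y}).$$
   Context: $\boldsymbol{x}=(x_1,\ldots,x_n)$, $\boldsymbol{y}=(y_1,\ldots,y_m)$. $\mathbb{S}[\boldsymbol{x}]^p$ (resp. $\mathbb{S}[\boldsymbol{x},\boldsymbol{y}]^q$) is the set of $p\times p$ (resp. $q\times q$) symmetric matrices with entries in $\mathbb{R}[\boldsymbol{x}]$ (resp. $\mathbb{R}[\boldsymbol{x},\boldsymbol{y}]$). A symmetric polynomial matrix $S$ of size $r\times r$ is an SOS matrix if $S=T^{\intercal}T$ for some $l\times r$ real polynomial matrix $T$ (in the same variables) and some $l\in\mathbb{N}$; for $r=1$ this is a sum of squares of polynomials. For $A\in\mathbb{R}^{pq\times pq}$, $B\in\mathbb{R}^{q\times q}$, $\langle A,B\rangle_p:=\mathrm{tr}_p(A^{\intercal}(I_p\otimes B))\in\mathbb{R}^{p\times p}$, where for $C=[C_{ij}]_{i,j=1}^p$ with blocks $C_{ij}\in\mathbb{R}^{q\times q}$, $\mathrm{tr}_p(C):=[\mathrm{tr}(C_{ij})]_{i,j=1}^p$; the same definition is used for polynomial matrices. For a polynomial matrix $H(\boldsymbol{x},\boldsymbol{y})=\sum_{\beta}H_\beta(\boldsymbol{x})\boldsymbol{y}^\beta$, $\int_{\mathcal{Y}}H(\boldsymbol{x},\boldsymbol{y})\,\mathrm{d}\nu(\boldsymbol{y}):=\sum_\beta H_\beta(\boldsymbol{x})\int_{\mathcal{Y}}\boldsymbol{y}^\beta\,\mathrm{d}\nu(\boldsymbol{y})$.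 For any positive integer $p$, $$\mathcal{Q}^p(G,\nu):=\left\{S_0+\int_{\mathcal{Y}}\langle S,G\rangle_p\,\mathrm{d}\nu(\boldsymbol{y})\ \middle|\ S_0\in\mathbb{S}[\boldsymbol{x}]^p,\ S\in\mathbb{S}[\boldsymbol{x},\boldsymbol{y}]^{pq}\text{ SOS matrices}\right\}.$$ *)

theory Defs
  imports "HOL-Analysis.Analysis" "HOL-Library.Poly_Mapping"
begin

text \<open>
  A multivariate polynomial maps exponent vectors to coefficients, with finite support; the ring
  structure is the convolution one of \<^theory>\<open>HOL-Library.Poly_Mapping\<close>. Polynomials in
  \<open>(x, y)\<close> are represented as polynomials in \<open>y\<close> whose coefficients are polynomials in \<open>x\<close>, so
  that the coefficients \<open>H\<^sub>\<beta>(x)\<close> of \<open>H = (\<Sum>\<beta>. H\<^sub>\<beta>(x) y\<^sup>\<beta>)\<close> are the values of \<open>lookup H\<close>.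
\<close>

type_synonym ('a, 'v) mpoly = "('v \<Rightarrow>\<^sub>0 nat) \<Rightarrow>\<^sub>0 'a"
type_synonym 'n rpoly = "(real, 'n) mpoly"
type_synonym ('n, 'm) poly_xy = "('n rpoly, 'm) mpoly"

definition Const :: "'a::zero \<Rightarrow> ('a, 'v) mpoly" where
  "Const c = Poly_Mapping.single 0 c"

definition Var :: "'v \<Rightarrow> ('a::zero_neq_one, 'v) mpoly" where
  "Var i = Poly_Mapping.single (Poly_Mapping.single i 1) 1"

definition mon_val :: "real ^ 'v::finite \<Rightarrow> ('v \<Rightarrow>\<^sub>0 nat) \<Rightarrow> real" where
  "mon_val x \<alpha> = (\<Prod>i\<in>UNIV. (x $ i) ^ Poly_Mapping.lookup \<alpha> i)"

definition eval_poly :: "real ^ 'n \<Rightarrow> 'n::finite rpoly \<Rightarrow> real" where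
  "eval_poly x f = (\<Sum>\<alpha>\<in>Poly_Mapping.keys f. Poly_Mapping.lookup f \<alpha> * mon_val x \<alpha>)"

definition eval_xy :: "real ^ 'n \<Rightarrow> real ^ 'm \<Rightarrow> ('n::finite, 'm::finite) poly_xy \<Rightarrow> real" where
  "eval_xy x y H = (\<Sum>\<beta>\<in>Poly_Mapping.keys H. eval_poly x (Poly_Mapping.lookup H \<beta>) * mon_val y \<beta>)"

definition map_mat :: "('a \<Rightarrow> 'b) \<Rightarrow> 'a ^ 'c ^ 'r \<Rightarrow> 'b ^ 'c ^ 'r" where
  "map_mat h A = (\<chi> i j. h (A $ i $ j))"

definition sym_mat :: "'a ^ 'r ^ 'r \<Rightarrow> bool" where
  "sym_mat A \<longleftrightarrow> transpose A = A"

definition psd :: "real ^ 'r ^ 'r::finite \<Rightarrow> bool" where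
  "psd A \<longleftrightarrow> sym_mat A \<and> (\<forall>v. v \<bullet> (A *v v) \<ge> 0)"

definition pos_def :: "real ^ 'r ^ 'r::finite \<Rightarrow> bool" where
  "pos_def A \<longleftrightarrow> sym_mat A \<and> (\<forall>v. v \<noteq> 0 \<longrightarrow> v \<bullet> (A *v v) > 0)"

text \<open>
  \<open>S = T\<^sup>T T\<close> is written out entrywise because the number \<open>l\<close> of rows of \<open>T\<close> is existentially
  quantified.
\<close>

definition sos_mat :: "'a::comm_ring_1 ^ 'r ^ 'r \<Rightarrow> bool" where
  "sos_mat S \<longleftrightarrow> sym_mat S \<and>
     (\<exists>(l::nat) (T :: nat \<Rightarrow> 'r \<Rightarrow> 'a). \<forall>i j. S $ i $ j = (\<Sum>k<l. T k i * T k j))"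

text \<open>
  Matrices of size \<open>pq \<times> pq\<close> are indexed by pairs; the block \<open>(i, j)\<close> consists of the entries with
  indices \<open>((i, a), (j, b))\<close>.
\<close>

definition kronecker ::
    "'a::comm_ring_1 ^ 'p ^ 'p \<Rightarrow> 'a ^ 'q ^ 'q
      \<Rightarrow> 'a ^ ('p::finite \<times> 'q::finite) ^ ('p \<times> 'q)" where
  "kronecker A B = (\<chi> r s. A $ fst r $ fst s * B $ snd r $ snd s)"

definition block ::
    "'a ^ ('p::finite \<times> 'q::finite) ^ ('p \<times> 'q) \<Rightarrow> 'p \<Rightarrow> 'p
      \<Rightarrow> 'a ^ 'q ^ 'q" where
  "block C i j = (\<chi> a b. C $ (i, a) $ (j, b))"

definition partial_trace ::
    "'a::comm_ring_1 ^ ('p::finite \<times> 'q::finite) ^ ('p \<times> 'q) \<Rightarrow> 'a ^ 'p ^ 'p" where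
  "partial_trace C = (\<chi> i j. trace (block C i j))"

definition mat_inner ::
    "'a::comm_ring_1 ^ ('p::finite \<times> 'q::finite) ^ ('p \<times> 'q) \<Rightarrow> 'a ^ 'q ^ 'q
      \<Rightarrow> 'a ^ 'p ^ 'p" where
  "mat_inner A B = partial_trace (transpose A ** kronecker (mat 1) B)"

definition integral_y ::
    "(real ^ 'm) set \<Rightarrow> (real ^ 'm) measure \<Rightarrow> ('n, 'm::finite) poly_xy \<Rightarrow> 'n rpoly" where
  "integral_y Y \<nu> H =
     (\<Sum>\<beta>\<in>Poly_Mapping.keys H. Poly_Mapping.lookup H \<beta> * Const (LINT y:Y|\<nu>. mon_val y \<beta>))"

definition Qmod ::
    "(real ^ 'm) set \<Rightarrow> ('n, 'm::finite) poly_xy ^ 'q ^ 'q \<Rightarrow> (real ^ 'm) measure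
      \<Rightarrow> ('n rpoly ^ 'p ^ 'p::finite) set" where
  "Qmod Y G \<nu> =
     {S0 + map_mat (integral_y Y \<nu>) (mat_inner S G) | S0 S.
        sos_mat S0 \<and> sos_mat (S :: ('n, 'm) poly_xy ^ ('p::finite \<times> 'q::finite) ^ ('p \<times> 'q))}"

definition measure_support :: "'a::topological_space measure \<Rightarrow> 'a set" where
  "measure_support \<nu> = {y. \<forall>U. open U \<and> y \<in> U \<longrightarrow> emeasure \<nu> U > 0}"

text \<open>
  The series is taken in \<^typ>\<open>ennreal\<close>, where \<open>inverse 0 = \<infinity>\<close>, so a vanishing moment
  contributes \<open>\<infinity>\<close>. The summation index is shifted so that the series starts at \<open>d = 1\<close>.
\<close>

definition carleman :: "(real ^ 'm) set \<Rightarrow> (real ^ 'm) measure \<Rightarrow> 'm::finite \<Rightarrow> bool" where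
  "carleman Y \<nu> j \<longleftrightarrow>
     suminf (\<lambda>d. inverse (ennreal
       ((LINT y:Y|\<nu>. (y $ j) ^ (2 * Suc d)) powr (1 / real (2 * Suc d))))) = \<infinity>"

end

theory Submission
  imports Defs
begin

text \<open>
  Write \<open>Q\<^sup>p\<close> for the quadratic module \<open>Qmod Y G \<nu>\<close> of matrices of size \<open>p\<close>. It is closed under
  addition, and it contains \<open>q w w\<^sup>T\<close> for every \<open>q\<close> in \<open>Q\<^sup>1\<close> and every vector \<open>w\<close> of polynomials in
  \<open>x\<close> (\<open>Qmod_outer\<close>). Matrix certificates can therefore be assembled from scalar ones, and two
  properties of \<open>Q\<^sup>1\<close> are enough.

  The first one is that the elements of \<open>Q\<^sup>1\<close> detect every point \<open>x\<close> outside \<open>X\<close>; this is where the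
  Carleman condition enters. For such an \<open>x\<close> there are a vector \<open>v\<close> and a point \<open>y0\<close> in the support
  of \<open>\<nu>\<close> at which the polynomial \<open>g(y) = v\<^sup>T G(x, y) v\<close> is negative. Polynomials in \<open>y\<close> approximate a
  bump function at \<open>y0\<close> in a weighted \<open>L\<^sup>2\<close> norm, so that the integral of \<open>s\<^sup>2 g\<close> is negative for some
  polynomial \<open>s\<close> (\<open>exists_poly_square_integral_neg\<close>), and replacing the fixed \<open>x\<close> by the variables in
  this integral gives an element of \<open>Q\<^sup>1\<close> that is negative at \<open>x\<close>. The density is an instance of the
  Denjoy-Carleman theorem: Bang's argument (\<open>bang\<close>) is applied to the \<open>L\<^sup>2\<close> distance between the
  polynomials and a polynomial multiple of \<open>cos (t y\<^sub>l)\<close>, as a function of \<open>t\<close>. This distance vanishes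
  at \<open>t = 0\<close>, hence for all \<open>t\<close>; products of cosines are then limits of polynomials, and
  Stone-Weierstrass does the rest.

  The second one is the Archimedean condition. It puts the preorder \<open>T\<close> generated by \<open>C - |x|\<^sup>2\<close> into
  \<open>Q\<^sup>1\<close>, and a matrix polynomial that is positive definite on the whole cube \<open>|x\<^sub>l| \<le> \<surd>C\<close> is a sum of
  matrices \<open>t w w\<^sup>T\<close> with \<open>t\<close> in \<open>T\<close> (\<open>outer_cone_positivstellensatz_cube\<close>). For a matrix that is
  positive definite on \<open>X\<close> only, the first property and compactness of the cube yield a single \<open>q\<close> in
  \<open>Q\<^sup>1\<close> such that \<open>F - q I\<close> is positive definite on the cube (\<open>compact_penalty\<close>): \<open>q\<close> is very negative
  where \<open>F\<close> fails to be positive definite and nearly nonpositive elsewhere. Then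
  \<open>F = (F - q I) + q I\<close> lies in \<open>Q\<^sup>p\<close> (\<open>Qmod_positivstellensatz\<close>).
\<close>

section \<open>Evaluation of polynomials\<close>

text \<open>
  The evaluations \<open>eval_poly\<close> and \<open>eval_xy\<close> and the integral \<open>integral_y\<close> are all sums over the
  exponents of a coefficient, mapped by some \<open>\<phi>\<close>, times a factor \<open>\<psi>\<close> that depends on the exponent
  only. Their algebraic properties are proved for that general shape.
\<close>

lemma eval_over_superset:
  fixes f :: "'k \<Rightarrow>\<^sub>0 'a::zero" and \<phi> :: "'a \<Rightarrow> 'b::comm_semiring_1"
  assumes "finite A" "Poly_Mapping.keys f \<subseteq> A" "\<phi> 0 = 0"
  shows "(\<Sum>\<alpha>\<in>Poly_Mapping.keys f. \<phi> (Poly_Mapping.lookup f \<alpha>) * \<psi> \<alpha>)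
       = (\<Sum>\<alpha>\<in>A. \<phi> (Poly_Mapping.lookup f \<alpha>) * \<psi> \<alpha>)"
  by (rule sum.mono_neutral_left)
     (use assms in \<open>auto simp: in_keys_iff\<close>)

lemma eval_add:
  fixes f g :: "'k \<Rightarrow>\<^sub>0 'a::monoid_add" and \<phi> :: "'a \<Rightarrow> 'b::comm_semiring_1"
  assumes "\<phi> 0 = 0" "\<And>a b. \<phi> (a + b) = \<phi> a + \<phi> b"
  shows "(\<Sum>\<alpha>\<in>Poly_Mapping.keys (f + g). \<phi> (Poly_Mapping.lookup (f + g) \<alpha>) * \<psi> \<alpha>)
       = (\<Sum>\<alpha>\<in>Poly_Mapping.keys f. \<phi> (Poly_Mapping.lookup f \<alpha>) * \<psi> \<alpha>)
       + (\<Sum>\<alpha>\<in>Poly_Mapping.keys g. \<phi> (Poly_Mapping.lookup g \<alpha>) * \<psi> \<alpha>)"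
proof -
  let ?A = "Poly_Mapping.keys f \<union> Poly_Mapping.keys g"
  have "Poly_Mapping.keys (f + g) \<subseteq> ?A" by (rule Poly_Mapping.keys_add)
  then show ?thesis
    using eval_over_superset[of ?A f \<phi> \<psi>] eval_over_superset[of ?A g \<phi> \<psi>]
      eval_over_superset[of ?A "f + g" \<phi> \<psi>] assms
    by (simp add: lookup_add distrib_right sum.distrib)
qed

lemma poly_mapping_induct_single [case_names single add]:
  fixes f :: "'k \<Rightarrow>\<^sub>0 'a::comm_monoid_add"
  assumes "\<And>k c. P (Poly_Mapping.single k c)" "\<And>f g. P f \<Longrightarrow> P g \<Longrightarrow> P (f + g)"
  shows "P f"
proof -
  have eq: "f = (\<Sum>k\<in>Poly_Mapping.keys f. Poly_Mapping.single k (Poly_Mapping.lookup f k))"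
    by (rule poly_mapping_eqI)
       (auto simp: lookup_sum lookup_single when_def in_keys_iff)
  have "P (\<Sum>k\<in>A. Poly_Mapping.single k (Poly_Mapping.lookup f k))" if "finite A" for A
    using that
  proof (induction A rule: finite_induct)
    case empty
    show ?case using assms(1)[of undefined 0] by simp
  qed (simp add: assms)
  from this[of "Poly_Mapping.keys f"] show ?thesis using eq by simp
qed

lemma eval_mult:
  fixes f g :: "'k::monoid_add \<Rightarrow>\<^sub>0 'a::comm_semiring_1" and \<phi> :: "'a \<Rightarrow> 'b::comm_semiring_1"
  assumes \<phi>: "\<phi> 0 = 0" "\<And>a b. \<phi> (a + b) = \<phi> a + \<phi> b" "\<And>a b. \<phi> (a * b) = \<phi> a * \<phi> b"
    and \<psi>: "\<And>\<alpha> \<beta>. \<psi> (\<alpha> + \<beta>) = \<psi> \<alpha> * \<psi> \<beta>"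
  shows "(\<Sum>\<alpha>\<in>Poly_Mapping.keys (f * g). \<phi> (Poly_Mapping.lookup (f * g) \<alpha>) * \<psi> \<alpha>)
       = (\<Sum>\<alpha>\<in>Poly_Mapping.keys f. \<phi> (Poly_Mapping.lookup f \<alpha>) * \<psi> \<alpha>)
       * (\<Sum>\<alpha>\<in>Poly_Mapping.keys g. \<phi> (Poly_Mapping.lookup g \<alpha>) * \<psi> \<alpha>)"
proof -
  define e where "e f = (\<Sum>\<alpha>\<in>Poly_Mapping.keys f. \<phi> (Poly_Mapping.lookup f \<alpha>) * \<psi> \<alpha>)" for f
  have add: "e (f + g) = e f + e g" for f g
    unfolding e_def by (rule eval_add[OF \<phi>(1,2)])
  have single: "e (Poly_Mapping.single k c) = \<phi> c * \<psi> k" for k c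
    by (auto simp: e_def \<phi>(1))
  have "e (f * g) = e f * e g"
  proof (induction f rule: poly_mapping_induct_single)
    case (single k c)
    show ?case
      by (induction g rule: poly_mapping_induct_single)
         (simp_all add: mult_single \<open>\<And>k c. e (Poly_Mapping.single k c) = \<phi> c * \<psi> k\<close>
           \<phi>(3) \<psi> distrib_left add mult_ac)
  qed (simp add: distrib_right add)
  then show ?thesis by (simp add: e_def)
qed

lemma Const_0 [simp]: "Const 0 = 0"
  by (simp add: Const_def)

lemma Const_1 [simp]: "Const 1 = 1"
  by (simp add: Const_def)

lemma Const_add: "Const (a + b) = Const a + Const b"
  by (simp add: Const_def single_add)

lemma Const_minus: "Const (- a) = - Const a" for a :: "'a::ab_group_add"
  by (simp add: Const_def single_uminus)

lemma Const_diff: "Const (a - b) = Const a - Const b" for a :: "'a::ab_group_add"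
  by (simp add: Const_def single_diff)

lemma Const_mult: "Const (a * b) = Const a * Const b"
  by (simp add: Const_def mult_single)

lemma Const_of_nat: "Const (of_nat k) = of_nat k" for k :: nat
  by (simp add: Const_def)

lemma single_eq_Const_mult: "Poly_Mapping.single \<alpha> c = Const c * Poly_Mapping.single \<alpha> 1"
  for c :: "'a::comm_semiring_1"
  by (simp add: Const_def mult_single)

lemma mon_val_add: "mon_val x (\<alpha> + \<beta>) = mon_val x \<alpha> * mon_val x \<beta>"
  by (simp add: mon_val_def lookup_add power_add prod.distrib)

lemma mon_val_0 [simp]: "mon_val x 0 = 1"
  by (simp add: mon_val_def)

lemma mon_val_single: "mon_val x (Poly_Mapping.single i k) = (x $ i) ^ k"
proof -
  have "mon_val x (Poly_Mapping.single i k) = (\<Prod>j\<in>UNIV. if j = i then (x $ j) ^ k else 1)"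
    unfolding mon_val_def by (rule prod.cong) (auto simp: lookup_single when_def)
  then show ?thesis by simp
qed

lemma eval_poly_single [simp]: "eval_poly x (Poly_Mapping.single \<alpha> c) = c * mon_val x \<alpha>"
  by (auto simp: eval_poly_def)

lemma eval_poly_add [simp]: "eval_poly x (f + g) = eval_poly x f + eval_poly x g"
  unfolding eval_poly_def using eval_add[of "\<lambda>c. c" f g "mon_val x"] by simp

lemma eval_poly_mult [simp]: "eval_poly x (f * g) = eval_poly x f * eval_poly x g"
  unfolding eval_poly_def using eval_mult[of "\<lambda>c. c" "mon_val x" f g] by (simp add: mon_val_add)

lemma eval_poly_0 [simp]: "eval_poly x 0 = 0"
  by (simp add: eval_poly_def)

lemma eval_poly_Const [simp]: "eval_poly x (Const c) = c"
  by (simp add: Const_def)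

lemma eval_poly_1 [simp]: "eval_poly x 1 = 1"
  using eval_poly_Const[of x 1] by simp

lemma eval_poly_minus [simp]: "eval_poly x (- f) = - eval_poly x f"
  using eval_poly_add[of x f "- f"] by simp

lemma eval_poly_diff [simp]: "eval_poly x (f - g) = eval_poly x f - eval_poly x g"
  using eval_poly_add[of x f "- g"] by simp

lemma eval_poly_power [simp]: "eval_poly x (f ^ k) = eval_poly x f ^ k"
  by (induction k) simp_all

lemma eval_poly_sum [simp]: "eval_poly x (sum f A) = (\<Sum>i\<in>A. eval_poly x (f i))"
  by (induction A rule: infinite_finite_induct) simp_all

lemma eval_poly_Var [simp]: "eval_poly x (Var i) = x $ i"
  by (simp add: Var_def mon_val_single)

lemma poly_induct [case_names Const Var add mult]:
  fixes f :: "'v::finite rpoly"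
  assumes Const: "\<And>c. P (Const c)" and Var: "\<And>i. P (Var i)"
    and add: "\<And>f g. P f \<Longrightarrow> P g \<Longrightarrow> P (f + g)" and mult: "\<And>f g. P f \<Longrightarrow> P g \<Longrightarrow> P (f * g)"
  shows "P f"
proof -
  have Var_power: "P (Poly_Mapping.single (Poly_Mapping.single i k) 1)" for i k
  proof (induction k)
    case 0
    show ?case using Const[of 1] by simp
  next
    case (Suc k)
    have "Poly_Mapping.single (Poly_Mapping.single i (Suc k)) (1::real)
        = Var i * Poly_Mapping.single (Poly_Mapping.single i k) 1"
      by (simp add: Var_def mult_single single_add[symmetric])
    then show ?case using mult[OF Var[of i] Suc] by simp
  qed
  have mon: "P (Poly_Mapping.single \<alpha> 1)" for \<alpha> :: "'v \<Rightarrow>\<^sub>0 nat"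
  proof (induction \<alpha> rule: poly_mapping_induct_single)
    case (add \<alpha> \<beta>)
    then show ?case
      using mult[of "Poly_Mapping.single \<alpha> 1" "Poly_Mapping.single \<beta> 1"] by (simp add: mult_single)
  qed (rule Var_power)
  show ?thesis
  proof (induction f rule: poly_mapping_induct_single)
    case (single \<alpha> c)
    show ?case unfolding single_eq_Const_mult[of \<alpha> c] by (rule mult[OF Const mon])
  qed (rule add)
qed

lemma continuous_on_eval_poly [continuous_intros]:
  "continuous_on A (\<lambda>x. eval_poly x f)"
  by (induction f rule: poly_induct) (auto intro!: continuous_intros)

lemma borel_measurable_eval_poly [measurable]:
  "(\<lambda>x. eval_poly x f) \<in> borel_measurable borel"
  by (intro borel_measurable_continuous_onI continuous_on_eval_poly)

lemma eval_xy_add [simp]: "eval_xy x y (H + K) = eval_xy x y H + eval_xy x y K"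
  unfolding eval_xy_def by (rule eval_add) simp_all

lemma eval_xy_mult [simp]: "eval_xy x y (H * K) = eval_xy x y H * eval_xy x y K"
  unfolding eval_xy_def by (rule eval_mult) (simp_all add: mon_val_add)

lemma eval_xy_single [simp]:
  "eval_xy x y (Poly_Mapping.single \<beta> f) = eval_poly x f * mon_val y \<beta>"
  by (auto simp: eval_xy_def)

lemma eval_xy_0 [simp]: "eval_xy x y 0 = 0"
  by (simp add: eval_xy_def)

lemma eval_xy_Const [simp]: "eval_xy x y (Const f) = eval_poly x f"
  by (simp add: Const_def)

lemma eval_xy_sum [simp]: "eval_xy x y (sum H A) = (\<Sum>i\<in>A. eval_xy x y (H i))"
  by (induction A rule: infinite_finite_induct) simp_all

text \<open>
  Fixing \<open>x\<close> leaves a polynomial in \<open>y\<close>; in this form, statements about polynomials in \<open>y\<close> apply to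
  the entries of \<open>G\<close>.
\<close>

definition spec_x :: "real ^ 'n \<Rightarrow> ('n::finite, 'm::finite) poly_xy \<Rightarrow> 'm rpoly" where
  "spec_x x H =
     (\<Sum>\<beta>\<in>Poly_Mapping.keys H. Poly_Mapping.single \<beta> (eval_poly x (Poly_Mapping.lookup H \<beta>)))"

lemma eval_poly_spec_x: "eval_poly y (spec_x x H) = eval_xy x y H"
  by (simp add: spec_x_def eval_xy_def)

definition of_y :: "'m rpoly \<Rightarrow> ('n, 'm::finite) poly_xy" where
  "of_y s = (\<Sum>\<beta>\<in>Poly_Mapping.keys s. Poly_Mapping.single \<beta> (Const (Poly_Mapping.lookup s \<beta>)))"

lemma eval_xy_of_y [simp]: "eval_xy x y (of_y s) = eval_poly y s"
  unfolding eval_poly_def[of y s] by (simp add: of_y_def)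

lemma integral_y_add: "integral_y Y \<nu> (H + K) = integral_y Y \<nu> H + integral_y Y \<nu> K"
  unfolding integral_y_def
  by (rule eval_add[of "\<lambda>c. c" H K "\<lambda>\<beta>. Const (LINT y:Y|\<nu>. mon_val y \<beta>)"]) simp_all

lemma integral_y_0 [simp]: "integral_y Y \<nu> 0 = 0"
  by (simp add: integral_y_def)

lemma integral_y_Const_mult: "integral_y Y \<nu> (Const c * H) = c * integral_y Y \<nu> H"
proof (induction H rule: poly_mapping_induct_single)
  case (single k d)
  have "integral_y Y \<nu> (Poly_Mapping.single k e) = e * Const (LINT y:Y|\<nu>. mon_val y k)"
    for e :: "'a rpoly"
    by (auto simp: integral_y_def)
  then show ?case by (simp add: Const_def[of c] mult_single mult_ac)
qed (simp add: distrib_left integral_y_add)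

lemma eval_integral_y:
  fixes H :: "('n::finite, 'm::finite) poly_xy"
  assumes "\<And>h :: 'm rpoly. set_integrable \<nu> Y (\<lambda>y. eval_poly y h)"
  shows "eval_poly x (integral_y Y \<nu> H) = (LINT y:Y|\<nu>. eval_xy x y H)"
proof (induction H rule: poly_mapping_induct_single)
  case (single \<beta> f)
  show ?case by (auto simp: integral_y_def)
next
  case (add H K)
  have "set_integrable \<nu> Y (\<lambda>y. eval_xy x y H)" for H :: "('n, 'm) poly_xy"
    using assms[of "spec_x x H"] by (simp add: eval_poly_spec_x)
  with add show ?case by (simp add: integral_y_add set_integral_add)
qed

section \<open>The quadratic module\<close>

text \<open>
  The module \<open>Q\<^sup>1\<close>, as a set of polynomials instead of matrices of size one.
\<close>

definition Qpoly ::
    "(real ^ 'm) set \<Rightarrow> ('n, 'm::finite) poly_xy ^ 'q ^ 'q \<Rightarrow> (real ^ 'm) measure \<Rightarrow> 'n rpoly set" where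
  "Qpoly Y G \<nu> = {q. (\<chi> i j. q) \<in> (Qmod Y G \<nu> :: ('n rpoly ^ 1 ^ 1) set)}"

lemma mat_inner_nth:
  fixes S :: "'a::comm_ring_1 ^ ('p::finite \<times> 'q::finite) ^ ('p \<times> 'q)"
  shows "mat_inner S G $ i $ j = (\<Sum>a\<in>UNIV. \<Sum>c\<in>UNIV. S $ (j, c) $ (i, a) * G $ c $ a)"
proof -
  have *: "(\<Sum>r\<in>UNIV. S $ r $ (i, a) * ((mat 1 :: 'a^'p^'p) $ fst r $ j * G $ snd r $ a))
      = (\<Sum>c\<in>UNIV. S $ (j, c) $ (i, a) * G $ c $ a)" for a
  proof -
    have "(\<Sum>r\<in>UNIV. S $ r $ (i, a) * ((mat 1 :: 'a^'p^'p) $ fst r $ j * G $ snd r $ a))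
        = (\<Sum>l\<in>UNIV. \<Sum>c\<in>UNIV. S $ (l, c) $ (i, a) * ((mat 1 :: 'a^'p^'p) $ l $ j * G $ c $ a))"
      unfolding sum.cartesian_product UNIV_Times_UNIV by (rule sum.cong) auto
    also have "\<dots> = (\<Sum>l\<in>UNIV. if l = j then (\<Sum>c\<in>UNIV. S $ (l, c) $ (i, a) * G $ c $ a) else 0)"
      by (rule sum.cong) (auto simp: mat_def)
    finally show ?thesis by simp
  qed
  show ?thesis
    unfolding mat_inner_def partial_trace_def trace_def block_def kronecker_def
      matrix_matrix_mult_def transpose_def
    by (simp add: *)
qed

lemma sos_matI:
  fixes l :: nat and T :: "nat \<Rightarrow> 'r::finite \<Rightarrow> 'a::comm_ring_1"
  assumes "\<And>i j. S $ i $ j = (\<Sum>k<l. T k i * T k j)"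
  shows "sos_mat S"
proof -
  have "S $ i $ j = S $ j $ i" for i j
    unfolding assms by (rule sum.cong) (simp_all add: mult.commute)
  then have "sym_mat S"
    unfolding sym_mat_def transpose_def by (simp add: vec_eq_iff)
  then show ?thesis
    unfolding sos_mat_def using assms by blast
qed

lemma QmodI:
  fixes F :: "'n rpoly ^ 'p::finite ^ 'p" and G :: "('n, 'm::finite) poly_xy ^ 'q::finite ^ 'q"
    and T :: "nat \<Rightarrow> 'p \<times> 'q \<Rightarrow> ('n, 'm) poly_xy"
    and t :: "nat \<Rightarrow> 'p \<Rightarrow> 'n rpoly" and l l' :: nat
  assumes "\<And>i j. F $ i $ j = (\<Sum>k<l. t k i * t k j)
    + integral_y Y \<nu> (\<Sum>a\<in>UNIV. \<Sum>c\<in>UNIV. (\<Sum>k<l'. T k (j, c) * T k (i, a)) * G $ c $ a)"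
  shows "F \<in> Qmod Y G \<nu>"
proof -
  define S0 :: "'n rpoly ^ 'p ^ 'p" where "S0 = (\<chi> i j. \<Sum>k<l. t k i * t k j)"
  define S :: "('n, 'm) poly_xy ^ ('p \<times> 'q) ^ ('p \<times> 'q)" where
    "S = (\<chi> r s. \<Sum>k<l'. T k r * T k s)"
  have "sos_mat S0"
    by (rule sos_matI[where l = l and T = t]) (simp add: S0_def)
  moreover have "sos_mat S"
    by (rule sos_matI[where l = l' and T = T]) (simp add: S_def)
  moreover have "F = S0 + map_mat (integral_y Y \<nu>) (mat_inner S G)"
    by (simp add: vec_eq_iff map_mat_def mat_inner_nth assms S0_def S_def)
  ultimately show ?thesis unfolding Qmod_def by blast
qed

lemma QmodE:
  fixes F :: "'n rpoly ^ 'p::finite ^ 'p" and G :: "('n, 'm::finite) poly_xy ^ 'q::finite ^ 'q"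
  assumes "F \<in> Qmod Y G \<nu>"
  obtains l l' :: nat and t and T :: "nat \<Rightarrow> 'p \<times> 'q \<Rightarrow> ('n, 'm) poly_xy"
  where "\<And>i j. F $ i $ j = (\<Sum>k<l. t k i * t k j)
    + integral_y Y \<nu> (\<Sum>a\<in>UNIV. \<Sum>c\<in>UNIV. (\<Sum>k<l'. T k (j, c) * T k (i, a)) * G $ c $ a)"
proof -
  obtain S0 and S :: "('n, 'm) poly_xy ^ ('p \<times> 'q) ^ ('p \<times> 'q)"
    where F: "F = S0 + map_mat (integral_y Y \<nu>) (mat_inner S G)" and "sos_mat S0" "sos_mat S"
    using assms unfolding Qmod_def by blast
  obtain l :: nat and t where S0: "\<And>i j. S0 $ i $ j = (\<Sum>k<l. t k i * t k j)"
    using \<open>sos_mat S0\<close> unfolding sos_mat_def by blast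
  obtain l' :: nat and T where S: "\<And>i j. S $ i $ j = (\<Sum>k<l'. T k i * T k j)"
    using \<open>sos_mat S\<close> unfolding sos_mat_def by blast
  show thesis
    by (rule that[where l = l and t = t and l' = l' and T = T]) (simp add: F map_mat_def mat_inner_nth S0 S)
qed

lemma sum_lessThan_append:
  fixes f :: "nat \<Rightarrow> 'a::comm_monoid_add"
  shows "(\<Sum>k<l + l'. if k < l then f k else g (k - l)) = (\<Sum>k<l. f k) + (\<Sum>k<l'. g k)"
  by (induction l') (simp_all add: add.assoc)

lemma Qmod_add:
  fixes F F' :: "'n rpoly ^ 'p::finite ^ 'p" and G :: "('n, 'm::finite) poly_xy ^ 'q::finite ^ 'q"
  assumes "F \<in> Qmod Y G \<nu>" "F' \<in> Qmod Y G \<nu>"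
  shows "F + F' \<in> Qmod Y G \<nu>"
proof -
  obtain l l' :: nat and t and T :: "nat \<Rightarrow> 'p \<times> 'q \<Rightarrow> ('n, 'm) poly_xy" where
    F: "\<And>i j. F $ i $ j = (\<Sum>k<l. t k i * t k j)
    + integral_y Y \<nu> (\<Sum>a\<in>UNIV. \<Sum>c\<in>UNIV. (\<Sum>k<l'. T k (j, c) * T k (i, a)) * G $ c $ a)"
    by (rule QmodE[OF assms(1)]) (rule that)
  obtain m m' :: nat and u and U :: "nat \<Rightarrow> 'p \<times> 'q \<Rightarrow> ('n, 'm) poly_xy" where
    F': "\<And>i j. F' $ i $ j = (\<Sum>k<m. u k i * u k j)
    + integral_y Y \<nu> (\<Sum>a\<in>UNIV. \<Sum>c\<in>UNIV. (\<Sum>k<m'. U k (j, c) * U k (i, a)) * G $ c $ a)"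
    by (rule QmodE[OF assms(2)]) (rule that)
  define tu where "tu k = (if k < l then t k else u (k - l))" for k
  define TU where "TU k = (if k < l' then T k else U (k - l'))" for k
  have tu: "(\<Sum>k<l + m. tu k i * tu k j) = (\<Sum>k<l. t k i * t k j) + (\<Sum>k<m. u k i * u k j)" for i j
  proof -
    have "(\<Sum>k<l + m. tu k i * tu k j)
        = (\<Sum>k<l + m. if k < l then t k i * t k j else u (k - l) i * u (k - l) j)"
      by (rule sum.cong) (simp_all add: tu_def)
    then show ?thesis
      by (simp add: sum_lessThan_append[where f = "\<lambda>k. t k i * t k j" and g = "\<lambda>k. u k i * u k j"])
  qed
  have TU: "(\<Sum>k<l' + m'. TU k i * TU k j) = (\<Sum>k<l'. T k i * T k j) + (\<Sum>k<m'. U k i * U k j)" for i j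
  proof -
    have "(\<Sum>k<l' + m'. TU k i * TU k j)
        = (\<Sum>k<l' + m'. if k < l' then T k i * T k j else U (k - l') i * U (k - l') j)"
      by (rule sum.cong) (simp_all add: TU_def)
    then show ?thesis
      by (simp add: sum_lessThan_append[where f = "\<lambda>k. T k i * T k j" and g = "\<lambda>k. U k i * U k j"])
  qed
  show ?thesis
    by (rule QmodI[where l = "l + m" and t = tu and l' = "l' + m'" and T = TU])
       (simp add: F F' tu TU distrib_right sum.distrib integral_y_add add_ac)
qed

lemma Qpoly_add:
  fixes p q :: "'n rpoly" and G :: "('n, 'm::finite) poly_xy ^ 'q::finite ^ 'q"
  assumes "p \<in> Qpoly Y G \<nu>" "q \<in> Qpoly Y G \<nu>"
  shows "p + q \<in> Qpoly Y G \<nu>"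
proof -
  from assms have "(\<chi> i j. p) + (\<chi> i j. q) \<in> (Qmod Y G \<nu> :: ('n rpoly ^ 1 ^ 1) set)"
    unfolding Qpoly_def by (auto intro: Qmod_add)
  moreover have "(\<chi> i j. p) + (\<chi> i j. q) = ((\<chi> i j. p + q) :: 'n rpoly ^ 1 ^ 1)"
    by (simp add: vec_eq_iff)
  ultimately show ?thesis by (simp add: Qpoly_def)
qed

text \<open>
  If \<open>S\<close> is the SOS matrix of size \<open>q\<close> in a representation of a scalar element, then the Kronecker
  product of \<open>w w\<^sup>T\<close> with \<open>S\<close> is again an SOS matrix, now of size \<open>pq\<close>, and the factors \<open>w\<close>, being free
  of \<open>y\<close>, move out of the integral.
\<close>

lemma Qmod_outer:
  fixes w :: "'p::finite \<Rightarrow> 'n rpoly" and G :: "('n, 'm::finite) poly_xy ^ 'q::finite ^ 'q"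
  assumes "q \<in> Qpoly Y G \<nu>"
  shows "(\<chi> i j. q * w i * w j) \<in> Qmod Y G \<nu>"
proof -
  have "((\<chi> i j. q) :: 'n rpoly ^ 1 ^ 1) \<in> Qmod Y G \<nu>"
    using assms by (simp add: Qpoly_def)
  then obtain l l' :: nat and t and T :: "nat \<Rightarrow> 1 \<times> 'q \<Rightarrow> ('n, 'm) poly_xy" where
    "\<And>i j::1. ((\<chi> i j. q) :: 'n rpoly ^ 1 ^ 1) $ i $ j = (\<Sum>k<l. t k i * t k j)
    + integral_y Y \<nu> (\<Sum>a\<in>UNIV. \<Sum>c\<in>UNIV. (\<Sum>k<l'. T k (j, c) * T k (i, a)) * G $ c $ a)"
    by (rule QmodE) (rule that)
  from this[of 1 1] have q: "q = (\<Sum>k<l. t k 1 * t k 1)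
    + integral_y Y \<nu> (\<Sum>a\<in>UNIV. \<Sum>c\<in>UNIV. (\<Sum>k<l'. T k (1, c) * T k (1, a)) * G $ c $ a)"
    by simp
  show ?thesis
  proof (rule QmodI[where l = l and t = "\<lambda>k i. t k 1 * w i" and l' = l' and T = "\<lambda>k r. Const (w (fst r)) * T k (1, snd r)"])
    fix i j
    define I where "I = (\<Sum>a\<in>UNIV. \<Sum>c\<in>UNIV. (\<Sum>k<l'. T k (1, c) * T k (1, a)) * G $ c $ a)"
    have "(\<Sum>a\<in>UNIV. \<Sum>c\<in>UNIV. (\<Sum>k<l'. Const (w j) * T k (1, c) * (Const (w i) * T k (1, a))) * G $ c $ a)
      = Const (w i * w j) * I"
      by (simp add: I_def sum_distrib_left sum_distrib_right Const_mult mult_ac)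
    moreover have "q * w i * w j = (\<Sum>k<l. t k 1 * w i * (t k 1 * w j)) + w i * w j * integral_y Y \<nu> I"
      unfolding q I_def[symmetric] distrib_right by (simp add: sum_distrib_right sum_distrib_left mult_ac)
    ultimately show "(\<chi> i j. q * w i * w j) $ i $ j = (\<Sum>k<l. t k 1 * w i * (t k 1 * w j)) +
       integral_y Y \<nu> (\<Sum>a\<in>UNIV. \<Sum>c\<in>UNIV. (\<Sum>k<l'.
          Const (w (fst (j, c))) * T k (1, snd (j, c)) * (Const (w (fst (i, a))) * T k (1, snd (i, a)))) * G $ c $ a)"
      by (simp add: integral_y_Const_mult)
  qed
qed

lemma Qpoly_mult_square: "q \<in> Qpoly Y G \<nu> \<Longrightarrow> q * (f * f) \<in> Qpoly Y G \<nu>"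
  using Qmod_outer[where ?'p = 1, of q Y G \<nu> "\<lambda>_. f"] by (simp add: Qpoly_def mult.assoc)

lemma Qpoly_square: "f * f \<in> Qpoly Y G \<nu>"
  unfolding Qpoly_def mem_Collect_eq
  by (rule QmodI[where l = "Suc 0" and t = "\<lambda>k i. f" and l' = 0 and T = "\<lambda>_ _. 0"], simp)

lemma Qmod_scalar_mat:
  fixes G :: "('n, 'm::finite) poly_xy ^ 'q::finite ^ 'q"
  assumes "q \<in> Qpoly Y G \<nu>"
  shows "(mat q :: 'n rpoly ^ 'p::finite ^ 'p) \<in> Qmod Y G \<nu>"
proof -
  define E :: "'p \<Rightarrow> 'n rpoly ^ 'p ^ 'p" where
    "E i = (\<chi> j k. q * (if j = i then 1 else 0) * (if k = i then 1 else 0))" for i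
  have "E i \<in> Qmod Y G \<nu>" for i
    unfolding E_def by (rule Qmod_outer[OF assms])
  moreover have "(0 :: 'n rpoly ^ 'p ^ 'p) \<in> Qmod Y G \<nu>"
    by (rule QmodI[where l = 0 and t = "\<lambda>_ _. 0" and l' = 0 and T = "\<lambda>_ _. 0"]) simp
  ultimately have "sum E A \<in> Qmod Y G \<nu>" for A
    by (induction A rule: infinite_finite_induct) (simp_all add: Qmod_add)
  moreover have "sum E UNIV = mat q"
  proof -
    have "(\<Sum>i\<in>UNIV. q * (if j = i then 1 else 0) * (if k = i then 1 else 0)) = (if j = k then q else 0)"
      for j k :: 'p
    proof -
      have "(\<Sum>i\<in>UNIV. q * (if j = i then 1 else 0) * (if k = i then 1 else 0))
          = (\<Sum>i\<in>UNIV. if j = i then (if j = k then q else 0) else 0)"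
        by (rule sum.cong) auto
      then show ?thesis by simp
    qed
    then show ?thesis by (simp add: vec_eq_iff E_def mat_def)
  qed
  ultimately show ?thesis by metis
qed

text \<open>
  These elements, given by the SOS matrices \<open>s\<^sup>2 v v\<^sup>T\<close> with \<open>s\<close> depending on \<open>y\<close> only, are the ones that
  will be negative at a prescribed point outside \<open>X\<close>.
\<close>

lemma Qpoly_quadratic_form:
  fixes G :: "('n::finite, 'm::finite) poly_xy ^ 'q::finite ^ 'q" and v :: "real ^ 'q"
  assumes int: "\<And>h :: 'm rpoly. set_integrable \<nu> Y (\<lambda>y. eval_poly y h)"
  shows "\<exists>q \<in> Qpoly Y G \<nu>. \<forall>x. eval_poly x q
           = (LINT y:Y|\<nu>. (eval_poly y s)\<^sup>2 * (v \<bullet> (map_mat (eval_xy x y) G *v v)))"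
proof -
  define w :: "'q \<Rightarrow> ('n, 'm) poly_xy" where "w a = of_y s * Const (Const (v $ a))" for a
  define H where "H = (\<Sum>a\<in>UNIV. \<Sum>c\<in>UNIV. (w c * w a) * G $ c $ a)"
  have "integral_y Y \<nu> H \<in> Qpoly Y G \<nu>"
    unfolding Qpoly_def mem_Collect_eq
    by (rule QmodI[where l = 0 and t = "\<lambda>_ _. 0" and l' = 1 and T = "\<lambda>_ r. w (snd r)"], simp add: H_def)
  moreover have "eval_poly x (integral_y Y \<nu> H)
      = (LINT y:Y|\<nu>. (eval_poly y s)\<^sup>2 * (v \<bullet> (map_mat (eval_xy x y) G *v v)))" for x
  proof -
    have "eval_xy x y H = (eval_poly y s)\<^sup>2 * (v \<bullet> (map_mat (eval_xy x y) G *v v))" for y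
      unfolding H_def w_def
      by (subst sum.swap)
         (simp add: inner_vec_def matrix_vector_mult_def map_mat_def sum_distrib_left
           power2_eq_square mult_ac)
    then show ?thesis by (simp add: eval_integral_y[OF int])
  qed
  ultimately show ?thesis by blast
qed

section \<open>The preorder of the ball\<close>

inductive_set sos :: "'a::comm_ring_1 set" where
  square: "a * a \<in> sos"
| add: "a \<in> sos \<Longrightarrow> b \<in> sos \<Longrightarrow> a + b \<in> sos"

lemma sos_mult:
  assumes "a \<in> sos" "b \<in> sos"
  shows "a * b \<in> sos"
  using assms
proof (induction a rule: sos.induct)
  case (square a)
  from \<open>b \<in> sos\<close> show ?case
  proof (induction b rule: sos.induct)
    case (square b)
    have "a * a * (b * b) = (a * b) * (a * b)" by (simp add: mult_ac)
    then show ?case by (metis sos.square)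
  qed (simp add: distrib_left sos.add)
qed (simp add: distrib_right sos.add)

lemma sos_0: "0 \<in> sos"
  using sos.square[of 0] by simp

lemma sos_sum: "(\<And>i. i \<in> A \<Longrightarrow> f i \<in> sos) \<Longrightarrow> sum f A \<in> sos"
  by (induction A rule: infinite_finite_induct) (auto simp: sos_0 sos.add)

lemma sos_Const: "r \<ge> 0 \<Longrightarrow> Const (r::real) \<in> sos"
  using sos.square[of "Const (sqrt r)"] by (simp flip: Const_mult)

definition ball_poly :: "real \<Rightarrow> 'n::finite rpoly" where
  "ball_poly C = Const C - (\<Sum>k\<in>UNIV. (Var k)\<^sup>2)"

definition ball_preorder :: "real \<Rightarrow> 'n::finite rpoly set" where
  "ball_preorder C = {s + t * ball_poly C | s t. s \<in> sos \<and> t \<in> sos}"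

lemma ball_preorderI: "s \<in> sos \<Longrightarrow> t \<in> sos \<Longrightarrow> s + t * ball_poly C \<in> ball_preorder C"
  unfolding ball_preorder_def by blast

lemma ball_preorder_sos: "s \<in> sos \<Longrightarrow> s \<in> ball_preorder C"
  using ball_preorderI[of s 0 C] by (simp add: sos_0)

lemma ball_preorder_Const: "r \<ge> 0 \<Longrightarrow> Const r \<in> ball_preorder C"
  by (simp add: ball_preorder_sos sos_Const)

lemma ball_preorder_0: "0 \<in> ball_preorder C"
  by (simp add: ball_preorder_sos sos_0)

lemma ball_preorder_ball_poly: "ball_poly C \<in> ball_preorder C"
  using ball_preorderI[of 0 "1 * 1" C] sos_0 sos.square[of 1] by simp

lemma ball_preorder_add:
  assumes "a \<in> ball_preorder C" "b \<in> ball_preorder C"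
  shows "a + b \<in> ball_preorder C"
proof -
  obtain s t s' t' where "a = s + t * ball_poly C" "b = s' + t' * ball_poly C"
    and "s \<in> sos" "t \<in> sos" "s' \<in> sos" "t' \<in> sos"
    using assms unfolding ball_preorder_def by blast
  then show ?thesis
    using ball_preorderI[of "s + s'" "t + t'" C] by (simp add: sos.add algebra_simps)
qed

text \<open>
  A quadratic module is rarely closed under products; with the single generator \<open>p = C - |x|\<^sup>2\<close> it is,
  because the only new product \<open>p p\<close> is a square.
\<close>

lemma ball_preorder_mult:
  assumes "a \<in> ball_preorder C" "b \<in> ball_preorder C"
  shows "a * b \<in> ball_preorder C"
proof -
  let ?p = "ball_poly C :: 'a rpoly"
  obtain s t s' t' where *: "a = s + t * ?p" "b = s' + t' * ?p"
    and "s \<in> sos" "t \<in> sos" "s' \<in> sos" "t' \<in> sos"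
    using assms unfolding ball_preorder_def by blast
  then have "(s * s' + t * t' * (?p * ?p)) + (s * t' + t * s') * ?p \<in> ball_preorder C"
    by (intro ball_preorderI sos.add sos_mult sos.square)
  also have "(s * s' + t * t' * (?p * ?p)) + (s * t' + t * s') * ?p = a * b"
    by (simp add: * algebra_simps)
  finally show ?thesis .
qed

lemma ball_preorder_sum: "(\<And>i. i \<in> A \<Longrightarrow> f i \<in> ball_preorder C) \<Longrightarrow> sum f A \<in> ball_preorder C"
  by (induction A rule: infinite_finite_induct) (auto simp: ball_preorder_0 ball_preorder_add)

lemma Const_half_cancel: "Const (1/2) * (a + a) = (a :: 'n rpoly)"
proof -
  have "Const (1/2) * (a + a) = (Const (1/2) + Const (1/2)) * a" by (simp add: algebra_simps)
  then show ?thesis by (simp flip: Const_add)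
qed

lemma sum_split1: "(\<Sum>k\<in>UNIV. f k) = f l + (\<Sum>k\<in>UNIV-{l}. f k)" for l :: "'n::finite"
  by (simp add: sum.remove)

text \<open>
  The identity behind this is
  \<open>2 R (R \<plusminus> x\<^sub>l) = (R \<plusminus> x\<^sub>l)\<^sup>2 + (R\<^sup>2 - |x|\<^sup>2) + (\<Sum>k\<noteq>l. x\<^sub>k\<^sup>2)\<close>.
  Together with closure under products it makes all products of the factors \<open>R \<plusminus> x\<^sub>l\<close> available, and
  this is the reason for working on a cube.
\<close>

lemma ball_preorder_linear:
  assumes "R > 0" "\<sigma> * \<sigma> = (1::real)"
  shows "Const R + Const \<sigma> * Var l \<in> (ball_preorder (R\<^sup>2) :: 'n::finite rpoly set)"
proof -
  let ?u = "Const R + Const \<sigma> * Var l :: 'n rpoly"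
  let ?rest = "\<Sum>k\<in>UNIV-{l}. (Var k)\<^sup>2 :: 'n rpoly"
  have \<sigma>: "Const \<sigma> * Const \<sigma> = (1 :: 'n rpoly)"
    using assms(2) by (simp flip: Const_mult)
  have "?u * ?u = Const R * Const R + 2 * (Const R * (Const \<sigma> * Var l)) + (Const \<sigma> * Const \<sigma>) * (Var l * Var l)"
    by (simp add: algebra_simps)
  then have "?u * ?u + ball_poly (R\<^sup>2) + ?rest = Const R * ?u + Const R * ?u"
    unfolding ball_poly_def sum_split1[of _ l] \<sigma> by (simp add: algebra_simps power2_eq_square Const_mult)
  then have "Const (1/2) * (?u * ?u + ball_poly (R\<^sup>2) + ?rest) = Const R * ?u"
    by (simp only: Const_half_cancel)
  then have "Const (1/R) * (Const (1/2) * (?u * ?u + ball_poly (R\<^sup>2) + ?rest)) = (Const (1/R) * Const R) * ?u"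
    by (simp add: mult.assoc)
  also have "\<dots> = ?u" using assms(1) by (simp flip: Const_mult)
  finally have eq: "Const (1/R) * (Const (1/2) * (?u * ?u + ball_poly (R\<^sup>2) + ?rest)) = ?u" .
  have "Const (1/R) * (Const (1/2) * (?u * ?u + ball_poly (R\<^sup>2) + ?rest)) \<in> ball_preorder (R\<^sup>2)"
    using assms(1)
    by (intro ball_preorder_mult ball_preorder_add ball_preorder_Const ball_preorder_ball_poly
         ball_preorder_sos[OF sos.square] ball_preorder_sos[OF sos_sum])
       (auto simp: power2_eq_square sos.square)
  then show ?thesis unfolding eq .
qed

text \<open>
  The estimate \<open>|f| \<le> e\<close> in the partial order whose nonnegative elements are the preorder.
\<close>

definition bounded_by :: "real \<Rightarrow> 'n::finite rpoly \<Rightarrow> 'n rpoly \<Rightarrow> bool" where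
  "bounded_by C e f \<longleftrightarrow> e + f \<in> ball_preorder C \<and> e - f \<in> ball_preorder C"

lemma bounded_by_add:
  assumes "bounded_by C a f" "bounded_by C b g"
  shows "bounded_by C (a + b) (f + g)"
proof -
  have "(a + f) + (b + g) = (a + b) + (f + g)" "(a - f) + (b - g) = (a + b) - (f + g)"
    by (simp_all add: algebra_simps)
  then show ?thesis
    using assms unfolding bounded_by_def by (metis ball_preorder_add)
qed

text \<open>
  Both signs come from products of nonnegative elements:
  \<open>(a + f)(b + g) + (a - f)(b - g) = 2(a b + f g)\<close> and
  \<open>(a + f)(b - g) + (a - f)(b + g) = 2(a b - f g)\<close>.
\<close>

lemma bounded_by_mult:
  assumes "bounded_by C a f" "bounded_by C b g"
  shows "bounded_by C (a * b) (f * g)"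
proof -
  have "Const (1/2) * ((a + f) * (b + g) + (a - f) * (b - g)) \<in> ball_preorder C"
    and "Const (1/2) * ((a + f) * (b - g) + (a - f) * (b + g)) \<in> ball_preorder C"
    using assms unfolding bounded_by_def
    by (auto intro!: ball_preorder_mult ball_preorder_add ball_preorder_Const)
  moreover have "(a + f) * (b + g) + (a - f) * (b - g) = (a * b + f * g) + (a * b + f * g)"
    and "(a + f) * (b - g) + (a - f) * (b + g) = (a * b - f * g) + (a * b - f * g)"
    by (simp_all add: algebra_simps)
  ultimately show ?thesis
    unfolding bounded_by_def by (metis Const_half_cancel)
qed

lemma bounded_by_Const: "\<bar>r\<bar> \<le> c \<Longrightarrow> bounded_by C (Const c) (Const r)"
  unfolding bounded_by_def
  by (simp flip: Const_add Const_diff) (auto intro!: ball_preorder_Const)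

lemma bounded_by_Var: "R > 0 \<Longrightarrow> bounded_by (R\<^sup>2) (Const R) (Var l)"
  using ball_preorder_linear[of R 1 l] ball_preorder_linear[of R "-1" l]
  by (simp add: bounded_by_def Const_minus)

lemma bounded_by_exists:
  assumes "R > 0"
  shows "\<exists>c>0. bounded_by (R\<^sup>2) (Const c) f"
proof (induction f rule: poly_induct)
  case (Const c)
  show ?case by (rule exI[of _ "\<bar>c\<bar> + 1"]) (auto intro: bounded_by_Const)
next
  case (Var i)
  show ?case using assms bounded_by_Var by blast
next
  case (add f g)
  then obtain c d where "c > 0" "bounded_by (R\<^sup>2) (Const c) f" "d > 0" "bounded_by (R\<^sup>2) (Const d) g"
    by blast
  then show ?case
    using bounded_by_add[of "R\<^sup>2" "Const c" f "Const d" g]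
    by (intro exI[of _ "c + d"]) (simp add: Const_add)
next
  case (mult f g)
  then obtain c d where "c > 0" "bounded_by (R\<^sup>2) (Const c) f" "d > 0" "bounded_by (R\<^sup>2) (Const d) g"
    by blast
  then show ?case
    using bounded_by_mult[of "R\<^sup>2" "Const c" f "Const d" g]
    by (intro exI[of _ "c * d"]) (simp add: Const_mult)
qed

definition cube :: "real \<Rightarrow> (real ^ 'n::finite) set" where
  "cube R = cbox (\<chi> i. - R) (\<chi> i. R)"

lemma cube_iff: "a \<in> cube R \<longleftrightarrow> (\<forall>l. \<bar>a $ l\<bar> \<le> R)"
  unfolding cube_def by (auto simp: mem_box_cart abs_le_iff minus_le_iff)

lemma compact_cube: "compact (cube R)"
  unfolding cube_def by (rule compact_cbox)

definition sqdist :: "real ^ 'n::finite \<Rightarrow> 'n rpoly" where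
  "sqdist a = (\<Sum>l\<in>UNIV. (Var l - Const (a $ l)) * (Var l - Const (a $ l)))"

lemma sqdist_sos: "sqdist a \<in> sos"
  unfolding sqdist_def by (intro sos_sum sos.square)

lemma eval_poly_bounded_on_cube: "\<exists>c>0. \<forall>a\<in>cube R. \<bar>eval_poly a f\<bar> \<le> c"
proof -
  have "bounded ((\<lambda>a. eval_poly a f) ` cube R)"
    by (intro compact_imp_bounded compact_continuous_image continuous_on_eval_poly compact_cube)
  then show ?thesis unfolding bounded_pos by auto
qed

text \<open>
  This is uniform continuity of \<open>f\<close> on the cube in algebraic form: the error of replacing \<open>f\<close> by its
  value at \<open>a\<close> is at most \<open>\<epsilon>\<close> plus a multiple of the squared distance to \<open>a\<close>, with a multiple that
  does not depend on \<open>a\<close>. The property passes from constants and variables to sums and products.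
\<close>

lemma bounded_by_sqdist:
  fixes f :: "'n::finite rpoly"
  assumes "R > 0"
  shows "\<forall>\<epsilon>>0. \<exists>c\<ge>0. \<forall>a\<in>cube R.
    bounded_by (R\<^sup>2) (Const \<epsilon> + Const c * sqdist a) (f - Const (eval_poly a f))"
proof (induction f rule: poly_induct)
  case (Const r)
  then show ?case
    by (auto intro!: exI[of _ 0] simp: bounded_by_def ball_preorder_Const)
next
  case (Var i)
  show ?case
  proof (intro allI impI)
    fix \<epsilon> :: real assume "\<epsilon> > 0"
    \<comment> \<open>With \<open>z = x\<^sub>i - a\<^sub>i\<close>, this \<open>c\<close> makes \<open>\<epsilon> + c z\<^sup>2 \<plusminus> z\<close> a perfect square.\<close>
    define c where "c = 1 / (4 * \<epsilon>)"
    have "c > 0" using \<open>\<epsilon> > 0\<close> by (simp add: c_def)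
    have "bounded_by (R\<^sup>2) (Const \<epsilon> + Const c * sqdist a) (Var i - Const (a $ i))" for a
    proof -
      define z where "z = (Var i - Const (a $ i) :: 'n rpoly)"
      define rest where "rest = (\<Sum>l\<in>UNIV-{i}. (Var l - Const (a $ l)) * (Var l - Const (a $ l)) :: 'n rpoly)"
      have eq: "Const \<epsilon> + Const c * sqdist a + Const \<sigma> * z
          = (Const (sqrt \<epsilon>) + Const (\<sigma> * sqrt c) * z) * (Const (sqrt \<epsilon>) + Const (\<sigma> * sqrt c) * z)
            + Const c * rest" if "\<sigma> * \<sigma> = 1" for \<sigma>
      proof -
        have "sqrt \<epsilon> * sqrt c = 1/2"
          using \<open>\<epsilon> > 0\<close> by (simp add: c_def real_sqrt_divide real_sqrt_mult)
        then have "Const (sqrt \<epsilon>) * Const (\<sigma> * sqrt c) + Const (sqrt \<epsilon>) * Const (\<sigma> * sqrt c) = (Const \<sigma> :: 'n rpoly)"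
          by (simp flip: Const_mult Const_add add: algebra_simps)
        moreover have "Const (sqrt \<epsilon>) * Const (sqrt \<epsilon>) = (Const \<epsilon> :: 'n rpoly)"
          using \<open>\<epsilon> > 0\<close> by (simp flip: Const_mult)
        moreover have "Const (\<sigma> * sqrt c) * Const (\<sigma> * sqrt c) = (Const c :: 'n rpoly)"
        proof -
          have "\<sigma> * sqrt c * (\<sigma> * sqrt c) = (\<sigma> * \<sigma>) * (sqrt c * sqrt c)" by (simp only: mult_ac)
          then show ?thesis using \<open>c > 0\<close> that by (simp flip: Const_mult)
        qed
        moreover have "sqdist a = z * z + rest"
          unfolding sqdist_def sum_split1[of _ i] z_def rest_def ..
        moreover have "(A + B * z) * (A + B * z) + c' * rest
            = A * A + (A * B + A * B) * z + ((B * B) * (z * z) + c' * rest)" for A B c'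
          by (simp add: algebra_simps)
        ultimately show ?thesis by (simp add: algebra_simps)
      qed
      have "rest \<in> sos" unfolding rest_def by (intro sos_sum sos.square)
      then have "Const \<epsilon> + Const c * sqdist a + Const \<sigma> * z \<in> ball_preorder (R\<^sup>2)" if "\<sigma> * \<sigma> = 1" for \<sigma>
        unfolding eq[OF that] using \<open>c > 0\<close>
        by (intro ball_preorder_sos sos.add sos.square sos_mult sos_Const) auto
      from this[of 1] this[of "-1"] show ?thesis
        unfolding bounded_by_def z_def[symmetric] by (simp add: Const_minus)
    qed
    then show "\<exists>c\<ge>0. \<forall>a\<in>cube R. bounded_by (R\<^sup>2) (Const \<epsilon> + Const c * sqdist a) (Var i - Const (eval_poly a (Var i)))"
      using \<open>c > 0\<close> by (intro exI[of _ c]) auto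
  qed
next
  case (add f g)
  show ?case
  proof (intro allI impI)
    fix \<epsilon> :: real assume "\<epsilon> > 0"
    then have "\<epsilon> / 2 > 0" by simp
    obtain c d where "c \<ge> 0" "d \<ge> 0"
      and c: "\<And>a. a \<in> cube R \<Longrightarrow> bounded_by (R\<^sup>2) (Const (\<epsilon>/2) + Const c * sqdist a) (f - Const (eval_poly a f))"
      and d: "\<And>a. a \<in> cube R \<Longrightarrow> bounded_by (R\<^sup>2) (Const (\<epsilon>/2) + Const d * sqdist a) (g - Const (eval_poly a g))"
      using add[rule_format, OF \<open>\<epsilon> / 2 > 0\<close>] by blast
    have "bounded_by (R\<^sup>2) (Const \<epsilon> + Const (c + d) * sqdist a) (f + g - Const (eval_poly a (f + g)))"
      if "a \<in> cube R" for a
    proof -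
      have 1: "(Const (\<epsilon>/2) + Const c * sqdist a) + (Const (\<epsilon>/2) + Const d * sqdist a)
          = Const (\<epsilon>/2 + \<epsilon>/2) + Const (c + d) * sqdist a"
        unfolding Const_add by (simp add: algebra_simps)
      have 2: "(f - Const (eval_poly a f)) + (g - Const (eval_poly a g)) = f + g - Const (eval_poly a (f + g))"
        by (simp add: Const_add algebra_simps)
      show ?thesis
        using bounded_by_add[OF c[OF that] d[OF that]] unfolding 1 2 by simp
    qed
    then show "\<exists>c\<ge>0. \<forall>a\<in>cube R. bounded_by (R\<^sup>2) (Const \<epsilon> + Const c * sqdist a) (f + g - Const (eval_poly a (f + g)))"
      using \<open>c \<ge> 0\<close> \<open>d \<ge> 0\<close> by (intro exI[of _ "c + d"]) auto
  qed
next
  case (mult f g)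
  obtain B where B: "B > 0" "bounded_by (R\<^sup>2) (Const B) f"
    using bounded_by_exists[OF assms] by blast
  obtain B' where B': "B' > 0" "\<And>a. a \<in> cube R \<Longrightarrow> \<bar>eval_poly a g\<bar> \<le> B'"
    using eval_poly_bounded_on_cube[of R g] by blast
  show ?case
  proof (intro allI impI)
    fix \<epsilon> :: real assume "\<epsilon> > 0"
    define \<delta> where "\<delta> = \<epsilon> / (B + B')"
    have "\<delta> > 0" using \<open>\<epsilon> > 0\<close> B B' by (simp add: \<delta>_def)
    have \<delta>: "B * \<delta> + B' * \<delta> = \<epsilon>"
      using B(1) B'(1) unfolding distrib_right[symmetric] by (simp add: \<delta>_def)
    obtain c d where "c \<ge> 0" "d \<ge> 0"
      and c: "\<And>a. a \<in> cube R \<Longrightarrow> bounded_by (R\<^sup>2) (Const \<delta> + Const c * sqdist a) (f - Const (eval_poly a f))"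
      and d: "\<And>a. a \<in> cube R \<Longrightarrow> bounded_by (R\<^sup>2) (Const \<delta> + Const d * sqdist a) (g - Const (eval_poly a g))"
      using mult[rule_format, OF \<open>\<delta> > 0\<close>] by blast
    have "bounded_by (R\<^sup>2) (Const \<epsilon> + Const (B * d + B' * c) * sqdist a) (f * g - Const (eval_poly a (f * g)))"
      if "a \<in> cube R" for a
    proof -
      have 1: "Const B * (Const \<delta> + Const d * sqdist a) + Const B' * (Const \<delta> + Const c * sqdist a)
          = Const (B * \<delta> + B' * \<delta>) + Const (B * d + B' * c) * sqdist a"
        unfolding Const_add Const_mult by (simp add: algebra_simps)
      \<comment> \<open>Split as in the product rule; the first factors are bounded uniformly in \<open>a\<close>.\<close>
      have 2: "f * (g - Const (eval_poly a g)) + Const (eval_poly a g) * (f - Const (eval_poly a f))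
          = f * g - Const (eval_poly a (f * g))"
        by (simp add: Const_mult algebra_simps)
      show ?thesis
        using bounded_by_add[OF bounded_by_mult[OF B(2) d[OF that]]
            bounded_by_mult[OF bounded_by_Const[OF B'(2)[OF that]] c[OF that]]]
        unfolding 1 2 \<delta> .
    qed
    then show "\<exists>c\<ge>0. \<forall>a\<in>cube R. bounded_by (R\<^sup>2) (Const \<epsilon> + Const c * sqdist a) (f * g - Const (eval_poly a (f * g)))"
      using \<open>c \<ge> 0\<close> \<open>d \<ge> 0\<close> B(1) B'(1) by (intro exI[of _ "B * d + B' * c"]) auto
  qed
qed

section \<open>Positive definite matrix polynomials on a cube\<close>

text \<open>
  The combinations of constant positive semidefinite matrices with coefficients in the preorder of
  the ball of radius \<open>\<surd>C\<close>. Unlike \<open>Qmod\<close>, this cone may be multiplied by any element of the preorder.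
\<close>

inductive_set outer_cone :: "real \<Rightarrow> ('n::finite rpoly ^ 'p::finite ^ 'p) set" for C where
  outer: "t \<in> ball_preorder C \<Longrightarrow> (\<chi> i j. t * Const (w i) * Const (w j)) \<in> outer_cone C"
| add: "A \<in> outer_cone C \<Longrightarrow> B \<in> outer_cone C \<Longrightarrow> A + B \<in> outer_cone C"

lemma outer_cone_0: "0 \<in> outer_cone C"
proof -
  have "(\<chi> i j. 0 * Const ((\<lambda>_. 0) i) * Const ((\<lambda>_. 0) j)) \<in> (outer_cone C :: ('a rpoly ^ 'b ^ 'b) set)"
    by (rule outer_cone.outer[OF ball_preorder_0])
  moreover have "(\<chi> i j. 0 * Const ((\<lambda>_. 0) i) * Const ((\<lambda>_. 0) j)) = (0 :: 'a rpoly ^ 'b ^ 'b)"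
    by (simp add: vec_eq_iff)
  ultimately show ?thesis by metis
qed

lemma outer_cone_sum: "(\<And>i. i \<in> I \<Longrightarrow> A i \<in> outer_cone C) \<Longrightarrow> sum A I \<in> outer_cone C"
  by (induction I rule: infinite_finite_induct) (auto simp: outer_cone_0 outer_cone.add)

lemma outer_cone_smult:
  assumes "t \<in> ball_preorder C" "A \<in> outer_cone C"
  shows "map_mat ((*) t) A \<in> outer_cone C"
  using assms(2)
proof (induction A rule: outer_cone.induct)
  case (outer s w)
  have "map_mat ((*) t) (\<chi> i j. s * Const (w i) * Const (w j)) = (\<chi> i j. (t * s) * Const (w i) * Const (w j))"
    by (simp add: vec_eq_iff map_mat_def mult.assoc)
  then show ?case
    using outer_cone.outer[OF ball_preorder_mult[OF assms(1) outer]] by metis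
next
  case (add A B)
  have "map_mat ((*) t) (A + B) = map_mat ((*) t) A + map_mat ((*) t) B"
    by (simp add: vec_eq_iff map_mat_def distrib_left)
  then show ?case using add.IH by (simp add: outer_cone.add)
qed

lemma outer_cone_mat:
  assumes "t \<in> ball_preorder C"
  shows "mat t \<in> (outer_cone C :: ('n::finite rpoly ^ 'p::finite ^ 'p) set)"
proof -
  define E :: "'p \<Rightarrow> 'n rpoly ^ 'p ^ 'p" where
    "E i = (\<chi> j k. t * Const (if j = i then 1 else 0) * Const (if k = i then 1 else 0))" for i
  have "(\<Sum>i\<in>UNIV. t * Const (if j = i then 1 else 0) * Const (if k = i then 1 else 0)) = (if j = k then t else 0)"
    for j k :: 'p
  proof -
    have "(\<Sum>i\<in>UNIV. t * Const (if j = i then 1 else 0) * Const (if k = i then 1 else 0))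
        = (\<Sum>i\<in>UNIV. if j = i then (if j = k then t else 0) else 0)"
      by (rule sum.cong) auto
    then show ?thesis by simp
  qed
  then have "sum E UNIV = mat t" by (simp add: vec_eq_iff E_def mat_def)
  moreover have "sum E UNIV \<in> outer_cone C"
    unfolding E_def by (intro outer_cone_sum outer_cone.outer assms)
  ultimately show ?thesis by metis
qed

text \<open>
  Otherwise the quadratic form is negative at \<open>e\<^sub>i + t e\<^sub>j\<close> for a suitable \<open>t\<close>.
\<close>

lemma psd_minor_2:
  assumes "psd A" "A $ j $ j = 0"
  shows "A $ i $ j = 0"
proof (rule ccontr)
  assume nz: "A $ i $ j \<noteq> 0"
  define t where "t = - (\<bar>A $ i $ i\<bar> + 1) / (2 * A $ i $ j)"
  define v where "v = axis i 1 + t *\<^sub>R (axis j 1 :: real ^ 'a)"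
  have sym: "A $ j $ i = A $ i $ j"
    using assms(1) unfolding psd_def sym_mat_def transpose_def by (metis vec_lambda_beta)
  have "v \<bullet> (A *v v) = A $ i $ i + 2 * (t * A $ i $ j)"
    using assms(2) sym
    by (simp add: v_def matrix_vector_right_distrib matrix_vector_mult_scaleR inner_add_left inner_add_right
        inner_axis' matrix_vector_mult_basis column_def algebra_simps)
  also have "\<dots> = A $ i $ i - (\<bar>A $ i $ i\<bar> + 1)"
    using nz by (simp add: t_def)
  also have "\<dots> < 0" by simp
  finally show False using assms(1) unfolding psd_def by (metis not_le)
qed

text \<open>
  Cholesky's factorization: subtracting \<open>a a\<^sup>T / A\<^sub>i\<^sub>i\<close>, where \<open>a\<close> is the \<open>i\<close>-th column, keeps the matrix
  positive semidefinite and lowers the number of nonzero diagonal entries.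
\<close>

lemma outer_cone_psd:
  fixes A :: "real ^ 'p::finite ^ 'p"
  assumes "psd A"
  shows "map_mat Const A \<in> (outer_cone C :: ('n::finite rpoly ^ 'p ^ 'p) set)"
  using assms
proof (induction "card {i. A $ i $ i \<noteq> 0}" arbitrary: A rule: less_induct)
  case less
  have sym: "A $ j $ i = A $ i $ j" for i j
    using less.prems unfolding psd_def sym_mat_def transpose_def by (metis vec_lambda_beta)
  have diag_nonneg: "B $ i $ i \<ge> 0" if "psd B" for B :: "real ^ 'p ^ 'p" and i
  proof -
    have "axis i 1 \<bullet> (B *v axis i 1) \<ge> 0" using that unfolding psd_def by blast
    then show ?thesis by (simp add: inner_axis' matrix_vector_mult_basis column_def)
  qed
  show ?case
  proof (cases "\<exists>i. A $ i $ i \<noteq> 0")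
    case False
    then have "map_mat Const A = (0 :: 'n rpoly ^ 'p ^ 'p)"
      using psd_minor_2[OF less.prems] by (simp add: vec_eq_iff map_mat_def)
    then show ?thesis by (simp add: outer_cone_0)
  next
    case True
    then obtain i where "A $ i $ i \<noteq> 0" by blast
    then have d: "A $ i $ i > 0" using diag_nonneg[OF less.prems, of i] by simp
    let ?d = "A $ i $ i"
    define B :: "real ^ 'p ^ 'p" where "B = (\<chi> j k. A $ j $ k - A $ j $ i * A $ k $ i / ?d)"
    have "sym_mat B"
      unfolding sym_mat_def transpose_def using sym by (simp add: B_def vec_eq_iff mult.commute)
    moreover have "v \<bullet> (B *v v) \<ge> 0" for v
    proof -
      define c where "c = (\<Sum>j\<in>UNIV. A $ j $ i * v $ j)"
      have Av: "(A *v v) $ i = c"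
        by (simp add: c_def matrix_vector_mult_def sym[of i])
      have vA: "v \<bullet> (A *v axis i 1) = c"
        by (simp add: c_def matrix_vector_mult_basis column_def inner_vec_def mult.commute)
      have "v \<bullet> (B *v v) = v \<bullet> (A *v v) - (\<Sum>j\<in>UNIV. \<Sum>k\<in>UNIV. v $ j * (A $ j $ i * A $ k $ i / ?d * v $ k))"
        by (simp add: inner_vec_def matrix_vector_mult_def B_def sum_subtractf left_diff_distrib
            right_diff_distrib sum_distrib_left)
      also have "(\<Sum>j\<in>UNIV. \<Sum>k\<in>UNIV. v $ j * (A $ j $ i * A $ k $ i / ?d * v $ k)) = c * c / ?d"
        unfolding c_def sum_product sum_divide_distrib by (intro sum.cong) simp_all
      finally have vB: "v \<bullet> (B *v v) = v \<bullet> (A *v v) - c * c / ?d" .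
      \<comment> \<open>The form of \<open>B\<close> at \<open>v\<close> is the minimum of the form of \<open>A\<close> on the line through \<open>v\<close> in direction \<open>e\<^sub>i\<close>.\<close>
      define u where "u t = v + t *\<^sub>R axis i (1::real)" for t
      have "u t \<bullet> (A *v u t) = v \<bullet> (A *v v) + 2 * t * c + t\<^sup>2 * ?d" for t
        by (simp add: u_def matrix_vector_right_distrib matrix_vector_mult_scaleR inner_add_left inner_add_right
          inner_axis' Av vA)
          (simp add: matrix_vector_mult_basis column_def power2_eq_square algebra_simps)
      from this[of "- c / ?d"] have "u (- c / ?d) \<bullet> (A *v u (- c / ?d)) = v \<bullet> (B *v v)"
        unfolding vB using d by (simp add: field_simps power2_eq_square)
      then show ?thesis using less.prems unfolding psd_def by metis
    qed
    ultimately have "psd B" unfolding psd_def by blast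
    have "{j. B $ j $ j \<noteq> 0} \<subset> {j. A $ j $ j \<noteq> 0}"
    proof
      show "{j. B $ j $ j \<noteq> 0} \<subseteq> {j. A $ j $ j \<noteq> 0}"
        using psd_minor_2[OF less.prems] sym by (auto simp: B_def)
      show "{j. B $ j $ j \<noteq> 0} \<noteq> {j. A $ j $ j \<noteq> 0}"
        using d by (auto simp: B_def set_eq_iff intro!: exI[of _ i])
    qed
    then have "card {j. B $ j $ j \<noteq> 0} < card {j. A $ j $ j \<noteq> 0}"
      by (intro psubset_card_mono) auto
    then have "map_mat Const B \<in> (outer_cone C :: ('n::finite rpoly ^ 'p ^ 'p) set)"
      using \<open>psd B\<close> by (rule less.hyps)
    moreover have "(\<chi> j k. Const (1 / ?d) * Const (A $ j $ i) * Const (A $ k $ i)) \<in> (outer_cone C :: ('n::finite rpoly ^ 'p ^ 'p) set)"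
      using d by (intro outer_cone.outer ball_preorder_Const) simp
    moreover have "(map_mat Const A :: 'n rpoly ^ 'p ^ 'p) = map_mat Const B + (\<chi> j k. Const (1 / ?d) * Const (A $ j $ i) * Const (A $ k $ i))"
      by (simp add: vec_eq_iff map_mat_def B_def flip: Const_mult Const_add)
    ultimately show ?thesis by (metis outer_cone.add)
  qed
qed

text \<open>
  A symmetric matrix with small entries is dominated by a small multiple of the identity. For a pair
  of indices,
  \<open>e (e\<^sub>i e\<^sub>i\<^sup>T + e\<^sub>j e\<^sub>j\<^sup>T) + E\<^sub>i\<^sub>j (e\<^sub>i e\<^sub>j\<^sup>T + e\<^sub>j e\<^sub>i\<^sup>T)\<close> is the sum of
  \<open>(e + E\<^sub>i\<^sub>j)/2\<close> times the square of \<open>e\<^sub>i + e\<^sub>j\<close> and \<open>(e - E\<^sub>i\<^sub>j)/2\<close> times the square of \<open>e\<^sub>i - e\<^sub>j\<close>;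
  summing over all ordered pairs counts every term twice.
\<close>

lemma outer_cone_small_perturbation:
  fixes E :: "'n::finite rpoly ^ 'p::finite ^ 'p"
  assumes sym: "sym_mat E" and bd: "\<And>i j. bounded_by C e (E $ i $ j)"
  shows "mat (of_nat CARD('p) * e) + E \<in> outer_cone C"
proof -
  define \<delta> :: "'p \<Rightarrow> 'p \<Rightarrow> real" where "\<delta> i a = (if a = i then 1 else 0)" for i a
  define U :: "'p \<Rightarrow> 'p \<Rightarrow> 'n rpoly ^ 'p ^ 'p" where
    "U i j = (\<chi> a b. (Const (1/4) * (e + E $ i $ j)) * Const (\<delta> i a + \<delta> j a) * Const (\<delta> i b + \<delta> j b))" for i j
  define V :: "'p \<Rightarrow> 'p \<Rightarrow> 'n rpoly ^ 'p ^ 'p" where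
    "V i j = (\<chi> a b. (Const (1/4) * (e - E $ i $ j)) * Const (\<delta> i a - \<delta> j a) * Const (\<delta> i b - \<delta> j b))" for i j
  have "U i j \<in> outer_cone C" "V i j \<in> outer_cone C" for i j
    unfolding U_def V_def using bd[of i j] unfolding bounded_by_def
    by (auto intro!: outer_cone.outer ball_preorder_mult ball_preorder_Const)
  then have "(\<Sum>i\<in>UNIV. \<Sum>j\<in>UNIV. U i j + V i j) \<in> outer_cone C"
    by (intro outer_cone_sum outer_cone.add)
  also have "(\<Sum>i\<in>UNIV. \<Sum>j\<in>UNIV. U i j + V i j) = mat (of_nat CARD('p) * e) + E"
  proof -
    have symE: "E $ i $ j = E $ j $ i" for i j
      using sym unfolding sym_mat_def transpose_def by (metis vec_lambda_beta)
    define D :: "'p \<Rightarrow> 'p \<Rightarrow> 'n rpoly" where "D i a = (if a = i then 1 else 0)" for i a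
    have D: "Const (\<delta> i a + \<delta> j a) = D i a + D j a" "Const (\<delta> i a - \<delta> j a) = D i a - D j a" for i j a
      by (simp_all add: \<delta>_def D_def Const_add Const_diff)
    have four: "Const (1/4) * (x + x + x + x) = x" for x :: "'n rpoly"
    proof -
      have "Const (1/4) * (x + x + x + x) = (Const (1/4) + Const (1/4) + Const (1/4) + Const (1/4)) * x"
        by (simp add: algebra_simps)
      then show ?thesis by (simp flip: Const_add)
    qed
    have sumD: "(\<Sum>i\<in>UNIV. D i a * f i) = f a" for a and f :: "'p \<Rightarrow> 'n rpoly"
    proof -
      have "(\<Sum>i\<in>UNIV. D i a * f i) = (\<Sum>i\<in>UNIV. if a = i then f i else 0)"
        by (rule sum.cong) (auto simp: D_def)
      then show ?thesis by simp
    qed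
    define W where "W i j a b =
      e * (D i a * D i b + D j a * D j b) + E $ i $ j * (D i a * D j b + D j a * D i b)" for i j a b
    have "(U i j + V i j) $ a $ b = Const (1/4) * (W i j a b + W i j a b)" for i j a b
      by (simp add: U_def V_def W_def D algebra_simps)
    then have UV: "(\<Sum>i\<in>UNIV. \<Sum>j\<in>UNIV. U i j + V i j) $ a $ b
        = Const (1/4) * (\<Sum>i\<in>UNIV. \<Sum>j\<in>UNIV. W i j a b + W i j a b)" for a b
      by (simp add: sum_distrib_left)
    have W: "(\<Sum>i\<in>UNIV. \<Sum>j\<in>UNIV. W i j a b)
       = (of_nat CARD('p) * e * D a b + E $ a $ b) + (of_nat CARD('p) * e * D a b + E $ a $ b)" for a b
    proof -
      have 1: "(\<Sum>i\<in>UNIV. \<Sum>j\<in>(UNIV::'p set). e * (D i a * D i b)) = of_nat CARD('p) * e * D a b"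
        using sumD[of a "\<lambda>i. of_nat CARD('p) * e * D i b"] by (simp add: mult_ac)
      then have 2: "(\<Sum>i\<in>(UNIV::'p set). \<Sum>j\<in>UNIV. e * (D j a * D j b)) = of_nat CARD('p) * e * D a b"
        by (subst sum.swap)
      have 3: "(\<Sum>i\<in>UNIV. \<Sum>j\<in>UNIV. E $ i $ j * (D i a * D j b)) = E $ a $ b" for a b
      proof -
        have "(\<Sum>i\<in>UNIV. \<Sum>j\<in>UNIV. E $ i $ j * (D i a * D j b))
            = (\<Sum>i\<in>UNIV. D i a * (\<Sum>j\<in>UNIV. D j b * E $ i $ j))"
          by (simp add: sum_distrib_left mult_ac)
        then show ?thesis by (simp add: sumD)
      qed
      have 4: "(\<Sum>i\<in>UNIV. \<Sum>j\<in>UNIV. E $ i $ j * (D j a * D i b)) = E $ a $ b"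
        using 3[of b a] symE[of a b] by (simp add: mult_ac)
      show ?thesis
        unfolding W_def distrib_left sum.distrib 1 2 3 4 by (simp add: algebra_simps)
    qed
    have "(\<Sum>i\<in>UNIV. \<Sum>j\<in>UNIV. U i j + V i j) $ a $ b = of_nat CARD('p) * e * D a b + E $ a $ b" for a b
    proof -
      have "(\<Sum>i\<in>UNIV. \<Sum>j\<in>UNIV. U i j + V i j) $ a $ b
          = Const (1/4) * ((\<Sum>i\<in>UNIV. \<Sum>j\<in>UNIV. W i j a b) + (\<Sum>i\<in>UNIV. \<Sum>j\<in>UNIV. W i j a b))"
        unfolding UV by (simp only: sum.distrib)
      then show ?thesis
        unfolding W using four[of "of_nat CARD('p) * e * D a b + E $ a $ b"] by (simp only: add.assoc)
    qed
    then show ?thesis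
      by (simp add: vec_eq_iff mat_def D_def)
  qed
  finally show ?thesis .
qed

lemma mat_add: "mat (a + b) = mat a + mat b" for a b :: "'a::monoid_add"
  by (auto simp: vec_eq_iff mat_def)

lemma mat_diff: "mat (a - b) = mat a - mat b" for a b :: "'a::group_add"
  by (auto simp: vec_eq_iff mat_def)

definition qform :: "'n::finite rpoly ^ 'p::finite ^ 'p \<Rightarrow> real ^ 'n \<Rightarrow> real ^ 'p \<Rightarrow> real" where
  "qform F a v = v \<bullet> (map_mat (eval_poly a) F *v v)"

lemma continuous_on_qform: "continuous_on A (\<lambda>z. qform F (fst z) (snd z))"
  unfolding qform_def inner_vec_def matrix_vector_mult_def map_mat_def
  by (auto intro!: continuous_intros continuous_on_compose2[OF continuous_on_eval_poly[of UNIV]])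

lemma qform_scaleR: "qform F a (c *\<^sub>R v) = c\<^sup>2 * qform F a v"
  by (simp add: qform_def matrix_vector_mult_scaleR power2_eq_square)

lemma qform_normalize:
  assumes "\<And>u. norm u = 1 \<Longrightarrow> qform F a u \<ge> \<delta>"
  shows "qform F a v \<ge> \<delta> * (v \<bullet> v)"
proof (cases "v = 0")
  case False
  have "qform F a (norm v *\<^sub>R sgn v) = (v \<bullet> v) * qform F a (sgn v)"
    unfolding qform_scaleR by (simp add: power2_norm_eq_inner)
  moreover have "norm v *\<^sub>R sgn v = v" using False by (simp add: sgn_div_norm)
  moreover have "\<delta> \<le> qform F a (sgn v)" using False by (intro assms) (simp add: norm_sgn)
  ultimately show ?thesis
    by (simp add: mult.commute[of \<delta>] mult_left_mono)
qed (simp add: qform_def)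

lemma sym_mat_map_mat: "sym_mat F \<Longrightarrow> sym_mat (map_mat h F)"
  by (auto simp: sym_mat_def transpose_def map_mat_def vec_eq_iff)

lemma pos_def_iff_qform:
  assumes "sym_mat F"
  shows "pos_def (map_mat (eval_poly a) F) \<longleftrightarrow> (\<forall>v. norm v = 1 \<longrightarrow> qform F a v > 0)"
proof
  assume *: "\<forall>v. norm v = 1 \<longrightarrow> qform F a v > 0"
  have "qform F a v > 0" if "v \<noteq> 0" for v
  proof -
    have "qform F a (norm v *\<^sub>R sgn v) = (norm v)\<^sup>2 * qform F a (sgn v)"
      by (rule qform_scaleR)
    moreover have "norm v *\<^sub>R sgn v = v" using that by (simp add: sgn_div_norm)
    ultimately show ?thesis using * that by (simp add: norm_sgn)
  qed
  then show "pos_def (map_mat (eval_poly a) F)"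
    using assms by (simp add: pos_def_def qform_def sym_mat_map_mat)
next
  assume "pos_def (map_mat (eval_poly a) F)"
  then show "\<forall>v. norm v = 1 \<longrightarrow> qform F a v > 0"
    unfolding pos_def_def qform_def by (metis norm_zero zero_neq_one)
qed

lemma pos_def_uniform:
  fixes F :: "'n::finite rpoly ^ 'p::finite ^ 'p"
  assumes "compact K" "sym_mat F" "\<And>a. a \<in> K \<Longrightarrow> pos_def (map_mat (eval_poly a) F)"
  shows "\<exists>\<delta>>0. \<forall>a\<in>K. \<forall>v. qform F a v \<ge> \<delta> * (v \<bullet> v)"
proof (cases "K = {}")
  case False
  let ?Z = "K \<times> sphere (0::real^'p) 1"
  have "compact ?Z" using assms(1) by (intro compact_Times compact_sphere)
  moreover have "?Z \<noteq> {}" using False by auto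
  ultimately have "\<exists>z\<in>?Z. \<forall>w\<in>?Z. qform F (fst z) (snd z) \<le> qform F (fst w) (snd w)"
    by (intro continuous_attains_inf continuous_on_qform)
  then obtain z where z: "z \<in> ?Z"
    and min: "\<And>w. w \<in> ?Z \<Longrightarrow> qform F (fst z) (snd z) \<le> qform F (fst w) (snd w)"
    by metis
  show ?thesis
  proof (intro exI conjI ballI allI)
    show "qform F (fst z) (snd z) > 0"
      using z assms pos_def_iff_qform[OF assms(2)] by auto
    show "qform F a v \<ge> qform F (fst z) (snd z) * (v \<bullet> v)" if "a \<in> K" for a v
      by (rule qform_normalize) (use min[of "(a, _)"] that in auto)
  qed
qed (auto intro: exI[of _ 1])

text \<open>
  With \<open>h = 1/(2r)\<close>, the weights \<open>h (r + x)\<close> and \<open>h (r - x)\<close> sum to one and are the probabilities of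
  a step \<open>r\<close> or \<open>-r\<close> with mean \<open>x\<close>. The expected square of \<open>y + x\<close> minus the step is \<open>y\<^sup>2\<close> plus the
  variance \<open>r\<^sup>2 - x\<^sup>2\<close>.
\<close>

lemma random_walk_step:
  fixes h r x y :: "'a::comm_ring_1"
  assumes "h * (r + r) = 1"
  shows "h * (r + x) * ((y + x - r) * (y + x - r)) + h * (r - x) * ((y + x + r) * (y + x + r))
       = y * y + (r * r - x * x)"
proof -
  have "h * (r + x) * ((y + x - r) * (y + x - r)) + h * (r - x) * ((y + x + r) * (y + x + r))
      = (h * (r + r)) * (y * y + (r * r - x * x))"
    by (simp add: algebra_simps)
  then show ?thesis by (simp only: assms mult_1)
qed

text \<open>
  This turns the local certificates at the points \<open>a\<close> of the cube into a global one, in the way in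
  which Bernstein polynomials approximate a function. In each coordinate \<open>l\<close> take \<open>d\<close> independent
  steps \<open>\<plusminus>R\<close> with mean \<open>x\<^sub>l\<close>, with probabilities \<open>(R \<plusminus> x\<^sub>l)/(2R)\<close> that belong to the preorder. After
  \<open>j\<^sub>l\<close> steps with sum \<open>s\<^sub>l\<close>, the expected final value of \<open>|d x - s|\<^sup>2\<close> is the sum over \<open>l\<close> in the
  definition of \<open>\<Phi>\<close>. Hence \<open>\<Phi>\<close> at \<open>(j, s)\<close> is the average of \<open>\<Phi>\<close> over the next step, and membership in
  the cone propagates backwards from the final positions, where it is the hypothesis at \<open>a = s/d\<close>.
\<close>

lemma outer_cone_random_walk:
  fixes F :: "'n::finite rpoly ^ 'p::finite ^ 'p"
  assumes "R > 0" and d: "d > 0"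
    and loc: "\<And>a. a \<in> cube R \<Longrightarrow> F + mat (Const c * sqdist a) \<in> outer_cone (R\<^sup>2)"
  defines "\<Phi> \<equiv> \<lambda>j s. F + mat (Const (c / (real d)\<^sup>2) * (\<Sum>l\<in>UNIV.
      (Const (real (j l)) * Var l - Const (s l)) * (Const (real (j l)) * Var l - Const (s l))
      + Const (real d - real (j l)) * (Const R * Const R - Var l * Var l)))"
  assumes "\<And>l. j l \<le> d" "\<And>l. \<bar>s l\<bar> \<le> real (j l) * R"
  shows "\<Phi> j s \<in> outer_cone (R\<^sup>2)"
  using assms(5,6)
proof (induction "\<Sum>l\<in>UNIV. d - j l" arbitrary: j s rule: less_induct)
  case less
  show ?case
  proof (cases "\<forall>l. j l = d")
    case True
    define a where "a = (\<chi> l. s l / real d)"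
    have "a \<in> cube R"
      using less.prems(2) True d by (simp add: cube_iff a_def divide_le_eq mult.commute)
    moreover have "\<Phi> j s = F + mat (Const c * sqdist a)"
    proof -
      have "(Const (real d) * Var l - Const (s l)) = Const (real d) * (Var l - Const (a $ l))" for l
        using d by (simp add: a_def right_diff_distrib flip: Const_mult)
      then have "(\<Sum>l\<in>UNIV. (Const (real (j l)) * Var l - Const (s l)) * (Const (real (j l)) * Var l - Const (s l))
            + Const (real d - real (j l)) * (Const R * Const R - Var l * Var l))
          = Const ((real d)\<^sup>2) * sqdist a"
        by (simp add: True sqdist_def sum_distrib_left Const_mult power2_eq_square mult_ac)
      moreover have "Const (c / (real d)\<^sup>2) * (Const ((real d)\<^sup>2) * sqdist a) = Const c * sqdist a"
        using d by (simp add: mult.assoc[symmetric] flip: Const_mult)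
      ultimately show ?thesis by (simp add: \<Phi>_def)
    qed
    ultimately show ?thesis using loc by metis
  next
    case False
    then obtain l where l: "j l < d" using less.prems(1) by (metis order_le_less)
    let ?j = "j(l := Suc (j l))"
    have dec: "(\<Sum>k\<in>UNIV. d - ?j k) < (\<Sum>k\<in>UNIV. d - j k)"
      by (rule sum_strict_mono_ex1) (use l in auto)
    have IH: "\<Phi> ?j (s(l := s l + \<sigma> * R)) \<in> outer_cone (R\<^sup>2)" if "\<bar>\<sigma>\<bar> = 1" for \<sigma>
    proof (rule less.hyps[OF dec])
      show "?j k \<le> d" for k using less.prems(1)[of k] l by auto
      have "\<bar>s l + \<sigma> * R\<bar> \<le> \<bar>s l\<bar> + \<bar>\<sigma>\<bar> * \<bar>R\<bar>"
        by (metis abs_mult abs_triangle_ineq)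
      then show "\<bar>(s(l := s l + \<sigma> * R)) k\<bar> \<le> real (?j k) * R" for k
        using less.prems(2)[of k] that \<open>R > 0\<close> by (auto simp: algebra_simps)
    qed
    define h :: "'n rpoly" where "h = Const (1 / (2 * R))"
    let ?r = "Const R :: 'n rpoly"
    have h: "h * (?r + ?r) = 1" using \<open>R > 0\<close> by (simp add: h_def flip: Const_mult Const_add)
    define u where "u = h * (?r + Var l)"
    define u' where "u' = h * (?r - Var l)"
    have u_sum: "u + u' = 1" unfolding u_def u'_def using h by (simp add: algebra_simps)
    have "u \<in> ball_preorder (R\<^sup>2)" "u' \<in> ball_preorder (R\<^sup>2)"
      unfolding u_def u'_def h_def
      using ball_preorder_linear[of R 1 l] ball_preorder_linear[of R "-1" l] \<open>R > 0\<close>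
      by (auto intro!: ball_preorder_mult ball_preorder_Const simp: Const_minus)
    then have step: "map_mat ((*) u) (\<Phi> ?j (s(l := s l + 1 * R))) + map_mat ((*) u') (\<Phi> ?j (s(l := s l + (-1) * R)))
        \<in> outer_cone (R\<^sup>2)"
      by (intro outer_cone.add outer_cone_smult IH) auto
    define e where "e j s = (\<Sum>l\<in>UNIV.
      (Const (real (j l)) * Var l - Const (s l)) * (Const (real (j l)) * Var l - Const (s l))
      + Const (real d - real (j l)) * (Const R * Const R - Var l * Var l) :: 'n rpoly)" for j :: "'n \<Rightarrow> nat" and s
    define y where "y = Const (real (j l)) * Var l - (Const (s l) :: 'n rpoly)"
    define rest where "rest = (\<Sum>k\<in>UNIV-{l}.
      (Const (real (j k)) * Var k - Const (s k)) * (Const (real (j k)) * Var k - Const (s k))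
      + Const (real d - real (j k)) * (Const R * Const R - Var k * Var k) :: 'n rpoly)"
    define w where "w = Const (real d - real (Suc (j l))) * (?r * ?r - Var l * Var l)"
    have e0: "e j s = y * y + (?r * ?r - Var l * Var l) + (w + rest)"
    proof -
      have "Const (real d - real (j l)) * (?r * ?r - Var l * Var l) = (?r * ?r - Var l * Var l) + w"
        by (simp add: w_def Const_add Const_diff algebra_simps)
      then show ?thesis
        unfolding e_def sum_split1[of _ l] rest_def[symmetric] y_def[symmetric]
        by (simp add: add_ac)
    qed
    have e1: "e ?j (s(l := s l + \<sigma> * R)) = (y + Var l - Const \<sigma> * ?r) * (y + Var l - Const \<sigma> * ?r) + (w + rest)" for \<sigma>
    proof -
      have "Const (real (Suc (j l))) * Var l - Const (s l + \<sigma> * R) = y + Var l - Const \<sigma> * ?r"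
        by (simp add: y_def Const_add Const_mult algebra_simps)
      moreover have "(\<Sum>k\<in>UNIV-{l}.
          (Const (real (?j k)) * Var k - Const ((s(l := s l + \<sigma> * R)) k)) * (Const (real (?j k)) * Var k - Const ((s(l := s l + \<sigma> * R)) k))
          + Const (real d - real (?j k)) * (Const R * Const R - Var k * Var k)) = rest"
        unfolding rest_def by (rule sum.cong) auto
      ultimately show ?thesis
        unfolding e_def sum_split1[of _ l] w_def by (simp add: add_ac)
    qed
    have e: "u * e ?j (s(l := s l + 1 * R)) + u' * e ?j (s(l := s l + (-1) * R)) = e j s"
    proof -
      have "u * (p + (w + rest)) + u' * (q + (w + rest)) = (u * p + u' * q) + (u + u') * (w + rest)" for p q
        by (simp add: algebra_simps)
      then show ?thesis
        unfolding e0 e1 u_sum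
        using random_walk_step[OF h, where x = "Var l" and y = y]
        by (simp add: u_def u'_def Const_minus mult.assoc)
    qed
    have "map_mat ((*) u) (F + mat (k * p)) + map_mat ((*) u') (F + mat (k * q))
        = F + mat (k * (u * p + u' * q))" for k p q
    proof -
      have 1: "u * f + u' * f = f" for f using u_sum by (metis distrib_right mult_1)
      have 2: "u * (f + k * p) + u' * (f + k * q) = f + k * (u * p + u' * q)" for f
        using 1[of f] by (simp add: algebra_simps)
      show ?thesis
        by (simp add: vec_eq_iff map_mat_def mat_def 1 2)
    qed
    then have "map_mat ((*) u) (\<Phi> ?j (s(l := s l + 1 * R))) + map_mat ((*) u') (\<Phi> ?j (s(l := s l + (-1) * R))) = \<Phi> j s"
      unfolding \<Phi>_def e_def[symmetric] e[symmetric] by blast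
    then show ?thesis using step by metis
  qed
qed

text \<open>
  Near \<open>a\<close> the matrix \<open>F\<close> is \<open>F(a) - \<delta> I\<close>, a constant positive semidefinite matrix, plus \<open>\<delta> I\<close>, plus an
  error bounded by \<open>\<delta>/2\<close> and a multiple of the squared distance to \<open>a\<close>. The random walk started at the
  origin replaces that squared distance by its expectation, which is of order \<open>1/d\<close>, and the remaining
  \<open>\<delta>/2\<close> absorbs it when \<open>d\<close> is large.
\<close>

theorem outer_cone_positivstellensatz_cube:
  fixes F :: "'n::finite rpoly ^ 'p::finite ^ 'p"
  assumes R: "R > 0" and sym: "sym_mat F"
    and pos: "\<And>a. a \<in> cube R \<Longrightarrow> pos_def (map_mat (eval_poly a) F)"
  shows "F \<in> outer_cone (R\<^sup>2)"
proof -
  obtain \<delta> where \<delta>: "\<delta> > 0" "\<And>a v. a \<in> cube R \<Longrightarrow> qform F a v \<ge> \<delta> * (v \<bullet> v)"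
    using pos_def_uniform[OF compact_cube sym pos] by blast
  let ?p = "real CARD('p)"
  define \<epsilon> where "\<epsilon> = \<delta> / (2 * ?p)"
  have "\<epsilon> > 0" using \<delta>(1) by (simp add: \<epsilon>_def)
  have "\<forall>i j. \<exists>c\<ge>0. \<forall>a\<in>cube R. bounded_by (R\<^sup>2) (Const \<epsilon> + Const c * sqdist a)
      (F $ i $ j - Const (eval_poly a (F $ i $ j)))"
    using bounded_by_sqdist[OF R] \<open>\<epsilon> > 0\<close> by blast
  then obtain c where c0: "\<And>i j. c i j \<ge> 0"
    and c: "\<And>i j a. a \<in> cube R \<Longrightarrow> bounded_by (R\<^sup>2) (Const \<epsilon> + Const (c i j) * sqdist a)
      (F $ i $ j - Const (eval_poly a (F $ i $ j)))"
    by metis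
  define c' where "c' = (\<Sum>i\<in>UNIV. \<Sum>j\<in>UNIV. c i j)"
  have "c' \<ge> 0" unfolding c'_def by (intro sum_nonneg c0)
  have cc': "c i j \<le> c'" for i j
  proof -
    have "c i j \<le> (\<Sum>j\<in>UNIV. c i j)" by (rule member_le_sum) (auto simp: c0)
    also have "\<dots> \<le> c'" unfolding c'_def by (rule member_le_sum) (auto simp: c0 sum_nonneg)
    finally show ?thesis .
  qed
  define F' where "F' = F - mat (Const (\<delta> / 2))"
  have loc: "F' + mat (Const (?p * c') * sqdist a) \<in> outer_cone (R\<^sup>2)" if a: "a \<in> cube R" for a
  proof -
    define Fa where "Fa = map_mat (eval_poly a) F"
    have "psd (Fa - mat \<delta>)"
      unfolding psd_def
    proof (intro conjI allI)
      show "sym_mat (Fa - mat \<delta>)"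
        using sym_mat_map_mat[OF sym, of "eval_poly a"]
        by (auto simp: Fa_def sym_mat_def transpose_def vec_eq_iff mat_def)
      fix v
      have "(mat \<delta> :: real^'p^'p) *v v = \<delta> *\<^sub>R v"
      proof -
        have "(mat \<delta> :: real^'p^'p) = \<delta> *\<^sub>R mat 1" by (simp add: vec_eq_iff mat_def)
        then show ?thesis by (simp add: scaleR_matrix_vector_assoc[symmetric])
      qed
      then show "0 \<le> v \<bullet> ((Fa - mat \<delta>) *v v)"
        using \<delta>(2)[OF a, of v]
        by (simp add: qform_def Fa_def matrix_vector_mult_diff_rdistrib inner_diff_right)
    qed
    then have 1: "map_mat Const (Fa - mat \<delta>) \<in> (outer_cone (R\<^sup>2) :: ('n rpoly ^ 'p ^ 'p) set)"
      by (rule outer_cone_psd)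
    have "bounded_by (R\<^sup>2) (Const \<epsilon> + Const c' * sqdist a) ((F - map_mat Const Fa) $ i $ j)" for i j
    proof -
      have "bounded_by (R\<^sup>2) (Const (c' - c i j) * sqdist a) 0"
        using cc'[of i j] by (auto simp: bounded_by_def intro!: ball_preorder_sos sos_mult sos_Const sqdist_sos)
      from bounded_by_add[OF c[OF a, of i j] this] show ?thesis
        by (simp add: Fa_def map_mat_def Const_diff algebra_simps)
    qed
    moreover have "sym_mat (F - map_mat Const Fa)"
      using sym sym_mat_map_mat[OF sym, of "Const \<circ> eval_poly a"]
      by (auto simp: sym_mat_def transpose_def vec_eq_iff map_mat_def Fa_def)
    ultimately have 2: "mat (of_nat CARD('p) * (Const \<epsilon> + Const c' * sqdist a)) + (F - map_mat Const Fa) \<in> outer_cone (R\<^sup>2)"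
      by (intro outer_cone_small_perturbation) auto
    have p\<epsilon>: "?p * \<epsilon> = \<delta> - \<delta> / 2" by (simp add: \<epsilon>_def)
    have "of_nat CARD('p) * (Const \<epsilon> + Const c' * sqdist a) = Const (?p * \<epsilon>) + Const (?p * c') * sqdist a"
      by (simp add: Const_mult Const_of_nat algebra_simps)
    also have "Const (?p * \<epsilon>) = (Const (\<delta> - \<delta> / 2) :: 'n rpoly)"
      by (simp only: p\<epsilon>)
    finally have 3: "of_nat CARD('p) * (Const \<epsilon> + Const c' * sqdist a) = Const \<delta> - Const (\<delta> / 2) + Const (?p * c') * sqdist a"
      by (simp only: Const_diff)
    have 4: "map_mat Const (Fa - mat \<delta>) = map_mat Const Fa - mat (Const \<delta>)"
      by (auto simp: vec_eq_iff map_mat_def mat_def Const_diff)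
    have "map_mat Const (Fa - mat \<delta>) + (mat (of_nat CARD('p) * (Const \<epsilon> + Const c' * sqdist a)) + (F - map_mat Const Fa))
        = F' + mat (Const (?p * c') * sqdist a)"
      unfolding 3 4 F'_def mat_add mat_diff by simp
    then show ?thesis using outer_cone.add[OF 1 2] by simp
  qed
  let ?n = "real CARD('n)"
  obtain d :: nat where d: "real d > 2 * (?p * c' * ?n * R\<^sup>2) / \<delta>"
    using reals_Archimedean2 by blast
  moreover have "2 * (?p * c' * ?n * R\<^sup>2) / \<delta> \<ge> 0" using \<open>c' \<ge> 0\<close> \<delta>(1) by simp
  ultimately have "d > 0" by (metis of_nat_0_less_iff order_le_less_trans)
  let ?k = "?p * c' / (real d)\<^sup>2"
  have "?k \<ge> 0" using \<open>c' \<ge> 0\<close> by simp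
  have "F' + mat (Const ?k * (\<Sum>l\<in>UNIV. Const (real d) * (Const R * Const R - Var l * Var l))) \<in> outer_cone (R\<^sup>2)"
    using outer_cone_random_walk[OF R \<open>d > 0\<close> loc, where j = "\<lambda>_. 0" and s = "\<lambda>_. 0"] by simp
  moreover have "mat (Const ?k * (\<Sum>l\<in>UNIV. Const (real d) * (Var l * Var l))) \<in> (outer_cone (R\<^sup>2) :: ('n rpoly ^ 'p ^ 'p) set)"
    using \<open>?k \<ge> 0\<close>
    by (intro outer_cone_mat ball_preorder_mult ball_preorder_sum ball_preorder_Const ball_preorder_sos sos.square) auto
  moreover have "mat (Const (\<delta> / 2 - ?k * (?n * (real d * R\<^sup>2)))) \<in> (outer_cone (R\<^sup>2) :: ('n rpoly ^ 'p ^ 'p) set)"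
  proof -
    have "?k * (?n * (real d * R\<^sup>2)) = (?p * c' * ?n * R\<^sup>2) / real d"
      using \<open>d > 0\<close> by (simp add: field_simps power2_eq_square)
    also have "\<dots> \<le> \<delta> / 2"
      using d \<open>d > 0\<close> \<delta>(1) by (simp add: field_simps)
    finally show ?thesis by (intro outer_cone_mat ball_preorder_Const) simp
  qed
  ultimately have inM: "F' + mat (Const ?k * (\<Sum>l\<in>UNIV. Const (real d) * (Const R * Const R - Var l * Var l)))
      + mat (Const ?k * (\<Sum>l\<in>UNIV. Const (real d) * (Var l * Var l)))
      + mat (Const (\<delta> / 2 - ?k * (?n * (real d * R\<^sup>2)))) \<in> outer_cone (R\<^sup>2)"
    by (intro outer_cone.add[OF outer_cone.add])
  have eqF: "F' + mat (Const ?k * (\<Sum>l\<in>UNIV. Const (real d) * (Const R * Const R - Var l * Var l)))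
      + mat (Const ?k * (\<Sum>l\<in>UNIV. Const (real d) * (Var l * Var l)))
      + mat (Const (\<delta> / 2 - ?k * (?n * (real d * R\<^sup>2)))) = F"
  proof -
    have "(\<Sum>l\<in>UNIV. Const (real d) * (Const R * Const R - Var l * Var l))
        + (\<Sum>l\<in>UNIV. Const (real d) * (Var l * Var l))
        = (of_nat CARD('n) * (Const (real d) * (Const R * Const R)) :: 'n rpoly)"
      by (subst sum.distrib[symmetric]) (simp add: right_diff_distrib)
    also have "\<dots> = Const (?n * (real d * R\<^sup>2))"
      by (simp only: Const_mult Const_of_nat power2_eq_square)
    finally have "Const ?k * (\<Sum>l\<in>UNIV. Const (real d) * (Const R * Const R - Var l * Var l))
        + Const ?k * (\<Sum>l\<in>UNIV. Const (real d) * (Var l * Var l))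
        = (Const (?k * (?n * (real d * R\<^sup>2))) :: 'n rpoly)"
      by (simp only: distrib_left[symmetric] Const_mult[of ?k])
    then have eq: "mat (Const ?k * (\<Sum>l\<in>UNIV. Const (real d) * (Const R * Const R - Var l * Var l)))
      + mat (Const ?k * (\<Sum>l\<in>UNIV. Const (real d) * (Var l * Var l)))
      = (mat (Const (?k * (?n * (real d * R\<^sup>2)))) :: 'n rpoly ^ 'p ^ 'p)"
      unfolding mat_add[symmetric] by (rule arg_cong)
    have "F' + A + B + mat (Const (\<delta> / 2 - c)) = F" if "A + B = mat (Const c)" for A B c
      using that unfolding F'_def Const_diff mat_diff by (simp add: algebra_simps)
    from this[OF eq] show ?thesis .
  qed
  show ?thesis using inM unfolding eqF .
qed

section \<open>Penalizing the complement of the feasible set\<close>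

text \<open>
  Bernoulli's inequality shows that \<open>t (1 - t)\<^sup>2\<^sup>k\<close> is at most of order \<open>1/k\<close> on the unit interval, while
  it tends to minus infinity at a linear rate for negative \<open>t\<close>.
\<close>

lemma penalty_bounds:
  fixes t :: real
  assumes "\<bar>t\<bar> \<le> 1" "k > 0"
  shows "t * (1 - t) ^ (2 * k) \<le> 1 / (2 * real k)"
    and "\<eta> \<ge> 0 \<Longrightarrow> t \<le> - \<eta> \<Longrightarrow> t * (1 - t) ^ (2 * k) \<le> - (2 * real k * \<eta>\<^sup>2)"
proof -
  show "t * (1 - t) ^ (2 * k) \<le> 1 / (2 * real k)"
  proof (cases "t \<le> 0")
    case True
    then have "t * (1 - t) ^ (2 * k) \<le> 0" by (simp add: mult_nonpos_nonneg)
    also have "0 \<le> 1 / (2 * real k)" by simp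
    finally show ?thesis .
  next
    case False
    have "(1 + t) ^ (2 * k) \<ge> 1 + real (2 * k) * t"
      using False by (intro Bernoulli_inequality) simp
    moreover have "(1 - t) ^ (2 * k) * (1 + t) ^ (2 * k) \<le> 1"
    proof -
      have "(1 - t) ^ (2 * k) * (1 + t) ^ (2 * k) = (1 - t * t) ^ (2 * k)"
        by (simp add: power_mult_distrib[symmetric] algebra_simps)
      also have "\<dots> \<le> 1"
        using assms(1) by (intro power_le_one) (auto simp: abs_le_square_iff[of t 1, simplified] power2_eq_square)
      finally show ?thesis .
    qed
    ultimately have "(1 - t) ^ (2 * k) * (1 + real (2 * k) * t) \<le> 1"
      using False assms(1) by (meson mult_left_mono order_trans zero_le_power diff_ge_0_iff_ge abs_le_D1)
    moreover have "(1 - t) ^ (2 * k) * (real (2 * k) * t) \<le> (1 - t) ^ (2 * k) * (1 + real (2 * k) * t)"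
      using assms(1) by (intro mult_left_mono) auto
    ultimately have "(1 - t) ^ (2 * k) * (real (2 * k) * t) \<le> 1" by linarith
    then show ?thesis using assms(2) by (simp add: field_simps)
  qed
next
  assume "\<eta> \<ge> 0" "t \<le> - \<eta>"
  have "2 * real k * \<eta>\<^sup>2 \<le> \<eta> * (1 + real (2 * k) * \<eta>)"
    using \<open>\<eta> \<ge> 0\<close> by (simp add: power2_eq_square algebra_simps)
  also have "\<dots> \<le> \<eta> * (1 + \<eta>) ^ (2 * k)"
    using \<open>\<eta> \<ge> 0\<close> by (intro mult_left_mono Bernoulli_inequality) auto
  also have "\<dots> \<le> (- t) * (1 - t) ^ (2 * k)"
    using \<open>\<eta> \<ge> 0\<close> \<open>t \<le> - \<eta>\<close> by (intro mult_mono power_mono) auto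
  finally show "t * (1 - t) ^ (2 * k) \<le> - (2 * real k * \<eta>\<^sup>2)" by simp
qed

text \<open>
  By compactness there are finitely many elements \<open>q\<close> of \<open>\<Q>\<close>, scaled to be at most one in absolute value,
  one of which is negative wherever \<open>\<Phi>\<close> is not positive, and there is a margin \<open>\<eta>\<close> such that
  everywhere \<open>\<Phi> \<ge> \<eta>\<close> or some \<open>q \<le> -\<eta>\<close>. The sum of the \<open>q (1 - q)\<^sup>2\<^sup>k\<close> then works for large \<open>k\<close>: it is
  below \<open>\<eta>\<close> everywhere and below the minimum of \<open>\<Phi>\<close> where some \<open>q \<le> -\<eta>\<close>.
\<close>

lemma compact_penalty:
  fixes Z :: "'a::metric_space set" and \<Phi> :: "'a \<Rightarrow> real" and \<Q> :: "('a \<Rightarrow> real) set"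
  assumes Z: "compact Z" and \<Phi>: "continuous_on Z \<Phi>"
    and cont: "\<And>q. q \<in> \<Q> \<Longrightarrow> continuous_on Z q"
    and zero: "(\<lambda>_. 0) \<in> \<Q>"
    and add: "\<And>p q. p \<in> \<Q> \<Longrightarrow> q \<in> \<Q> \<Longrightarrow> (\<lambda>z. p z + q z) \<in> \<Q>"
    and scale: "\<And>c q. c \<ge> 0 \<Longrightarrow> q \<in> \<Q> \<Longrightarrow> (\<lambda>z. c * q z) \<in> \<Q>"
    and penal: "\<And>q k. q \<in> \<Q> \<Longrightarrow> (\<lambda>z. q z * (1 - q z) ^ (2 * k)) \<in> \<Q>"
    and alt: "\<And>z. z \<in> Z \<Longrightarrow> \<Phi> z > 0 \<or> (\<exists>q\<in>\<Q>. q z < 0)"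
  shows "\<exists>q\<in>\<Q>. \<forall>z\<in>Z. q z < \<Phi> z"
proof (cases "Z = {}")
  case True
  then show ?thesis using zero by auto
next
  case False
  define \<B> where "\<B> = {q \<in> \<Q>. \<forall>z\<in>Z. \<bar>q z\<bar> \<le> 1}"
  have alt': "\<exists>q\<in>\<B>. \<Phi> z > 0 \<or> q z < 0" if z: "z \<in> Z" for z
  proof (cases "\<Phi> z > 0")
    case True
    then show ?thesis using zero by (intro bexI[of _ "\<lambda>_. 0"]) (auto simp: \<B>_def)
  next
    case False
    then obtain q where q: "q \<in> \<Q>" "q z < 0" using alt[OF z] by blast
    have "bounded (q ` Z)"
      using compact_continuous_image[OF cont[OF q(1)] Z] by (rule compact_imp_bounded)
    then obtain B where B: "B > 0" "\<And>z. z \<in> Z \<Longrightarrow> \<bar>q z\<bar> \<le> B"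
      unfolding bounded_pos by auto
    have "(\<lambda>z. (1 / B) * q z) \<in> \<B>"
      unfolding \<B>_def using B q(1) scale[of "1 / B" q] by (simp add: abs_mult)
    moreover have "(1 / B) * q z < 0" using B(1) q(2) by (simp add: divide_neg_pos)
    ultimately show ?thesis by (intro bexI[of _ "\<lambda>z. (1 / B) * q z"]) auto
  qed
  define U where "U q = {z \<in> Z. \<Phi> z > 0 \<or> q z < 0}" for q :: "'a \<Rightarrow> real"
  have "openin (top_of_set Z) (U q)" if "q \<in> \<B>" for q
  proof -
    have "openin (top_of_set Z) (Z \<inter> \<Phi> -` {0<..})" "openin (top_of_set Z) (Z \<inter> q -` {..<0})"
      using that \<Phi> cont by (auto simp: \<B>_def intro: continuous_openin_preimage_gen)
    then have "openin (top_of_set Z) ((Z \<inter> \<Phi> -` {0<..}) \<union> (Z \<inter> q -` {..<0}))" by blast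
    also have "(Z \<inter> \<Phi> -` {0<..}) \<union> (Z \<inter> q -` {..<0}) = U q" by (auto simp: U_def)
    finally show ?thesis .
  qed
  moreover have "Z \<subseteq> \<Union>(U ` \<B>)" using alt' by (fastforce simp: U_def)
  ultimately obtain \<D> where \<D>: "\<D> \<subseteq> \<B>" "finite \<D>" "Z \<subseteq> \<Union>(U ` \<D>)"
  proof -
    assume *: "\<And>\<D>. \<D> \<subseteq> \<B> \<Longrightarrow> finite \<D> \<Longrightarrow> Z \<subseteq> \<Union>(U ` \<D>) \<Longrightarrow> thesis"
      and op: "\<And>q. q \<in> \<B> \<Longrightarrow> openin (top_of_set Z) (U q)" and cover: "Z \<subseteq> \<Union>(U ` \<B>)"
    obtain \<E> where "\<E> \<subseteq> U ` \<B>" "finite \<E>" "Z \<subseteq> \<Union>\<E>"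
      using Z[unfolded compact_eq_openin_cover, rule_format, of "U ` \<B>"] op cover by auto
    then show thesis using * finite_subset_image[of \<E> U \<B>] by metis
  qed
  \<comment> \<open>The sum is positive exactly when one of its terms is, and it is continuous.\<close>
  define m where "m z = max 0 (\<Phi> z) + (\<Sum>q\<in>\<D>. max 0 (- q z))" for z
  have "continuous_on Z m"
    unfolding m_def using \<Phi> cont \<D>(1) by (intro continuous_intros) (auto simp: \<B>_def)
  then have "\<exists>z\<in>Z. \<forall>w\<in>Z. m z \<le> m w"
    by (intro continuous_attains_inf Z False)
  then obtain z0 where z0: "z0 \<in> Z" "\<And>w. w \<in> Z \<Longrightarrow> m z0 \<le> m w" by blast
  have "m z0 > 0"
  proof -
    obtain q where q: "q \<in> \<D>" "\<Phi> z0 > 0 \<or> q z0 < 0" using \<D>(3) z0(1) by (auto simp: U_def)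
    have "max 0 (- q z0) \<le> (\<Sum>q\<in>\<D>. max 0 (- q z0))" using \<D>(2) q(1) by (intro member_le_sum) auto
    then show ?thesis using q(2) by (auto simp: m_def max_def split: if_splits)
  qed
  define r where "r = real (card \<D>)"
  define \<eta> where "\<eta> = m z0 / (r + 1)"
  have "r \<ge> 0" by (simp add: r_def)
  have "\<eta> > 0" using \<open>m z0 > 0\<close> \<open>r \<ge> 0\<close> by (simp add: \<eta>_def)
  have gap: "\<Phi> z \<ge> \<eta> \<or> (\<exists>q\<in>\<D>. q z \<le> - \<eta>)" if "z \<in> Z" for z
  proof (rule ccontr)
    assume "\<not> (\<Phi> z \<ge> \<eta> \<or> (\<exists>q\<in>\<D>. q z \<le> - \<eta>))"
    then have "max 0 (\<Phi> z) < \<eta>" "\<And>q. q \<in> \<D> \<Longrightarrow> max 0 (- q z) \<le> \<eta>"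
      using \<open>\<eta> > 0\<close> by force+
    then have "m z < \<eta> + r * \<eta>"
      unfolding m_def r_def by (intro add_less_le_mono sum_bounded_above) auto
    also have "\<dots> = \<eta> * (r + 1)" by (simp add: algebra_simps)
    also have "\<dots> = m z0" using \<open>r \<ge> 0\<close> by (simp add: \<eta>_def)
    finally show False using z0(2)[OF that] by simp
  qed
  have "bounded (\<Phi> ` Z)"
    using compact_continuous_image[OF \<Phi> Z] by (rule compact_imp_bounded)
  then obtain B where B: "B > 0" "\<And>z. z \<in> Z \<Longrightarrow> \<bar>\<Phi> z\<bar> \<le> B"
    unfolding bounded_pos by auto
  obtain k :: nat where k: "real k > max 1 (max r (max (r / \<eta>) ((B + 1) / \<eta>\<^sup>2)))"
    using reals_Archimedean2 by blast
  have "k > 0" using k by (cases k) auto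
  have rk: "r / (2 * real k) < \<eta>" "r / (2 * real k) < 1" "2 * real k * \<eta>\<^sup>2 > B + 1"
  proof -
    have "r < real k * \<eta>" using k \<open>\<eta> > 0\<close> by (simp add: pos_divide_less_eq)
    moreover have "real k * \<eta> > 0" using \<open>\<eta> > 0\<close> \<open>k > 0\<close> by simp
    ultimately have "r < 2 * real k * \<eta>" by linarith
    then show "r / (2 * real k) < \<eta>" using \<open>k > 0\<close> by (simp add: field_simps)
    show "r / (2 * real k) < 1" using k \<open>r \<ge> 0\<close> by simp
    have "B + 1 < real k * \<eta>\<^sup>2" using k \<open>\<eta> > 0\<close> by (simp add: pos_divide_less_eq)
    moreover have "real k * \<eta>\<^sup>2 > 0" using \<open>\<eta> > 0\<close> \<open>k > 0\<close> by simp
    ultimately show "2 * real k * \<eta>\<^sup>2 > B + 1" by linarith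
  qed
  define h where "h q z = q z * (1 - q z) ^ (2 * k)" for q :: "'a \<Rightarrow> real" and z
  have bd: "h q z \<le> 1 / (2 * real k)" if "q \<in> \<D>" "z \<in> Z" for q z
    unfolding h_def using that \<D>(1) \<open>k > 0\<close> by (intro penalty_bounds(1)) (auto simp: \<B>_def)
  have "(\<lambda>z. \<Sum>q\<in>D. h q z) \<in> \<Q>" if "finite D" "D \<subseteq> \<D>" for D
    using that
  proof (induction D rule: finite_induct)
    case (insert q D)
    then have "h q \<in> \<Q>" using \<D>(1) penal[of q k] by (auto simp: \<B>_def h_def[abs_def])
    with insert show ?case using add[of "h q" "\<lambda>z. \<Sum>q\<in>D. h q z"] by simp
  qed (simp add: zero)
  from this[OF \<D>(2) subset_refl] show ?thesis
  proof (rule bexI[rotated], intro ballI)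
    fix z assume z: "z \<in> Z"
    show "(\<Sum>q\<in>\<D>. h q z) < \<Phi> z"
    proof (cases "\<Phi> z \<ge> \<eta>")
      case True
      have "(\<Sum>q\<in>\<D>. h q z) \<le> r * (1 / (2 * real k))"
        unfolding r_def using bd[OF _ z] by (intro sum_bounded_above) auto
      then show ?thesis using rk(1) True by simp
    next
      case False
      then obtain q where q: "q \<in> \<D>" "q z \<le> - \<eta>" using gap[OF z] by blast
      have "\<bar>q z\<bar> \<le> 1" using q(1) z \<D>(1) unfolding \<B>_def by blast
      then have "h q z \<le> - (2 * real k * \<eta>\<^sup>2)"
        unfolding h_def using q(2) \<open>k > 0\<close> \<open>\<eta> > 0\<close>
        by (intro penalty_bounds(2)) auto
      moreover have "(\<Sum>q\<in>\<D>-{q}. h q z) \<le> real (card (\<D> - {q})) * (1 / (2 * real k))"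
        using bd[OF _ z] by (intro sum_bounded_above) auto
      moreover have "real (card (\<D> - {q})) * (1 / (2 * real k)) \<le> r * (1 / (2 * real k))"
        unfolding r_def by (intro mult_right_mono) (auto simp: \<D>(2) card_Diff1_le)
      moreover have "(\<Sum>q\<in>\<D>. h q z) = h q z + (\<Sum>q\<in>\<D>-{q}. h q z)"
        using \<D>(2) q(1) by (simp add: sum.remove)
      ultimately have "(\<Sum>q\<in>\<D>. h q z) < - B" using rk by simp
      then show ?thesis using B(2)[OF z] by linarith
    qed
  qed
qed

section \<open>Positivstellensatz for the quadratic module\<close>

lemma Qpoly_sos: "(s :: 'n rpoly) \<in> sos \<Longrightarrow> s \<in> Qpoly Y G \<nu>"
  by (induction s rule: sos.induct) (auto intro: Qpoly_square Qpoly_add)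

lemma Qpoly_sos_mult: "(s :: 'n rpoly) \<in> sos \<Longrightarrow> (q :: 'n rpoly) \<in> Qpoly Y G \<nu> \<Longrightarrow> q * s \<in> Qpoly Y G \<nu>"
  by (induction s rule: sos.induct) (auto intro: Qpoly_mult_square Qpoly_add simp: distrib_left)

lemma ball_preorder_subset_Qpoly:
  fixes G :: "('n::finite, 'm::finite) poly_xy ^ 'q::finite ^ 'q"
  assumes "ball_poly C \<in> Qpoly Y G \<nu>"
  shows "ball_preorder C \<subseteq> Qpoly Y G \<nu>"
proof
  fix q :: "'n rpoly" assume "q \<in> ball_preorder C"
  then obtain s t where "q = s + ball_poly C * t" "s \<in> sos" "t \<in> sos"
    unfolding ball_preorder_def by (auto simp: mult.commute)
  then show "q \<in> Qpoly Y G \<nu>"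
    using assms by (auto intro: Qpoly_add Qpoly_sos Qpoly_sos_mult)
qed

lemma outer_cone_subset_Qmod:
  fixes G :: "('n::finite, 'm::finite) poly_xy ^ 'q::finite ^ 'q"
  assumes "ball_poly C \<in> Qpoly Y G \<nu>" "A \<in> outer_cone C"
  shows "A \<in> Qmod Y G \<nu>"
  using assms(2)
proof (induction A rule: outer_cone.induct)
  case (outer t w)
  then show ?case
    using ball_preorder_subset_Qpoly[OF assms(1)] by (intro Qmod_outer) auto
qed (rule Qmod_add)

text \<open>
  The penalty is applied to the values \<open>v\<^sup>T F(x) v\<close> on the product of the cube with the unit sphere, which
  treats all directions \<open>v\<close> at once and reduces the matrix problem to a scalar one.
\<close>

theorem Qmod_positivstellensatz:
  fixes F :: "'n::finite rpoly ^ 'p::finite ^ 'p" and G :: "('n, 'm::finite) poly_xy ^ 'q::finite ^ 'q"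
  assumes C: "C > 0" "ball_poly C \<in> Qpoly Y G \<nu>" and sym: "sym_mat F"
    and alt: "\<And>x. pos_def (map_mat (eval_poly x) F) \<or> (\<exists>q\<in>Qpoly Y G \<nu>. eval_poly x q < 0)"
  shows "F \<in> Qmod Y G \<nu>"
proof -
  define R where "R = sqrt C"
  have R: "R > 0" "R\<^sup>2 = C" using C(1) by (auto simp: R_def)
  let ?Z = "cube R \<times> sphere (0::real^'p) 1"
  let ?\<Phi> = "\<lambda>z. qform F (fst z) (snd z)"
  let ?Q = "(\<lambda>q z. eval_poly (fst z) q) ` Qpoly Y G \<nu> :: ((real^'n) \<times> (real^'p) \<Rightarrow> real) set"
  have "\<exists>q\<in>?Q. \<forall>z\<in>?Z. q z < ?\<Phi> z"
  proof (rule compact_penalty)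
    show "compact ?Z" by (intro compact_Times compact_cube compact_sphere)
    show "continuous_on ?Z ?\<Phi>" by (rule continuous_on_qform)
    show "continuous_on ?Z q" if "q \<in> ?Q" for q
      using that by (auto intro!: continuous_on_compose2[OF continuous_on_eval_poly[of UNIV]] continuous_intros)
    show "(\<lambda>_. 0) \<in> ?Q"
      using Qpoly_square[of 0 Y G \<nu>] by (intro image_eqI[of _ _ 0]) auto
    show "(\<lambda>z. p z + q z) \<in> ?Q" if "p \<in> ?Q" "q \<in> ?Q" for p q
    proof -
      obtain p' q' where "p = (\<lambda>z. eval_poly (fst z) p')" "p' \<in> Qpoly Y G \<nu>"
        and "q = (\<lambda>z. eval_poly (fst z) q')" "q' \<in> Qpoly Y G \<nu>" using \<open>p \<in> ?Q\<close> \<open>q \<in> ?Q\<close> by auto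
      then show ?thesis by (intro image_eqI[of _ _ "p' + q'"] Qpoly_add) simp_all
    qed
    show "(\<lambda>z. c * q z) \<in> ?Q" if c: "c \<ge> 0" and "q \<in> ?Q" for c q
    proof -
      obtain q' where q': "q = (\<lambda>z. eval_poly (fst z) q')" "q' \<in> Qpoly Y G \<nu>" using \<open>q \<in> ?Q\<close> by auto
      have "q' * Const c \<in> Qpoly Y G \<nu>" using q'(2) sos_Const[OF c] by (intro Qpoly_sos_mult)
      then show ?thesis by (rule image_eqI[rotated]) (simp add: q'(1) mult.commute)
    qed
    show "(\<lambda>z. q z * (1 - q z) ^ (2 * k)) \<in> ?Q" if "q \<in> ?Q" for q k
    proof -
      obtain q' where q': "q = (\<lambda>z. eval_poly (fst z) q')" "q' \<in> Qpoly Y G \<nu>" using \<open>q \<in> ?Q\<close> by auto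
      have "q' * ((1 - q') ^ k * (1 - q') ^ k) \<in> Qpoly Y G \<nu>" using q'(2) by (rule Qpoly_mult_square)
      then show ?thesis
        by (rule image_eqI[rotated]) (simp add: q'(1) power_mult power2_eq_square power_mult_distrib)
    qed
    show "?\<Phi> z > 0 \<or> (\<exists>q\<in>?Q. q z < 0)" if "z \<in> ?Z" for z
      using that alt[of "fst z"] pos_def_iff_qform[OF sym, of "fst z"] by auto
  qed
  then obtain q where q: "q \<in> Qpoly Y G \<nu>" "\<And>z. z \<in> ?Z \<Longrightarrow> eval_poly (fst z) q < ?\<Phi> z" by blast
  have qf: "qform (F - mat q) a v = qform F a v - eval_poly a q * (v \<bullet> v)" for a :: "real ^ 'n" and v :: "real ^ 'p"
  proof -
    have "map_mat (eval_poly a) (F - mat q) = map_mat (eval_poly a) F - eval_poly a q *\<^sub>R mat 1"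
      by (auto simp: vec_eq_iff map_mat_def mat_def)
    then show ?thesis
      by (simp add: qform_def matrix_vector_mult_diff_rdistrib inner_diff_right scaleR_matrix_vector_assoc[symmetric])
  qed
  have symq: "sym_mat (F - mat q)"
    using sym by (auto simp: sym_mat_def transpose_def vec_eq_iff mat_def)
  have "F - mat q \<in> outer_cone (R\<^sup>2)"
  proof (rule outer_cone_positivstellensatz_cube[OF R(1) symq])
    fix a :: "real ^ 'n" assume "a \<in> cube R"
    then show "pos_def (map_mat (eval_poly a) (F - mat q))"
      unfolding pos_def_iff_qform[OF symq] qf using q(2)[of "(a, _)"]
      by (auto simp: power2_norm_eq_inner[symmetric])
  qed
  then have "F - mat q \<in> Qmod Y G \<nu>" using C(2) outer_cone_subset_Qmod unfolding R(2) by blast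
  from Qmod_add[OF this Qmod_scalar_mat[OF q(1)]] show ?thesis by simp
qed

section \<open>Quasi-analyticity\<close>

lemma sum_exp_series_le:
  assumes "x \<ge> (0::real)"
  shows "(\<Sum>i<k. x ^ i / fact i) \<le> exp x"
proof -
  have "(\<Sum>i<k. inverse (fact i) * x ^ i) \<le> suminf (\<lambda>i. inverse (fact i) * x ^ i)"
    using assms by (intro sum_le_suminf summable_exp) auto
  then show ?thesis by (simp add: exp_def divide_inverse mult.commute)
qed

lemma log_convex_ratio_mono:
  fixes M :: "nat \<Rightarrow> real"
  assumes pos: "\<And>j. M j > 0" and convex: "\<And>j. (M (Suc j))\<^sup>2 \<le> M j * M (Suc (Suc j))"
    and "a \<le> b"
  shows "M (Suc a) / M a \<le> M (Suc b) / M b"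
proof -
  have "M (Suc j) / M j \<le> M (Suc (Suc j)) / M (Suc j)" for j
    using convex[of j] pos[of j] pos[of "Suc j"] by (simp add: field_simps power2_eq_square)
  then show ?thesis
    using lift_Suc_mono_le[of "\<lambda>j. M (Suc j) / M j" a b] \<open>a \<le> b\<close> by blast
qed

lemma log_convex_power_bound:
  fixes M :: "nat \<Rightarrow> real"
  assumes pos: "\<And>j. M j > 0" and convex: "\<And>j. (M (Suc j))\<^sup>2 \<le> M j * M (Suc (Suc j))"
    and "j + i \<le> Suc n"
  shows "M (j + i) \<le> M j * (M (Suc n) / M n) ^ i"
  using assms(3)
proof (induction i)
  case (Suc i)
  have "M (j + Suc i) = M (j + i) * (M (Suc (j + i)) / M (j + i))"
    using pos[of "j + i"] by simp
  also have "\<dots> \<le> (M j * (M (Suc n) / M n) ^ i) * (M (Suc n) / M n)"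
    using Suc pos by (intro mult_mono log_convex_ratio_mono convex) (auto intro: less_imp_le)
  finally show ?case by (simp add: mult_ac)
qed simp

text \<open>
  Bang's proof of the Denjoy-Carleman theorem. In the classical setting \<open>N j x\<close> is the absolute value
  of the \<open>j\<close>-th derivative at \<open>x\<close> of a function that vanishes to infinite order at \<open>0\<close>; the argument
  uses only the estimate given by Taylor's formula, so \<open>N j x\<close> may be any family of numbers with that
  property.

  Let \<open>B(x)\<close> be the least \<open>b\<close> with \<open>N j x \<le> b e\<^sup>j M j\<close> for all \<open>j\<close>. The derivatives of order above \<open>n\<close>
  cannot raise \<open>B\<close> above \<open>e\<^sup>-\<^sup>n\<^sup>-\<^sup>1\<close>, so beyond that value it grows at most at the exponential rate
  \<open>e M(n+1)/M(n)\<close>. To rise from \<open>e\<^sup>-\<^sup>n\<^sup>-\<^sup>1\<close> to \<open>e\<^sup>-\<^sup>n\<close> it needs a distance of at least \<open>M(n)/(e M(n+1))\<close>.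
  These distances have an infinite sum and \<open>B(0) = 0\<close>, so \<open>B \<le> e\<^sup>-\<^sup>n\<close> everywhere, for every \<open>n\<close>.
\<close>

lemma bang_nonneg:
  fixes N :: "nat \<Rightarrow> real \<Rightarrow> real" and M :: "nat \<Rightarrow> real"
  assumes pos: "\<And>j. M j > 0" and convex: "\<And>j. (M (Suc j))\<^sup>2 \<le> M j * M (Suc (Suc j))"
    and div: "\<not> summable (\<lambda>j. M j / M (Suc j))"
    and bound: "\<And>j x. N j x \<le> M j"
    and taylor: "\<And>j k x h. N j (x + h) \<le> (\<Sum>i<k. N (j + i) x * \<bar>h\<bar> ^ i / fact i) + M (j + k) * \<bar>h\<bar> ^ k / fact k"
    and zero: "\<And>j. N j 0 \<le> 0"
    and "x \<ge> 0"
  shows "N j x \<le> 0"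
proof -
  \<comment> \<open>\<open>\<B> b x\<close> says that \<open>B(x) \<le> b\<close>.\<close>
  define \<B> where "\<B> b x \<longleftrightarrow> (\<forall>j. N j x \<le> b * exp (real j) * M j)" for b x
  have mono: "\<B> b' x" if "\<B> b x" "b \<le> b'" for b b' x
    unfolding \<B>_def
  proof
    fix j
    have "N j x \<le> b * exp (real j) * M j" using that(1) by (simp add: \<B>_def)
    also have "\<dots> \<le> b' * exp (real j) * M j"
      using that(2) pos[of j] by (intro mult_right_mono) auto
    finally show "N j x \<le> b' * exp (real j) * M j" .
  qed
  define r where "r n = M n / M (Suc n) / exp 1" for n
  have r: "r n > 0" for n using pos by (simp add: r_def)
  have step: "\<B> (b * exp (\<bar>h\<bar> / r n)) (x + h)" if b: "b \<ge> exp (- real (Suc n))" and B: "\<B> b x" for b h n x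
    unfolding \<B>_def
  proof
    fix j
    have "b > 0" using b by (meson exp_gt_zero less_le_trans)
    have E: "exp (\<bar>h\<bar> / r n) \<ge> 1" using r[of n] by simp
    show "N j (x + h) \<le> b * exp (\<bar>h\<bar> / r n) * exp (real j) * M j"
    proof (cases "j \<le> n")
      case False
      have "1 \<le> exp (- real (Suc n)) * exp (real j)"
        using False by (simp flip: exp_add)
      also have "\<dots> \<le> b * exp (real j)" using b by (intro mult_right_mono) auto
      also have "\<dots> \<le> (b * exp (real j)) * exp (\<bar>h\<bar> / r n)"
        using mult_left_mono[OF E, of "b * exp (real j)"] \<open>b > 0\<close> by simp
      finally have "1 \<le> b * exp (\<bar>h\<bar> / r n) * exp (real j)" by (simp add: mult_ac)
      then have "1 * M j \<le> (b * exp (\<bar>h\<bar> / r n) * exp (real j)) * M j"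
        using pos[of j] by (intro mult_right_mono) auto
      then show ?thesis using bound[of j "x + h"] by simp
    next
      case True
      define k where "k = Suc n - j"
      let ?\<mu> = "M (Suc n) / M n"
      let ?c = "b * exp (real j) * M j"
      have Mk: "M (j + i) \<le> M j * ?\<mu> ^ i" if "i \<le> k" for i
        using that True by (intro log_convex_power_bound pos convex) (simp add: k_def)
      have h_r: "\<bar>h\<bar> / r n = exp 1 * ?\<mu> * \<bar>h\<bar>" using pos by (simp add: r_def)
      have tm: "b * exp (real (j + i)) * M (j + i) * \<bar>h\<bar> ^ i / fact i \<le> ?c * ((\<bar>h\<bar> / r n) ^ i / fact i)"
        if "i \<le> k" for i
      proof -
        have "b * exp (real (j + i)) * M (j + i) * \<bar>h\<bar> ^ i / fact i
            \<le> b * exp (real (j + i)) * (M j * ?\<mu> ^ i) * \<bar>h\<bar> ^ i / fact i"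
          using \<open>b > 0\<close> Mk[OF that] by (intro divide_right_mono mult_right_mono mult_left_mono) auto
        also have "\<dots> = ?c * ((\<bar>h\<bar> / r n) ^ i / fact i)"
          unfolding h_r using exp_of_nat_mult[of i "1::real"]
          by (simp add: exp_add power_mult_distrib power_divide mult_ac)
        finally show ?thesis .
      qed
      have "M (j + k) \<le> b * exp (real (j + k)) * M (j + k)"
      proof -
        have "1 = exp (- real (Suc n)) * exp (real (j + k))" using True by (simp add: k_def flip: exp_add)
        also have "\<dots> \<le> b * exp (real (j + k))" using b by (intro mult_right_mono) auto
        finally show ?thesis using pos[of "j + k"] by (simp add: mult_le_cancel_right1)
      qed
      then have last: "M (j + k) * \<bar>h\<bar> ^ k / fact k \<le> ?c * ((\<bar>h\<bar> / r n) ^ k / fact k)"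
        by (intro order_trans[OF _ tm[of k]] divide_right_mono mult_right_mono) auto
      have "N j (x + h) \<le> (\<Sum>i<k. N (j + i) x * \<bar>h\<bar> ^ i / fact i) + M (j + k) * \<bar>h\<bar> ^ k / fact k"
        by (rule taylor)
      also have "(\<Sum>i<k. N (j + i) x * \<bar>h\<bar> ^ i / fact i) \<le> (\<Sum>i<k. ?c * ((\<bar>h\<bar> / r n) ^ i / fact i))"
      proof (rule sum_mono)
        fix i assume "i \<in> {..<k}"
        have "N (j + i) x \<le> b * exp (real (j + i)) * M (j + i)" using B unfolding \<B>_def by blast
        then have "N (j + i) x * \<bar>h\<bar> ^ i / fact i \<le> b * exp (real (j + i)) * M (j + i) * \<bar>h\<bar> ^ i / fact i"
          by (intro divide_right_mono mult_right_mono) auto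
        also have "\<dots> \<le> ?c * ((\<bar>h\<bar> / r n) ^ i / fact i)" using \<open>i \<in> {..<k}\<close> by (intro tm) simp
        finally show "N (j + i) x * \<bar>h\<bar> ^ i / fact i \<le> ?c * ((\<bar>h\<bar> / r n) ^ i / fact i)" .
      qed
      finally have "N j (x + h) \<le> (\<Sum>i<Suc k. ?c * ((\<bar>h\<bar> / r n) ^ i / fact i))"
        using last by simp
      also have "\<dots> = ?c * (\<Sum>i<Suc k. (\<bar>h\<bar> / r n) ^ i / fact i)" by (rule sum_distrib_left[symmetric])
      also have "\<dots> \<le> ?c * exp (\<bar>h\<bar> / r n)"
        using \<open>b > 0\<close> pos[of j] r[of n] by (intro mult_left_mono sum_exp_series_le) auto
      finally show ?thesis by (simp add: mult_ac)
    qed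
  qed
  have reach: "\<B> (exp (- real n)) x" if "n \<le> K" "0 \<le> x" "x \<le> (\<Sum>k\<in>{n..<K}. r k)" for n K x
    using that
  proof (induction arbitrary: x rule: inc_induct)
    case base
    then have "x = 0" by simp
    have "N j 0 \<le> exp (- real K) * exp (real j) * M j" for j
      using zero[of j] pos[of j] by (meson exp_ge_zero less_imp_le mult_nonneg_nonneg order_trans)
    then show ?case by (simp add: \<B>_def \<open>x = 0\<close>)
  next
    case (step n)
    define y where "y = (\<Sum>k\<in>{Suc n..<K}. r k)"
    have "y \<ge> 0" unfolding y_def using r by (intro sum_nonneg less_imp_le) auto
    have xy: "x \<le> r n + y"
      using step.prems(2) step.hyps by (simp add: y_def sum.atLeast_Suc_lessThan)
    show ?case
    proof (cases "x \<le> y")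
      case True
      then show ?thesis
        using mono[OF step.IH[of x]] step.prems(1) by (simp add: y_def)
    next
      case False
      have "\<B> (exp (- real (Suc n)) * exp (\<bar>x - y\<bar> / r n)) (y + (x - y))"
        using \<open>y \<ge> 0\<close> by (intro \<open>\<And>x n h b. _ \<Longrightarrow> _ \<Longrightarrow> \<B> (b * exp (\<bar>h\<bar> / r n)) (x + h)\<close> step.IH) (auto simp: y_def)
      moreover have "exp (- real (Suc n)) * exp (\<bar>x - y\<bar> / r n) \<le> exp (- real n)"
      proof -
        have "\<bar>x - y\<bar> / r n \<le> 1" using False xy r[of n] by simp
        then show ?thesis by (simp flip: exp_add)
      qed
      ultimately show ?thesis using mono by fastforce
    qed
  qed
  have all: "\<B> (exp (- real n)) x" for n
  proof -
    have "\<not> summable r"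
    proof
      assume "summable r"
      then have "summable (\<lambda>n. r n * exp 1)" by (rule summable_mult2)
      then show False using div by (simp add: r_def)
    qed
    then have "\<not> summable (\<lambda>k. r (k + n))" by (simp add: summable_iff_shift)
    then obtain m where "(\<Sum>k<m. r (k + n)) > x"
      using bounded_imp_summable[of "\<lambda>k. r (k + n)" x] r
      by (metis less_imp_le lessThan_Suc_atMost not_le)
    also have "(\<Sum>k<m. r (k + n)) = (\<Sum>k\<in>{n..<m + n}. r k)"
      using sum.shift_bounds_nat_ivl[of r 0 n m] by (simp add: atLeast0LessThan)
    finally show ?thesis using reach[of n "m + n" x] \<open>x \<ge> 0\<close> by simp
  qed
  have "(\<lambda>n. exp (- real n) * (exp (real j) * M j)) \<longlonglongrightarrow> 0 * (exp (real j) * M j)"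
    by (intro tendsto_mult tendsto_const filterlim_compose[OF exp_at_bot])
       (auto simp: filterlim_uminus_at_bot filterlim_real_sequentially)
  then show ?thesis
    using all by (intro LIMSEQ_le_const[where x = 0]) (auto simp: \<B>_def mult.assoc)
qed

lemma bang:
  fixes N :: "nat \<Rightarrow> real \<Rightarrow> real" and M :: "nat \<Rightarrow> real"
  assumes pos: "\<And>j. M j > 0" and convex: "\<And>j. (M (Suc j))\<^sup>2 \<le> M j * M (Suc (Suc j))"
    and div: "\<not> summable (\<lambda>j. M j / M (Suc j))"
    and bound: "\<And>j x. N j x \<le> M j"
    and taylor: "\<And>j k x h. N j (x + h) \<le> (\<Sum>i<k. N (j + i) x * \<bar>h\<bar> ^ i / fact i) + M (j + k) * \<bar>h\<bar> ^ k / fact k"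
    and zero: "\<And>j. N j 0 \<le> 0"
  shows "N j x \<le> 0"
proof (cases "x \<ge> 0")
  case True
  show ?thesis by (rule bang_nonneg[OF pos convex div bound taylor zero True])
next
  case False
  have "N j (- (- x)) \<le> 0"
  proof (rule bang_nonneg[where N = "\<lambda>j x. N j (- x)" and x = "- x", OF pos convex div])
    show "N j (- (x + h)) \<le> (\<Sum>i<k. N (j + i) (- x) * \<bar>h\<bar> ^ i / fact i) + M (j + k) * \<bar>h\<bar> ^ k / fact k" for j k x h
      using taylor[of j "- x" "- h" k] by simp
  qed (use bound zero False in auto)
  then show ?thesis by simp
qed

section \<open>Carleman's inequality\<close>

lemma fact_ge_power: "((real n + 2) / exp 1) ^ Suc n \<le> fact (Suc n)"
proof (induction n)
  case 0
  show ?case using exp_ge_add_one_self[of 1] by (simp add: divide_le_eq)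
next
  case (Suc n)
  let ?n = "real n"
  have "((?n + 3) / (?n + 2)) ^ (n + 2) \<le> exp 1"
  proof -
    have "((?n + 3) / (?n + 2)) = 1 + 1 / (?n + 2)" by (simp add: field_simps)
    also have "\<dots> \<le> exp (1 / (?n + 2))" by (rule exp_ge_add_one_self)
    finally have "((?n + 3) / (?n + 2)) ^ (n + 2) \<le> exp (1 / (?n + 2)) ^ (n + 2)"
      by (intro power_mono) auto
    also have "\<dots> = exp (real (n + 2) * (1 / (?n + 2)))" by (rule exp_of_nat_mult[symmetric])
    also have "real (n + 2) * (1 / (?n + 2)) = 1" by (simp add: field_simps)
    finally show ?thesis .
  qed
  then have *: "((?n + 3) / (?n + 2)) ^ (n + 2) / exp 1 \<le> 1"
    using divide_le_eq_1_pos[OF exp_gt_zero] by blast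
  have "((real (Suc n) + 2) / exp 1) ^ Suc (Suc n) = ((?n + 3) / exp 1) ^ (n + 2)" by (simp add: add_ac)
  also have "(?n + 3) / exp 1 = ((?n + 2) / exp 1) * ((?n + 3) / (?n + 2))"
  proof -
    have "c / e = (a / e) * (c / a)" if "a \<noteq> 0" for a c e :: real using that by simp
    then show ?thesis by (metis of_nat_0_le_iff add_nonneg_pos zero_less_numeral less_irrefl)
  qed
  also have "(\<dots>) ^ (n + 2) = (?n + 2) * ((?n + 2) / exp 1) ^ Suc n * (((?n + 3) / (?n + 2)) ^ (n + 2) / exp 1)"
    unfolding power_mult_distrib by simp
  also have "\<dots> \<le> (?n + 2) * fact (Suc n) * 1"
    using Suc * by (intro mult_mono) auto
  also have "\<dots> = fact (Suc (Suc n))" by simp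
  finally show ?case .
qed

text \<open>
  The inequality between the means is applied to \<open>(k + 1) a\<^sub>k\<close> instead of \<open>a\<^sub>k\<close>: these weights make the
  sum over \<open>n\<close> of the resulting bounds telescope.
\<close>

lemma carleman_inequality_term:
  fixes a :: "nat \<Rightarrow> real"
  assumes "\<And>k. a k > 0"
  shows "(\<Prod>k\<le>n. a k) powr (1 / real (Suc n))
    \<le> exp 1 / (real (Suc n) * real (Suc (Suc n))) * (\<Sum>k\<le>n. real (Suc k) * a k)"
proof -
  let ?s = "1 / real (Suc n)"
  let ?P = "\<Prod>k\<le>n. a k"
  have P: "?P > 0" by (intro prod_pos) (use assms in auto)
  have "(\<Prod>k\<le>n. real (Suc k) * a k) powr ?s \<le> (\<Sum>k\<le>n. real (Suc k) * a k / real (card {..n}))"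
    using arith_geom_mean[of "{..n}" "\<lambda>k. real (Suc k) * a k"] assms
    by (simp add: less_imp_le sum_divide_distrib)
  also have "(\<Prod>k\<le>n. real (Suc k) * a k) = fact (Suc n) * ?P"
  proof -
    have "(\<Prod>k\<le>n. real (Suc k)) = fact (Suc n)" by (induction n) simp_all
    then show ?thesis by (simp add: prod.distrib)
  qed
  finally have 1: "fact (Suc n) powr ?s * ?P powr ?s \<le> (\<Sum>k\<le>n. real (Suc k) * a k) / real (Suc n)"
    using P by (simp add: powr_mult sum_divide_distrib)
  have "(real n + 2) / exp 1 = (((real n + 2) / exp 1) ^ Suc n) powr ?s"
    by (subst powr_realpow[symmetric]) (simp_all add: powr_powr)
  also have "\<dots> \<le> fact (Suc n) powr ?s" by (intro powr_mono2 fact_ge_power) auto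
  finally have "(real n + 2) / exp 1 * ?P powr ?s \<le> (\<Sum>k\<le>n. real (Suc k) * a k) / real (Suc n)"
    using 1 by (meson mult_right_mono order_trans powr_ge_zero)
  then have "exp 1 / (real n + 2) * ((real n + 2) / exp 1 * ?P powr ?s)
      \<le> exp 1 / (real n + 2) * ((\<Sum>k\<le>n. real (Suc k) * a k) / real (Suc n))"
    by (intro mult_left_mono) auto
  then show ?thesis by (simp add: mult_ac add_ac)
qed

lemma sum_telescope_reciprocal:
  "(\<Sum>n\<in>{k..<K}. 1 / (real (Suc n) * real (Suc (Suc n)))) \<le> 1 / real (Suc k)"
proof (cases "k \<le> K")
  case True
  have "(\<Sum>n\<in>{k..<K}. 1 / (real (Suc n) * real (Suc (Suc n)))) = 1 / real (Suc k) - 1 / real (Suc K)"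
    using True
  proof (induction rule: dec_induct)
    case (step K)
    have "1 / (real (Suc K) * real (Suc (Suc K))) = 1 / real (Suc K) - 1 / real (Suc (Suc K))"
      by (simp add: field_simps)
    with step show ?case by simp
  qed simp
  then show ?thesis by simp
qed simp

theorem carleman_inequality:
  fixes a :: "nat \<Rightarrow> real"
  assumes pos: "\<And>k. a k > 0" and "summable a"
  shows "summable (\<lambda>n. (\<Prod>k\<le>n. a k) powr (1 / real (Suc n)))"
proof (rule bounded_imp_summable)
  fix N
  let ?w = "\<lambda>n. 1 / (real (Suc n) * real (Suc (Suc n)))"
  have "(\<Sum>n\<le>N. (\<Prod>k\<le>n. a k) powr (1 / real (Suc n)))
      \<le> (\<Sum>n\<le>N. \<Sum>k\<le>n. exp 1 * (real (Suc k) * a k) * ?w n)"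
    by (intro sum_mono order_trans[OF carleman_inequality_term[OF pos]])
       (simp add: sum_distrib_left sum_divide_distrib mult_ac)
  also have "\<dots> = (\<Sum>k\<le>N. \<Sum>n\<in>{k..<Suc N}. exp 1 * (real (Suc k) * a k) * ?w n)"
    unfolding sum.Sigma[OF finite_atMost ballI[OF finite_atMost]] sum.Sigma[OF finite_atMost ballI[OF finite_atLeastLessThan]]
    by (rule sum.reindex_bij_witness[of _ "\<lambda>(k, n). (n, k)" "\<lambda>(n, k). (k, n)"]) auto
  also have "\<dots> \<le> (\<Sum>k\<le>N. exp 1 * a k)"
  proof (rule sum_mono)
    fix k
    have "(\<Sum>n\<in>{k..<Suc N}. exp 1 * (real (Suc k) * a k) * ?w n)
        = exp 1 * (real (Suc k) * a k) * (\<Sum>n\<in>{k..<Suc N}. ?w n)" by (rule sum_distrib_left[symmetric])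
    also have "\<dots> \<le> exp 1 * (real (Suc k) * a k) * (1 / real (Suc k))"
      using pos[of k] by (intro mult_left_mono sum_telescope_reciprocal) auto
    also have "\<dots> = exp 1 * a k" by simp
    finally show "(\<Sum>n\<in>{k..<Suc N}. exp 1 * (real (Suc k) * a k) * ?w n) \<le> exp 1 * a k" .
  qed
  also have "\<dots> = exp 1 * (\<Sum>k\<le>N. a k)" by (rule sum_distrib_left[symmetric])
  also have "\<dots> \<le> exp 1 * suminf a"
    using pos by (intro mult_left_mono sum_le_suminf \<open>summable a\<close>) (auto intro: less_imp_le)
  finally show "(\<Sum>n\<le>N. (\<Prod>k\<le>n. a k) powr (1 / real (Suc n))) \<le> exp 1 * suminf a" .
qed simp

text \<open>
  For \<open>a\<^sub>k = \<surd>(b\<^sub>k / b\<^sub>k\<^sub>+\<^sub>1)\<close> the products in Carleman's inequality telescope, and the inequality turns the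
  divergence of the Carleman series into divergence of the sum of the \<open>a\<^sub>k\<close>. The fourth roots of the
  even-indexed terms, which is what the Cauchy-Schwarz inequality leaves of the moments below, have
  ratios \<open>\<surd>(a\<^sub>2\<^sub>j a\<^sub>2\<^sub>j\<^sub>+\<^sub>1)\<close>; since the \<open>a\<^sub>k\<close> decrease, their sum diverges too.
\<close>

lemma carleman_log_convex:
  fixes b :: "nat \<Rightarrow> real"
  assumes pos: "\<And>k. b k > 0" and b0: "b 0 \<ge> 1"
    and convex: "\<And>j. (b (Suc j))\<^sup>2 \<le> b j * b (Suc (Suc j))"
    and div: "\<not> summable (\<lambda>n. b (Suc n) powr (- 1 / real (2 * Suc n)))"
  shows "\<not> summable (\<lambda>j. b (2 * j) powr (1/4) / b (2 * Suc j) powr (1/4))"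
proof
  assume sm: "summable (\<lambda>j. b (2 * j) powr (1/4) / b (2 * Suc j) powr (1/4))"
  define a where "a k = sqrt (b k / b (Suc k))" for k
  have a: "a k > 0" for k using pos by (simp add: a_def)
  have anti: "a (Suc k) \<le> a k" for k
    using log_convex_ratio_mono[of b k "Suc k", OF pos convex] pos[of k] pos[of "Suc k"] pos[of "Suc (Suc k)"]
    by (simp add: a_def field_simps)
  have "a (2 * j + 1) \<le> b (2 * j) powr (1/4) / b (2 * Suc j) powr (1/4)" for j
  proof -
    have "a (2 * j + 1) * a (2 * j + 1) \<le> a (2 * j) * a (2 * j + 1)"
      using anti[of "2 * j"] a[of "2 * j + 1"] by simp
    also have "\<dots> = sqrt (b (2 * j) / b (2 * Suc j))"
      using pos[of "Suc (2 * j)"] by (simp add: a_def real_sqrt_mult[symmetric])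
    finally have "a (2 * j + 1) \<le> sqrt (sqrt (b (2 * j) / b (2 * Suc j)))"
      by (simp add: real_le_rsqrt power2_eq_square)
    also have "\<dots> = (b (2 * j) / b (2 * Suc j)) powr (1/4)"
      using pos[of "2 * j"] pos[of "2 * Suc j"] by (simp add: powr_half_sqrt[symmetric] powr_powr)
    also have "\<dots> = b (2 * j) powr (1/4) / b (2 * Suc j) powr (1/4)"
      using pos[of "2 * j"] pos[of "2 * Suc j"] by (simp add: powr_divide)
    finally show ?thesis .
  qed
  then have "summable (\<lambda>j. a (2 * j + 1))"
    using a by (intro summable_comparison_test'[OF sm, of 0]) (auto simp: less_imp_le)
  then have odd: "(\<Sum>j\<le>N. a (2 * j + 1)) \<le> suminf (\<lambda>j. a (2 * j + 1))" for N
    using a by (intro sum_le_suminf) (auto intro: less_imp_le)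
  have "summable a"
  proof (rule bounded_imp_summable)
    fix N
    have "(\<Sum>k\<le>2 * N + 2. a k) \<le> a 0 + 2 * (\<Sum>j\<le>N. a (2 * j + 1))" for N
    proof (induction N)
      case 0
      show ?case using anti[of 1] by (simp add: numeral_2_eq_2)
    next
      case (Suc N)
      have "(\<Sum>k\<le>2 * Suc N + 2. a k) = (\<Sum>k\<le>2 * N + 2. a k) + a (2 * Suc N + 1) + a (2 * Suc N + 2)"
        by simp
      then show ?case using Suc anti[of "2 * Suc N + 1"] by simp
    qed
    note this[of N]
    moreover have "(\<Sum>k\<le>N. a k) \<le> (\<Sum>k\<le>2 * N + 2. a k)"
      using a by (intro sum_mono2) (auto intro: less_imp_le)
    ultimately show "(\<Sum>k\<le>N. a k) \<le> a 0 + 2 * suminf (\<lambda>j. a (2 * j + 1))"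
      using odd[of N] by linarith
  qed (use a in \<open>auto intro: less_imp_le\<close>)
  then have sm': "summable (\<lambda>n. (\<Prod>k\<le>n. a k) powr (1 / real (Suc n)))"
    using a by (intro carleman_inequality)
  have le: "b (Suc n) powr (- 1 / real (2 * Suc n)) \<le> (\<Prod>k\<le>n. a k) powr (1 / real (Suc n))" for n
  proof -
    have prod: "(\<Prod>k\<le>n. a k) = sqrt (b 0 / b (Suc n))"
    proof (induction n)
      case (Suc n)
      then show ?case using pos[of "Suc n"] by (simp add: a_def real_sqrt_mult[symmetric])
    qed (simp add: a_def)
    have "b (Suc n) powr (- 1 / real (2 * Suc n)) = (1 / b (Suc n)) powr (1 / real (2 * Suc n))"
    proof -
      have "- 1 / real (2 * Suc n) = - (1 / real (2 * Suc n))" by simp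
      then show ?thesis
        using pos[of "Suc n"] by (simp only: powr_minus_divide) (simp add: powr_divide)
    qed
    also have "\<dots> \<le> (b 0 / b (Suc n)) powr (1 / real (2 * Suc n))"
      using pos[of "Suc n"] b0 by (intro powr_mono2 divide_right_mono) auto
    also have "\<dots> = (\<Prod>k\<le>n. a k) powr (1 / real (Suc n))"
      unfolding prod using pos[of 0] pos[of "Suc n"] by (simp add: powr_half_sqrt[symmetric] powr_powr)
    finally show ?thesis .
  qed
  have "summable (\<lambda>n. b (Suc n) powr (- 1 / real (2 * Suc n)))"
    by (rule summable_comparison_test'[OF sm', of 0]) (use le in simp)
  with div show False ..
qed

section \<open>Density of polynomials\<close>

text \<open>
  Measurable functions of polynomial growth: an algebra on which all the integrals below exist.
\<close>

definition tame :: "(real ^ 'm::finite \<Rightarrow> real) \<Rightarrow> bool" where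
  "tame f \<longleftrightarrow> f \<in> borel_measurable borel \<and> (\<exists>p. \<forall>y. \<bar>f y\<bar> \<le> eval_poly y p)"

lemma tame_measurable: "tame f \<Longrightarrow> f \<in> borel_measurable borel"
  by (simp add: tame_def)

lemma tame_poly: "tame (\<lambda>y. eval_poly y p)"
proof -
  have "\<bar>t\<bar> \<le> 1 + t * t" for t :: real
  proof (cases "\<bar>t\<bar> \<le> 1")
    case False
    then have "\<bar>t\<bar> * 1 \<le> \<bar>t\<bar> * \<bar>t\<bar>" by (intro mult_left_mono) auto
    then show ?thesis by (simp flip: abs_mult)
  qed (use zero_le_square[of t] in linarith)
  then show ?thesis
    unfolding tame_def by (auto intro!: exI[of _ "1 + p * p"])
qed

lemma tame_add: "tame f \<Longrightarrow> tame g \<Longrightarrow> tame (\<lambda>y. f y + g y)"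
proof -
  assume "tame f" "tame g"
  then obtain p q where "\<And>y. \<bar>f y\<bar> \<le> eval_poly y p" "\<And>y. \<bar>g y\<bar> \<le> eval_poly y q"
    by (auto simp: tame_def)
  then have "\<bar>f y + g y\<bar> \<le> eval_poly y (p + q)" for y
    by (simp add: abs_triangle_ineq[THEN order_trans] add_mono)
  with \<open>tame f\<close> \<open>tame g\<close> show ?thesis
    unfolding tame_def by (intro conjI exI[of _ "p + q"]) auto
qed

lemma tame_mult: "tame f \<Longrightarrow> tame g \<Longrightarrow> tame (\<lambda>y. f y * g y)"
proof -
  assume "tame f" "tame g"
  then obtain p q where pq: "\<And>y. \<bar>f y\<bar> \<le> eval_poly y p" "\<And>y. \<bar>g y\<bar> \<le> eval_poly y q"
    by (auto simp: tame_def)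
  then have "\<bar>f y * g y\<bar> \<le> eval_poly y (p * q)" for y
    unfolding abs_mult eval_poly_mult
    by (intro mult_mono) (auto intro: order_trans[OF abs_ge_zero pq(1)])
  with \<open>tame f\<close> \<open>tame g\<close> show ?thesis
    unfolding tame_def by (intro conjI exI[of _ "p * q"]) auto
qed

lemma tame_bounded: "f \<in> borel_measurable borel \<Longrightarrow> (\<And>y. \<bar>f y\<bar> \<le> B) \<Longrightarrow> tame f"
  unfolding tame_def by (auto intro!: exI[of _ "Const B"])

lemma tame_const: "tame (\<lambda>y. c)"
  by (rule tame_bounded[of _ "\<bar>c\<bar>"]) auto

lemma tame_minus: "tame f \<Longrightarrow> tame (\<lambda>y. - f y)"
  using tame_mult[OF tame_const[of "-1"], of f] by simp

lemma tame_diff: "tame f \<Longrightarrow> tame g \<Longrightarrow> tame (\<lambda>y. f y - g y)"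
  using tame_add[of f "\<lambda>y. - g y"] tame_minus[of g] by simp

lemma tame_power: "tame f \<Longrightarrow> tame (\<lambda>y. f y ^ k)"
  by (induction k) (auto intro: tame_const tame_mult)

lemma tame_sum: "(\<And>i. i \<in> I \<Longrightarrow> tame (f i)) \<Longrightarrow> tame (\<lambda>y. \<Sum>i\<in>I. f i y)"
  by (induction I rule: infinite_finite_induct) (auto intro: tame_const tame_add)

lemma tame_coord: "tame (\<lambda>y. y $ l)"
  using tame_poly[of "Var l"] by simp

lemmas tame_intros = tame_poly tame_add tame_mult tame_const tame_minus tame_diff tame_power
  tame_sum tame_coord

lemma quadratic_nonneg_discriminant:
  fixes a b d :: real
  assumes "\<And>t. a + 2 * t * b + t\<^sup>2 * d \<ge> 0"
  shows "b\<^sup>2 \<le> a * d"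
proof (cases "d = 0")
  case True
  have "b = 0"
  proof (rule ccontr)
    assume "b \<noteq> 0"
    define t where "t = - (a + 1) / (2 * b)"
    have "2 * t * b = - (a + 1)" using \<open>b \<noteq> 0\<close> by (simp add: t_def)
    then show False using assms[of t] True by simp
  qed
  then show ?thesis using True by simp
next
  case False
  have "d > 0"
  proof (rule ccontr)
    assume "\<not> d > 0"
    then have "d < 0" using False by simp
    have "a \<ge> 0" using assms[of 0] by simp
    define t where "t = (\<bar>a\<bar> + 1) / (- d) + 1"
    have "t \<ge> 1" using \<open>d < 0\<close> by (simp add: t_def divide_nonneg_neg)
    have "a + t\<^sup>2 * d \<ge> 0" using assms[of t] assms[of "- t"] by simp
    moreover have "t * d \<ge> t\<^sup>2 * d"
      using \<open>t \<ge> 1\<close> \<open>d < 0\<close> by (simp add: power2_eq_square mult_le_cancel_right)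
    moreover have "t * d = - (\<bar>a\<bar> + 1) + d" using \<open>d < 0\<close> unfolding t_def distrib_right by simp
    ultimately show False using \<open>d < 0\<close> by linarith
  qed
  then show ?thesis
    using assms[of "- b / d"] by (simp add: field_simps power2_eq_square)
qed

text \<open>
  A measure satisfying Carleman's condition and a polynomial weight \<open>r\<close> for the \<open>L\<^sup>2\<close> norm. Adding one
  to the moments does not change the divergence, and it removes the exceptional case of a measure on
  the hyperplane \<open>y\<^sub>l = 0\<close>, whose moments vanish.
\<close>

locale carleman_measure =
  fixes \<nu> :: "(real ^ 'm::finite) measure" and r :: "'m rpoly"
  assumes sets_nu [measurable_cong, simp]: "sets \<nu> = sets borel"
    and integrable_poly: "\<And>h. integrable \<nu> (\<lambda>y. eval_poly y h)"
    and div: "\<And>l. \<not> summable (\<lambda>n. ((LINT y|\<nu>. (y $ l) ^ (2 * Suc n)) + 1) powr (- 1 / real (2 * Suc n)))"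
    and weight_nonneg: "\<And>y. eval_poly y r \<ge> 0"
begin

lemma integrable_tame:
  assumes "tame f"
  shows "integrable \<nu> f"
proof -
  obtain p where "\<And>y. \<bar>f y\<bar> \<le> eval_poly y p" using assms by (auto simp: tame_def)
  then show ?thesis
    using tame_measurable[OF assms]
    by (intro Bochner_Integration.integrable_bound[OF integrable_poly[of p]] AE_I2)
       (auto intro: order_trans abs_ge_self)
qed

lemma cauchy_schwarz:
  assumes "tame f" "tame g" "tame w" "\<And>y. w y \<ge> 0"
  shows "(LINT y|\<nu>. f y * g y * w y)\<^sup>2 \<le> (LINT y|\<nu>. (f y)\<^sup>2 * w y) * (LINT y|\<nu>. (g y)\<^sup>2 * w y)"
proof (rule quadratic_nonneg_discriminant)
  fix t
  have "0 \<le> (LINT y|\<nu>. (f y + t * g y)\<^sup>2 * w y)"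
    by (rule Bochner_Integration.integral_nonneg) (simp add: assms(4))
  also have "(LINT y|\<nu>. (f y + t * g y)\<^sup>2 * w y)
      = (LINT y|\<nu>. (f y)\<^sup>2 * w y + 2 * t * (f y * g y * w y) + t\<^sup>2 * ((g y)\<^sup>2 * w y))"
    by (intro Bochner_Integration.integral_cong) (auto simp: power2_eq_square algebra_simps)
  also have "\<dots> = (LINT y|\<nu>. (f y)\<^sup>2 * w y) + 2 * t * (LINT y|\<nu>. f y * g y * w y) + t\<^sup>2 * (LINT y|\<nu>. (g y)\<^sup>2 * w y)"
    using assms by (simp add: integrable_tame tame_intros)
  finally show "0 \<le> \<dots>" .
qed

definition l2 :: "(real ^ 'm \<Rightarrow> real) \<Rightarrow> real" where
  "l2 f = sqrt (LINT y|\<nu>. (f y)\<^sup>2 * eval_poly y r)"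

lemma l2_nonneg: "l2 f \<ge> 0"
  unfolding l2_def by (simp add: weight_nonneg Bochner_Integration.integral_nonneg)

lemma l2_square: "(l2 f)\<^sup>2 = (LINT y|\<nu>. (f y)\<^sup>2 * eval_poly y r)"
  unfolding l2_def by (simp add: weight_nonneg Bochner_Integration.integral_nonneg)

lemma l2_inner_le:
  assumes "tame f" "tame g"
  shows "\<bar>LINT y|\<nu>. f y * g y * eval_poly y r\<bar> \<le> l2 f * l2 g"
proof -
  have "(LINT y|\<nu>. f y * g y * eval_poly y r)\<^sup>2 \<le> (l2 f * l2 g)\<^sup>2"
    unfolding power_mult_distrib l2_square
    using assms by (intro cauchy_schwarz weight_nonneg tame_poly)
  then show ?thesis
    using l2_nonneg by (simp add: abs_le_square_iff[symmetric] abs_of_nonneg)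
qed

lemma l2_mono:
  assumes "tame f" "tame g" "\<And>y. \<bar>f y\<bar> \<le> \<bar>g y\<bar>"
  shows "l2 f \<le> l2 g"
  unfolding l2_def using assms
  by (intro real_sqrt_le_mono integral_mono integrable_tame mult_right_mono weight_nonneg tame_intros)
     (auto simp: abs_le_square_iff)

lemma l2_scale: "l2 (\<lambda>y. c * f y) = \<bar>c\<bar> * l2 f"
  unfolding l2_def by (simp add: power_mult_distrib mult.assoc real_sqrt_mult)

lemma l2_triangle:
  assumes "tame f" "tame g"
  shows "l2 (\<lambda>y. f y + g y) \<le> l2 f + l2 g"
proof -
  have "(l2 (\<lambda>y. f y + g y))\<^sup>2
      = (LINT y|\<nu>. (f y)\<^sup>2 * eval_poly y r + 2 * (f y * g y * eval_poly y r) + (g y)\<^sup>2 * eval_poly y r)"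
    unfolding l2_square
    by (intro Bochner_Integration.integral_cong) (auto simp: power2_eq_square algebra_simps)
  also have "\<dots> = (l2 f)\<^sup>2 + 2 * (LINT y|\<nu>. f y * g y * eval_poly y r) + (l2 g)\<^sup>2"
    using assms by (simp add: l2_square integrable_tame tame_intros)
  also have "\<dots> \<le> (l2 f + l2 g)\<^sup>2"
    using l2_inner_le[OF assms] by (simp add: power2_sum)
  finally show ?thesis using l2_nonneg by (meson power2_le_imp_le add_nonneg_nonneg)
qed

text \<open>
  The distance to the space of polynomials in the weighted \<open>L\<^sup>2\<close> norm. It is a seminorm that vanishes
  on polynomials, and it takes the place of integration against functionals that annihilate the
  polynomials.
\<close>

definition poly_dist :: "(real ^ 'm \<Rightarrow> real) \<Rightarrow> real" where
  "poly_dist f = (INF p. l2 (\<lambda>y. f y - eval_poly y p))"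

lemma poly_dist_le: "poly_dist f \<le> l2 (\<lambda>y. f y - eval_poly y p)"
  unfolding poly_dist_def by (rule cINF_lower) (auto intro!: bdd_belowI2[where m = 0] l2_nonneg)

lemma poly_dist_le_l2: "poly_dist f \<le> l2 f"
  using poly_dist_le[of f 0] by simp

lemma poly_dist_less:
  assumes "poly_dist f < c"
  obtains p where "l2 (\<lambda>y. f y - eval_poly y p) < c"
  using assms unfolding poly_dist_def
  by (subst (asm) cINF_less_iff) (auto intro!: bdd_belowI2[where m = 0] l2_nonneg)

lemma poly_dist_nonneg: "poly_dist f \<ge> 0"
  unfolding poly_dist_def by (rule cINF_greatest) (auto simp: l2_nonneg)

lemma poly_dist_add:
  assumes "tame f" "tame g"
  shows "poly_dist (\<lambda>y. f y + g y) \<le> poly_dist f + poly_dist g"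
proof (rule field_le_epsilon)
  fix e :: real assume "e > 0"
  obtain p where p: "l2 (\<lambda>y. f y - eval_poly y p) < poly_dist f + e / 2"
    using poly_dist_less[of f "poly_dist f + e / 2"] \<open>e > 0\<close> by auto
  obtain q where q: "l2 (\<lambda>y. g y - eval_poly y q) < poly_dist g + e / 2"
    using poly_dist_less[of g "poly_dist g + e / 2"] \<open>e > 0\<close> by auto
  have "poly_dist (\<lambda>y. f y + g y) \<le> l2 (\<lambda>y. f y + g y - eval_poly y (p + q))"
    by (rule poly_dist_le)
  also have "(\<lambda>y. f y + g y - eval_poly y (p + q)) = (\<lambda>y. (f y - eval_poly y p) + (g y - eval_poly y q))"
    by (simp add: fun_eq_iff)
  also have "l2 \<dots> \<le> l2 (\<lambda>y. f y - eval_poly y p) + l2 (\<lambda>y. g y - eval_poly y q)"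
    using assms by (intro l2_triangle tame_intros)
  finally show "poly_dist (\<lambda>y. f y + g y) \<le> poly_dist f + poly_dist g + e" using p q by simp
qed

lemma poly_dist_scale: "poly_dist (\<lambda>y. c * f y) \<le> \<bar>c\<bar> * poly_dist f"
proof (cases "c = 0")
  case True
  then show ?thesis using poly_dist_le_l2[of "\<lambda>_. 0"] by (simp add: l2_def)
next
  case False
  have "poly_dist (\<lambda>y. c * f y) / \<bar>c\<bar> \<le> poly_dist f"
    unfolding poly_dist_def[of f]
  proof (rule cINF_greatest)
    fix p
    have "poly_dist (\<lambda>y. c * f y) \<le> l2 (\<lambda>y. c * f y - eval_poly y (Const c * p))" by (rule poly_dist_le)
    also have "\<dots> = \<bar>c\<bar> * l2 (\<lambda>y. f y - eval_poly y p)"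
      unfolding l2_scale[symmetric] by (simp add: right_diff_distrib)
    finally show "poly_dist (\<lambda>y. c * f y) / \<bar>c\<bar> \<le> l2 (\<lambda>y. f y - eval_poly y p)"
      using False by (simp add: divide_le_eq mult.commute)
  qed simp
  then show ?thesis using False by (simp add: divide_le_eq mult.commute)
qed

lemma poly_dist_sum:
  assumes "finite I" "\<And>i. i \<in> I \<Longrightarrow> tame (f i)"
  shows "poly_dist (\<lambda>y. \<Sum>i\<in>I. c i * f i y) \<le> (\<Sum>i\<in>I. \<bar>c i\<bar> * poly_dist (f i))"
  using assms
proof (induction I rule: finite_induct)
  case empty
  show ?case using poly_dist_le_l2[of "\<lambda>_. 0"] by (simp add: l2_def)
next
  case (insert i I)
  have "poly_dist (\<lambda>y. \<Sum>i\<in>insert i I. c i * f i y) = poly_dist (\<lambda>y. c i * f i y + (\<Sum>i\<in>I. c i * f i y))"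
    using insert by simp
  also have "\<dots> \<le> poly_dist (\<lambda>y. c i * f i y) + poly_dist (\<lambda>y. \<Sum>i\<in>I. c i * f i y)"
    using insert by (intro poly_dist_add tame_intros) auto
  also have "\<dots> \<le> \<bar>c i\<bar> * poly_dist (f i) + (\<Sum>i\<in>I. \<bar>c i\<bar> * poly_dist (f i))"
    using insert by (intro add_mono poly_dist_scale insert.IH) auto
  finally show ?case using insert by simp
qed

text \<open>
  The bounded functions whose product with every polynomial is a limit of polynomials. Allowing a
  polynomial factor makes the set stable under multiplication by further bounded functions of the
  same kind, which is what the passage from one coordinate to several needs.
\<close>

definition multipliers :: "(real ^ 'm \<Rightarrow> real) set" where
  "multipliers = {w. w \<in> borel_measurable borel \<and> (\<exists>B. \<forall>y. \<bar>w y\<bar> \<le> B) \<and>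
     (\<forall>q. poly_dist (\<lambda>y. w y * eval_poly y q) = 0)}"

lemma multipliersI:
  assumes "w \<in> borel_measurable borel" "\<And>y. \<bar>w y\<bar> \<le> B" "\<And>q. poly_dist (\<lambda>y. w y * eval_poly y q) \<le> 0"
  shows "w \<in> multipliers"
  unfolding multipliers_def using assms poly_dist_nonneg by (auto intro: antisym)

lemma multipliers_tame: "w \<in> multipliers \<Longrightarrow> tame w"
  unfolding multipliers_def by (auto intro: tame_bounded)

lemma multipliers_1: "(\<lambda>y. 1) \<in> multipliers"
proof (rule multipliersI[where B = 1])
  show "poly_dist (\<lambda>y. 1 * eval_poly y q) \<le> 0" for q
    using poly_dist_le[of "\<lambda>y. eval_poly y q" q] by (simp add: l2_def)
qed auto

lemma multipliers_add:
  assumes "v \<in> multipliers" "w \<in> multipliers"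
  shows "(\<lambda>y. v y + w y) \<in> multipliers"
proof -
  obtain A B where "\<And>y. \<bar>v y\<bar> \<le> A" "\<And>y. \<bar>w y\<bar> \<le> B" using assms unfolding multipliers_def by blast
  then have "\<bar>v y + w y\<bar> \<le> A + B" for y by (meson abs_triangle_ineq add_mono order_trans)
  moreover have "poly_dist (\<lambda>y. (v y + w y) * eval_poly y q) \<le> 0" for q
  proof -
    have "poly_dist (\<lambda>y. v y * eval_poly y q + w y * eval_poly y q)
        \<le> poly_dist (\<lambda>y. v y * eval_poly y q) + poly_dist (\<lambda>y. w y * eval_poly y q)"
      using assms by (intro poly_dist_add tame_intros multipliers_tame)
    also have "\<dots> = 0" using assms by (simp add: multipliers_def)
    finally show ?thesis by (simp add: distrib_right)
  qed
  ultimately show ?thesis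
    using assms by (intro multipliersI) (auto simp: multipliers_def)
qed

lemma multipliers_scale:
  assumes "w \<in> multipliers"
  shows "(\<lambda>y. c * w y) \<in> multipliers"
proof -
  obtain B where "\<And>y. \<bar>w y\<bar> \<le> B" using assms unfolding multipliers_def by blast
  then have "\<bar>c * w y\<bar> \<le> \<bar>c\<bar> * B" for y by (simp add: abs_mult mult_left_mono)
  moreover have "poly_dist (\<lambda>y. (c * w y) * eval_poly y q) \<le> 0" for q
    using poly_dist_scale[of c "\<lambda>y. w y * eval_poly y q"] assms
    by (simp add: multipliers_def mult.assoc)
  ultimately show ?thesis
    using assms by (intro multipliersI) (auto simp: multipliers_def)
qed

lemma multipliers_0: "(\<lambda>y. 0) \<in> multipliers"
  using multipliers_scale[OF multipliers_1, of 0] by simp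

lemma multipliers_sum: "(\<And>i. i \<in> I \<Longrightarrow> w i \<in> multipliers) \<Longrightarrow> (\<lambda>y. \<Sum>i\<in>I. w i y) \<in> multipliers"
  by (induction I rule: infinite_finite_induct) (auto intro: multipliers_0 multipliers_add)

end

lemma cos_taylor:
  "\<exists>t. cos (\<theta> + s) = (\<Sum>i<k. cos (\<theta> + real i * pi / 2) * s ^ i / fact i) + cos t * s ^ k / fact k"
proof -
  define d where "d i x = cos (\<theta> + x + real i * pi / 2)" for i x
  have "DERIV (d i) x :> d (Suc i) x" for i x
  proof -
    have "DERIV (d i) x :> - sin (\<theta> + x + real i * pi / 2)"
      unfolding d_def by (auto intro!: derivative_eq_intros)
    also have "- sin (\<theta> + x + real i * pi / 2) = d (Suc i) x"
    proof -
      have "\<theta> + x + real (Suc i) * pi / 2 = (\<theta> + x + real i * pi / 2) + pi / 2" by (simp add: field_simps)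
      then show ?thesis unfolding d_def by (simp only: cos_add) simp
    qed
    finally show ?thesis .
  qed
  then obtain t where "cos (\<theta> + s) = (\<Sum>i<k. (d i 0 / fact i) * s ^ i) + (d k t / fact k) * s ^ k"
    using Maclaurin_all_le[of d "\<lambda>x. cos (\<theta> + x)" s k] by (auto simp: d_def fun_eq_iff)
  then show ?thesis by (intro exI[of _ "\<theta> + t + real k * pi / 2"]) (simp add: d_def)
qed

lemma powr_quarter_eq: "x \<ge> 0 \<Longrightarrow> x powr (1/4) = sqrt (sqrt x)"
  by (simp add: powr_half_sqrt[symmetric] powr_powr)

context carleman_measure
begin

text \<open>
  Like the moments themselves, the moments increased by one form a log-convex sequence.
\<close>

definition coord_moment :: "'m \<Rightarrow> nat \<Rightarrow> real" where
  "coord_moment l n = (LINT y|\<nu>. (y $ l) ^ (2 * n)) + 1"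

lemma coord_moment_ge_1: "coord_moment l n \<ge> 1"
  unfolding coord_moment_def by (simp add: Bochner_Integration.integral_nonneg)

lemma coord_moment_log_convex:
  "(coord_moment l ((a + b) div 2))\<^sup>2 \<le> coord_moment l a * coord_moment l b" if "even (a + b)"
proof -
  obtain c where c: "a + b = 2 * c" using \<open>even (a + b)\<close> by (elim evenE)
  define m where "m n = (LINT y|\<nu>. (y $ l) ^ (2 * n))" for n
  have m0: "m n \<ge> 0" for n unfolding m_def by (simp add: Bochner_Integration.integral_nonneg)
  have "(LINT y|\<nu>. (y $ l) ^ a * (y $ l) ^ b * 1)\<^sup>2 \<le> (LINT y|\<nu>. ((y $ l) ^ a)\<^sup>2 * 1) * (LINT y|\<nu>. ((y $ l) ^ b)\<^sup>2 * 1)"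
    by (intro cauchy_schwarz tame_intros) auto
  also have "(LINT y|\<nu>. (y $ l) ^ a * (y $ l) ^ b * 1) = m c"
    unfolding m_def c[symmetric] by (simp add: power_add)
  finally have cs: "(m c)\<^sup>2 \<le> m a * m b" by (simp add: m_def power_mult[symmetric] mult.commute)
  also have "m a * m b \<le> ((m a + m b) / 2)\<^sup>2"
    using zero_le_power2[of "m a - m b"] by (simp add: power2_eq_square field_simps)
  finally have "m c \<le> (m a + m b) / 2" using m0 by (meson power2_le_imp_le add_nonneg_nonneg divide_nonneg_pos zero_less_numeral)
  with cs have "(m c + 1)\<^sup>2 \<le> (m a + 1) * (m b + 1)" by (simp add: power2_eq_square algebra_simps)
  then show ?thesis using c by (simp add: coord_moment_def m_def)
qed

text \<open>
  Bang's lemma is applied to the distances \<open>N j x\<close> of \<open>w q y\<^sub>l\<^sup>j cos (x y\<^sub>l + \<phi> + j \<pi>/2)\<close>, the formal \<open>j\<close>-th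
  derivative in \<open>x\<close> of \<open>w q cos (x y\<^sub>l + \<phi>)\<close>. The Taylor estimate holds pointwise for the cosine and
  therefore for the seminorm; at \<open>x = 0\<close> the function is a constant times \<open>w\<close> times a polynomial, so its
  distance is zero.
\<close>

lemma multipliers_cos:
  assumes w: "w \<in> multipliers"
  shows "(\<lambda>y. w y * cos (x * y $ l + \<phi>)) \<in> multipliers"
proof -
  obtain B0 where B0: "\<And>y. \<bar>w y\<bar> \<le> B0" using w unfolding multipliers_def by blast
  define B where "B = \<bar>B0\<bar> + 1"
  have "B > 0" and B: "\<bar>w y\<bar> \<le> B" for y using B0[of y] by (auto simp: B_def)
  note tw = multipliers_tame[OF w]
  have "poly_dist (\<lambda>y. w y * cos (x * y $ l + \<phi>) * eval_poly y q) \<le> 0" for q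
  proof -
    define u where "u j x y = w y * eval_poly y q * (y $ l) ^ j * cos (x * y $ l + \<phi> + real j * pi / 2)" for j x y
    have tcos: "tame (\<lambda>y::real^'m. cos (a * y $ l + b))" for a b
      by (rule tame_bounded[of _ 1]) (auto intro!: borel_measurable_continuous_onI continuous_intros)
    have tu: "tame (u j x)" for j x
      unfolding u_def[abs_def] using tcos[of x "\<phi> + real j * pi / 2"]
      by (intro tame_intros tw) (simp add: add.assoc)
    \<comment> \<open>\<open>c\<close> and \<open>M j\<close> come from separating \<open>y\<^sub>l\<^sup>2\<^sup>j\<close> from \<open>q\<^sup>2 r\<close> in the squared norm by Cauchy-Schwarz.\<close>
    define K where "K = (LINT y|\<nu>. (eval_poly y q)^4 * (eval_poly y r)\<^sup>2) + 1"
    have "K > 0" unfolding K_def by (smt (verit) Bochner_Integration.integral_nonneg zero_le_even_power zero_le_power2 mult_nonneg_nonneg even_numeral)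
    define c where "c = B * K powr (1/4)"
    have "c > 0" using \<open>B > 0\<close> \<open>K > 0\<close> by (simp add: c_def)
    define M where "M j = c * coord_moment l (2 * j) powr (1/4)" for j
    have bp: "coord_moment l n > 0" for n using coord_moment_ge_1[of l n] by simp
    have Mpos: "M j > 0" for j using \<open>c > 0\<close> bp[of "2 * j"] by (simp add: M_def)
    have Mconv: "(M (Suc j))\<^sup>2 \<le> M j * M (Suc (Suc j))" for j
    proof -
      have "(2 * j + 2 * Suc (Suc j)) div 2 = 2 * Suc j" by simp
      then have "(coord_moment l (2 * Suc j))\<^sup>2 \<le> coord_moment l (2 * j) * coord_moment l (2 * Suc (Suc j))"
        using coord_moment_log_convex[of "2 * j" "2 * Suc (Suc j)" l] by simp
      then have "((coord_moment l (2 * Suc j))\<^sup>2) powr (1/4) \<le> (coord_moment l (2 * j) * coord_moment l (2 * Suc (Suc j))) powr (1/4)"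
        by (intro powr_mono2) auto
      then have "(coord_moment l (2 * Suc j) powr (1/4))\<^sup>2 \<le> coord_moment l (2 * j) powr (1/4) * coord_moment l (2 * Suc (Suc j)) powr (1/4)"
        using bp by (simp add: power2_eq_square powr_mult less_imp_le)
      then show ?thesis
        using \<open>c > 0\<close> by (simp add: M_def power2_eq_square mult_ac)
    qed
    have "\<not> summable (\<lambda>n. coord_moment l (Suc n) powr (- 1 / real (2 * Suc n)))"
      using div[of l] unfolding coord_moment_def .
    then have "\<not> summable (\<lambda>j. coord_moment l (2 * j) powr (1/4) / coord_moment l (2 * Suc j) powr (1/4))"
    proof (rule carleman_log_convex[rotated 3])
      show "(coord_moment l (Suc j))\<^sup>2 \<le> coord_moment l j * coord_moment l (Suc (Suc j))" for j
        using coord_moment_log_convex[of j "Suc (Suc j)" l] by simp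
    qed (use bp coord_moment_ge_1 in auto)
    then have Mdiv: "\<not> summable (\<lambda>j. M j / M (Suc j))"
      using \<open>c > 0\<close> by (simp add: M_def)
    define g where "g j y = B * (eval_poly y q * (y $ l) ^ j)" for j and y :: "real ^ 'm"
    have tg: "tame (g j)" for j unfolding g_def[abs_def] by (intro tame_intros)
    have g: "l2 (g j) \<le> M j" for j
    proof -
      define A where "A = (LINT y|\<nu>. (y $ l) ^ (2 * (2 * j)))"
      define D where "D = (LINT y|\<nu>. (eval_poly y q)^4 * (eval_poly y r)\<^sup>2)"
      have "A \<ge> 0"
        unfolding A_def by (intro Bochner_Integration.integral_nonneg zero_le_even_power) simp
      have "D \<ge> 0"
        unfolding D_def
        by (intro Bochner_Integration.integral_nonneg mult_nonneg_nonneg zero_le_even_power zero_le_power2) simp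
      have "(LINT y|\<nu>. (y $ l) ^ (2 * j) * ((eval_poly y q)\<^sup>2 * eval_poly y r) * 1)\<^sup>2
          \<le> (LINT y|\<nu>. ((y $ l) ^ (2 * j))\<^sup>2 * 1) * (LINT y|\<nu>. ((eval_poly y q)\<^sup>2 * eval_poly y r)\<^sup>2 * 1)"
        by (intro cauchy_schwarz tame_intros) auto
      also have "(LINT y|\<nu>. ((y $ l) ^ (2 * j))\<^sup>2 * 1) = A"
        by (simp add: A_def power_mult[symmetric] mult_ac)
      also have "(LINT y|\<nu>. ((eval_poly y q)\<^sup>2 * eval_poly y r)\<^sup>2 * 1) = D"
        by (simp add: D_def power_mult_distrib power_mult[symmetric])
      also have "(LINT y|\<nu>. (y $ l) ^ (2 * j) * ((eval_poly y q)\<^sup>2 * eval_poly y r) * 1)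
          = (l2 (\<lambda>y. eval_poly y q * (y $ l) ^ j))\<^sup>2"
        unfolding l2_square
        by (intro Bochner_Integration.integral_cong) (auto simp: power_mult_distrib power_mult[symmetric] mult_ac)
      finally have "((l2 (\<lambda>y. eval_poly y q * (y $ l) ^ j))\<^sup>2)\<^sup>2 \<le> (A + 1) * (D + 1)"
        using \<open>A \<ge> 0\<close> \<open>D \<ge> 0\<close> by (simp add: algebra_simps)
      then have "l2 (\<lambda>y. eval_poly y q * (y $ l) ^ j) \<le> sqrt (sqrt ((A + 1) * (D + 1)))"
        by (intro real_le_rsqrt)
      also have "\<dots> = (A + 1) powr (1/4) * (D + 1) powr (1/4)"
        using \<open>A \<ge> 0\<close> \<open>D \<ge> 0\<close> by (simp add: powr_quarter_eq real_sqrt_mult)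
      finally have "B * l2 (\<lambda>y. eval_poly y q * (y $ l) ^ j) \<le> B * ((A + 1) powr (1/4) * (D + 1) powr (1/4))"
        using \<open>B > 0\<close> by (intro mult_left_mono) auto
      then show ?thesis
        unfolding g_def l2_scale M_def c_def K_def coord_moment_def A_def[symmetric] D_def[symmetric]
        using \<open>B > 0\<close> by (simp add: mult_ac)
    qed
    have "poly_dist (u 0 x) \<le> 0"
    proof (rule bang[where N = "\<lambda>j x. poly_dist (u j x)" and M = M, OF Mpos Mconv Mdiv])
      fix j x
      have "\<bar>u j x y\<bar> \<le> \<bar>g j y\<bar>" for y
      proof -
        have "\<bar>u j x y\<bar> = \<bar>w y\<bar> * \<bar>cos (x * y $ l + \<phi> + real j * pi / 2)\<bar> * \<bar>eval_poly y q * (y $ l) ^ j\<bar>"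
          by (simp add: u_def abs_mult mult_ac)
        also have "\<dots> \<le> B * 1 * \<bar>eval_poly y q * (y $ l) ^ j\<bar>"
          using B[of y] by (intro mult_mono) auto
        finally show ?thesis using \<open>B > 0\<close> by (simp add: g_def abs_mult)
      qed
      then have "l2 (u j x) \<le> l2 (g j)" by (intro l2_mono tu tg)
      then show "poly_dist (u j x) \<le> M j" using poly_dist_le_l2[of "u j x"] g[of j] by linarith
    next
      fix j
      have "u j 0 = (\<lambda>y. cos (\<phi> + real j * pi / 2) * (w y * eval_poly y (q * Var l ^ j)))"
        by (simp add: u_def fun_eq_iff mult_ac)
      then have "poly_dist (u j 0) \<le> \<bar>cos (\<phi> + real j * pi / 2)\<bar> * poly_dist (\<lambda>y. w y * eval_poly y (q * Var l ^ j))"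
        using poly_dist_scale by presburger
      moreover have "poly_dist (\<lambda>y. w y * eval_poly y (q * Var l ^ j)) = 0"
        using w unfolding multipliers_def by blast
      ultimately show "poly_dist (u j 0) \<le> 0" by simp
    next
      fix j k x h
      define R where "R y = u j (x + h) y - (\<Sum>i<k. (h ^ i / fact i) * u (j + i) x y)" for y
      have tR: "tame R" unfolding R_def[abs_def] by (intro tame_intros tu)
      have bR: "\<bar>R y\<bar> \<le> \<bar>(\<bar>h\<bar> ^ k / fact k) * g (j + k) y\<bar>" for y
      proof -
        define \<theta> where "\<theta> = x * y $ l + \<phi> + real j * pi / 2"
        obtain t where t: "cos (\<theta> + h * y $ l)
            = (\<Sum>i<k. cos (\<theta> + real i * pi / 2) * (h * y $ l) ^ i / fact i) + cos t * (h * y $ l) ^ k / fact k"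
          using cos_taylor by blast
        define v where "v = w y * eval_poly y q * (y $ l) ^ j"
        have "u j (x + h) y = v * cos (\<theta> + h * y $ l)"
          by (simp add: u_def v_def \<theta>_def algebra_simps)
        moreover have "(h ^ i / fact i) * u (j + i) x y = v * (cos (\<theta> + real i * pi / 2) * (h * y $ l) ^ i / fact i)" for i
        proof -
          have "x * y $ l + \<phi> + real (j + i) * pi / 2 = \<theta> + real i * pi / 2"
            by (simp add: \<theta>_def algebra_simps add_divide_distrib)
          then show ?thesis by (simp add: u_def v_def power_add power_mult_distrib mult_ac)
        qed
        ultimately have "R y = v * (cos t * (h * y $ l) ^ k / fact k)"
          by (simp add: R_def t distrib_left sum_distrib_left)
        then have "\<bar>R y\<bar> = \<bar>w y\<bar> * \<bar>cos t\<bar> * (\<bar>h\<bar> ^ k / fact k * \<bar>eval_poly y q * (y $ l) ^ (j + k)\<bar>)"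
          by (simp add: v_def abs_mult power_abs power_mult_distrib power_add mult_ac)
        also have "\<dots> \<le> B * 1 * (\<bar>h\<bar> ^ k / fact k * \<bar>eval_poly y q * (y $ l) ^ (j + k)\<bar>)"
          using B[of y] by (intro mult_mono) auto
        finally show ?thesis using \<open>B > 0\<close> by (simp add: g_def abs_mult mult_ac)
      qed
      have u_eq: "u j (x + h) = (\<lambda>y. (\<Sum>i<k. (h ^ i / fact i) * u (j + i) x y) + R y)"
        by (simp add: R_def fun_eq_iff)
      have tS: "tame (\<lambda>y. \<Sum>i<k. (h ^ i / fact i) * u (j + i) x y)"
        by (intro tame_intros tu)
      have "poly_dist (u j (x + h)) \<le> poly_dist (\<lambda>y. \<Sum>i<k. (h ^ i / fact i) * u (j + i) x y) + poly_dist R"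
        unfolding u_eq by (rule poly_dist_add[OF tS tR])
      also have "\<dots> \<le> (\<Sum>i<k. \<bar>h ^ i / fact i\<bar> * poly_dist (u (j + i) x)) + (\<bar>h\<bar> ^ k / fact k) * M (j + k)"
      proof (intro add_mono)
        show "poly_dist (\<lambda>y. \<Sum>i<k. (h ^ i / fact i) * u (j + i) x y) \<le> (\<Sum>i<k. \<bar>h ^ i / fact i\<bar> * poly_dist (u (j + i) x))"
          by (intro poly_dist_sum tu) auto
        have "poly_dist R \<le> l2 R" by (rule poly_dist_le_l2)
        also have "\<dots> \<le> l2 (\<lambda>y. (\<bar>h\<bar> ^ k / fact k) * g (j + k) y)"
          using bR by (intro l2_mono tame_intros tR tg)
        also have "\<dots> \<le> (\<bar>h\<bar> ^ k / fact k) * M (j + k)"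
          unfolding l2_scale using g[of "j + k"] by (simp add: mult_left_mono divide_right_mono)
        finally show "poly_dist R \<le> (\<bar>h\<bar> ^ k / fact k) * M (j + k)" .
      qed
      finally show "poly_dist (u j (x + h)) \<le> (\<Sum>i<k. poly_dist (u (j + i) x) * \<bar>h\<bar> ^ i / fact i) + M (j + k) * \<bar>h\<bar> ^ k / fact k"
        by (simp add: power_abs mult_ac)
    qed
    moreover have "u 0 x = (\<lambda>y. w y * cos (x * y $ l + \<phi>) * eval_poly y q)"
      by (simp add: u_def fun_eq_iff)
    ultimately show ?thesis by (simp only:)
  qed
  moreover have "\<bar>w y * cos (x * y $ l + \<phi>)\<bar> \<le> B" for y
    using mult_mono[OF B[of y], of "\<bar>cos (x * y $ l + \<phi>)\<bar>" 1] \<open>B > 0\<close> by (simp add: abs_mult)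
  moreover have "(\<lambda>y. w y * cos (x * y $ l + \<phi>)) \<in> borel_measurable borel"
  proof (rule borel_measurable_times)
    show "w \<in> borel_measurable borel" using w by (simp add: multipliers_def)
    show "(\<lambda>y::real^'m. cos (x * y $ l + \<phi>)) \<in> borel_measurable borel"
      by (intro borel_measurable_continuous_onI continuous_intros)
  qed
  ultimately show ?thesis by (intro multipliersI)
qed

lemma multipliers_polynomial_sin:
  assumes "real_polynomial_function p" "w \<in> multipliers"
  shows "(\<lambda>y. w y * p (\<chi> l. sin (s * y $ l))) \<in> multipliers"
  using assms
proof (induction p arbitrary: w rule: real_polynomial_function.induct)
  case (linear p)
  have p: "p z = (\<Sum>l\<in>UNIV. p (axis l 1) * z $ l)" for z :: "real ^ 'm"
  proof -
    have "z = (\<Sum>l\<in>UNIV. (z $ l) *\<^sub>R axis l 1)"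
      by (simp add: vec_eq_iff axis_def if_distrib[of "\<lambda>c. _ * c"] cong: if_cong)
    then have "p z = p (\<Sum>l\<in>UNIV. (z $ l) *\<^sub>R axis l 1)" by simp
    then show ?thesis
      using bounded_linear.linear[OF linear.hyps] by (simp add: linear_sum linear_scale mult.commute)
  qed
  have "(\<lambda>y. \<Sum>l\<in>UNIV. p (axis l 1) * (w y * cos (s * y $ l + (- pi / 2)))) \<in> multipliers"
    by (intro multipliers_sum multipliers_scale multipliers_cos linear.prems)
  also have "(\<lambda>y. \<Sum>l\<in>UNIV. p (axis l 1) * (w y * cos (s * y $ l + (- pi / 2)))) = (\<lambda>y. w y * p (\<chi> l. sin (s * y $ l)))"
  proof
    fix y :: "real ^ 'm"
    have "cos (a + (- pi / 2)) = sin a" for a by (simp add: cos_diff)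
    then show "(\<Sum>l\<in>UNIV. p (axis l 1) * (w y * cos (s * y $ l + (- pi / 2)))) = w y * p (\<chi> l. sin (s * y $ l))"
      by (subst p) (simp add: sum_distrib_left mult_ac)
  qed
  finally show ?case .
next
  case (const c)
  then show ?case using multipliers_scale[of w c] by (simp add: mult.commute)
next
  case (add p1 p2)
  then show ?case using multipliers_add by (simp add: distrib_left)
next
  case (mult p1 p2)
  from mult.IH(2)[OF mult.IH(1)[OF mult.prems]] show ?case by (simp add: mult.assoc)
qed

end

context carleman_measure
begin

text \<open>
  For small \<open>s\<close> the map \<open>y \<mapsto> (sin (s y\<^sub>l))\<^sub>l\<close> sends everything into the cube \<open>[-1, 1]\<^sup>m\<close> and is injective on the
  large cube \<open>|y\<^sub>l| \<le> \<pi>/(2s)\<close>. On that large cube \<open>h\<close> factors through it, and Stone-Weierstrass gives a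
  polynomial in the sines that is close to \<open>h\<close> there and bounded everywhere. Outside the large cube the
  bounded error is dominated by a multiple of \<open>s |y|\<close>, which is small in norm.
\<close>

lemma poly_dist_continuous:
  assumes h: "continuous_on UNIV h" and B: "\<And>y. \<bar>h y\<bar> \<le> B"
  shows "poly_dist h \<le> 0"
proof -
  define K where "K = l2 (\<lambda>y. 1) + (2 * B + 1) * l2 (\<lambda>y. \<Sum>l\<in>UNIV. \<bar>y $ l\<bar>)"
  have "B \<ge> 0" using B[of 0] by linarith
  have tabs: "tame (\<lambda>y::real^'m. \<Sum>l\<in>UNIV. \<bar>y $ l\<bar>)"
  proof (intro tame_sum)
    fix l :: 'm
    have "tame (\<lambda>y::real^'m. y $ l)" by (rule tame_coord)
    then show "tame (\<lambda>y::real^'m. \<bar>y $ l\<bar>)" by (auto simp: tame_def)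
  qed
  have th: "tame h" using B by (intro tame_bounded borel_measurable_continuous_onI h)
  have est: "poly_dist h \<le> s * K" if s: "0 < s" "s < 1" for s
  proof -
    define E where "E y = (\<chi> l. sin (s * y $ l))" for y :: "real ^ 'm"
    define H where "H z = h (\<chi> l. arcsin (z $ l) / s)" for z
    let ?C = "cbox (\<chi> l. - 1) (\<chi> l. 1) :: (real ^ 'm) set"
    have "continuous_on ?C H"
      unfolding H_def using s
      by (intro continuous_on_compose2[OF h] continuous_intros) (auto simp: mem_box_cart)
    then obtain p where p: "real_polynomial_function p" "\<And>z. z \<in> ?C \<Longrightarrow> \<bar>H z - p z\<bar> < s"
      using Stone_Weierstrass_real_polynomial_function[OF compact_cbox _ s(1)] by blast
    have E_C: "E y \<in> ?C" for y by (simp add: E_def mem_box_cart)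
    have mult: "(\<lambda>y. 1 * p (E y)) \<in> multipliers"
      unfolding E_def by (rule multipliers_polynomial_sin[OF p(1) multipliers_1])
    then have tp: "tame (\<lambda>y. p (E y))" using multipliers_tame by simp
    have bp: "\<bar>p (E y)\<bar> \<le> B + s" for y
      using p(2)[OF E_C, of y] B[of "\<chi> l. arcsin (E y $ l) / s"] by (simp add: H_def abs_if split: if_splits)
    have diff: "\<bar>h y - p (E y)\<bar> \<le> s * (1 + (2 * B + 1) * (\<Sum>l\<in>UNIV. \<bar>y $ l\<bar>))" for y
    proof (cases "\<forall>l. \<bar>s * y $ l\<bar> \<le> pi / 2")
      case True
      have "arcsin (sin (s * y $ l)) = s * y $ l" for l
        using True[rule_format, of l] by (intro arcsin_sin) (auto simp: abs_le_iff)
      then have "(\<chi> l. arcsin (E y $ l) / s) = y"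
        using s by (simp add: vec_eq_iff E_def)
      then have "\<bar>h y - p (E y)\<bar> \<le> s * 1" using p(2)[OF E_C, of y] by (simp add: H_def less_imp_le)
      also have "\<dots> \<le> s * (1 + (2 * B + 1) * (\<Sum>l\<in>UNIV. \<bar>y $ l\<bar>))"
        using s \<open>B \<ge> 0\<close> by (intro mult_left_mono) (auto intro!: mult_nonneg_nonneg sum_nonneg)
      finally show ?thesis .
    next
      case False
      then obtain l where l: "\<bar>s * y $ l\<bar> > pi / 2" by (auto simp: not_le)
      have "1 \<le> s * \<bar>y $ l\<bar>" using l s pi_gt3 by (simp add: abs_mult)
      also have "\<dots> \<le> s * (\<Sum>l\<in>UNIV. \<bar>y $ l\<bar>)"
        using s by (intro mult_left_mono member_le_sum) auto
      finally have 1: "1 \<le> s * (\<Sum>l\<in>UNIV. \<bar>y $ l\<bar>)" .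
      have "\<bar>h y - p (E y)\<bar> \<le> (2 * B + 1) * 1"
        using B[of y] bp[of y] s by (simp add: abs_le_iff)
      also have "\<dots> \<le> (2 * B + 1) * (s * (\<Sum>l\<in>UNIV. \<bar>y $ l\<bar>))"
        using 1 \<open>B \<ge> 0\<close> by (intro mult_left_mono) auto
      also have "\<dots> \<le> s * (1 + (2 * B + 1) * (\<Sum>l\<in>UNIV. \<bar>y $ l\<bar>))"
        using s by (simp add: distrib_left mult_ac)
      finally show ?thesis .
    qed
    have "poly_dist h = poly_dist (\<lambda>y. p (E y) + (h y - p (E y)))" by simp
    also have "\<dots> \<le> poly_dist (\<lambda>y. p (E y)) + poly_dist (\<lambda>y. h y - p (E y))"
      by (intro poly_dist_add tame_diff tp th)
    also have "poly_dist (\<lambda>y. p (E y)) = 0"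
    proof -
      have "poly_dist (\<lambda>y. 1 * p (E y) * eval_poly y 1) = 0" using mult unfolding multipliers_def by blast
      then show ?thesis by simp
    qed
    also have "poly_dist (\<lambda>y. h y - p (E y)) \<le> l2 (\<lambda>y. h y - p (E y))" by (rule poly_dist_le_l2)
    also have "\<dots> \<le> l2 (\<lambda>y. s * (1 + (2 * B + 1) * (\<Sum>l\<in>UNIV. \<bar>y $ l\<bar>)))"
      using diff by (intro l2_mono tame_mult tame_add tame_const tame_diff th tp tabs) (meson abs_ge_self order_trans)
    also have "\<dots> \<le> \<bar>s\<bar> * (l2 (\<lambda>y. 1) + l2 (\<lambda>y. (2 * B + 1) * (\<Sum>l\<in>UNIV. \<bar>y $ l\<bar>)))"
      unfolding l2_scale[of s] by (intro mult_left_mono l2_triangle tame_mult tame_const tabs) auto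
    also have "\<dots> = s * K" unfolding l2_scale K_def using s \<open>B \<ge> 0\<close> by simp
    finally show ?thesis by simp
  qed
  have "((\<lambda>s. s * K) \<longlongrightarrow> 0 * K) (at_right 0)"
    by (intro tendsto_intros)
  moreover have "\<forall>\<^sub>F s in at_right 0. poly_dist h \<le> s * K"
    unfolding eventually_at_right_field using est by (intro exI[of _ 1]) auto
  ultimately show ?thesis
    using tendsto_lowerbound[of "\<lambda>s. s * K" "0 * K" "at_right 0" "poly_dist h"] by simp
qed

end

text \<open>
  A bump function \<open>h\<close> at \<open>y0\<close> satisfies \<open>\<integral> h\<^sup>2 g d\<nu> < 0\<close>. The weight \<open>1 + g\<^sup>2\<close> dominates \<open>|g|\<close> and is a
  polynomial, so approximating \<open>h\<close> by a polynomial \<open>s\<close> in the norm with this weight changes the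
  integral as little as desired.
\<close>

lemma exists_poly_square_integral_neg:
  fixes \<nu> :: "(real ^ 'm::finite) measure" and g :: "'m rpoly"
  assumes "sets \<nu> = sets borel"
    and "\<And>h :: 'm rpoly. integrable \<nu> (\<lambda>y. eval_poly y h)"
    and "\<And>l. \<not> summable (\<lambda>n. ((LINT y|\<nu>. (y $ l) ^ (2 * Suc n)) + 1) powr (- 1 / real (2 * Suc n)))"
    and neg: "eval_poly y0 g < 0"
    and supp: "\<And>U. open U \<Longrightarrow> y0 \<in> U \<Longrightarrow> emeasure \<nu> U > 0"
  shows "\<exists>s. (LINT y|\<nu>. (eval_poly y s)\<^sup>2 * eval_poly y g) < 0"
proof -
  interpret carleman_measure \<nu> "1 + g * g"
    by unfold_locales (use assms in auto)
  have "open {y. eval_poly y g < 0}"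
    by (intro open_Collect_less continuous_on_eval_poly continuous_intros)
  then obtain d where d: "d > 0" "\<And>y. dist y y0 < d \<Longrightarrow> eval_poly y g < 0"
    using neg unfolding open_dist by force
  define h where "h y = max 0 (d - dist y y0)" for y
  have h_cont: "continuous_on UNIV h" unfolding h_def by (intro continuous_intros)
  have h_bd: "\<bar>h y\<bar> \<le> d" for y using d(1) by (simp add: h_def)
  have th: "tame h" using h_bd by (intro tame_bounded borel_measurable_continuous_onI h_cont)
  have nonpos: "(h y)\<^sup>2 * eval_poly y g \<le> 0" for y
  proof (cases "dist y y0 < d")
    case True
    then show ?thesis using d(2)[of y] by (simp add: mult_nonneg_nonpos less_imp_le)
  qed (simp add: h_def)
  have int: "integrable \<nu> (\<lambda>y. (f y)\<^sup>2 * eval_poly y g)" if "tame f" for f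
    using that by (intro integrable_tame tame_intros)
  define I where "I = (LINT y|\<nu>. (h y)\<^sup>2 * eval_poly y g)"
  have "I < 0"
  proof (rule ccontr)
    assume "\<not> I < 0"
    moreover have "(LINT y|\<nu>. - ((h y)\<^sup>2 * eval_poly y g)) \<ge> 0"
      using nonpos by (intro Bochner_Integration.integral_nonneg) auto
    ultimately have "(LINT y|\<nu>. - ((h y)\<^sup>2 * eval_poly y g)) = 0"
      by (simp add: I_def)
    then have "AE y in \<nu>. - ((h y)\<^sup>2 * eval_poly y g) = 0"
      using nonpos int[OF th] by (subst (asm) integral_nonneg_eq_0_iff_AE) auto
    then have "AE y in \<nu>. y \<notin> ball y0 d"
    proof (eventually_elim)
      case (elim y)
      then show ?case using d(2)[of y] by (auto simp: h_def dist_commute)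
    qed
    then have "emeasure \<nu> (ball y0 d) = 0"
      by (subst (asm) AE_iff_measurable[of "ball y0 d"]) (auto simp: space_borel sets_eq_imp_space_eq[OF sets_nu])
    moreover have "emeasure \<nu> (ball y0 d) > 0" using d(1) by (intro supp) auto
    ultimately show False by simp
  qed
  define K where "K = 1 + 2 * l2 h"
  have "K \<ge> 1" using l2_nonneg[of h] by (simp add: K_def)
  define e where "e = min 1 (- I / (2 * K))"
  have "e > 0" using \<open>I < 0\<close> \<open>K \<ge> 1\<close> by (simp add: e_def divide_neg_pos)
  have "poly_dist h < e" using poly_dist_continuous[OF h_cont h_bd] \<open>e > 0\<close> by simp
  then obtain s where s: "l2 (\<lambda>y. h y - eval_poly y s) < e" by (rule poly_dist_less)
  let ?s = "\<lambda>y. eval_poly y s"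
  have t1: "tame (\<lambda>y. h y - ?s y)" and t2: "tame (\<lambda>y. h y + ?s y)" by (intro tame_intros th)+
  have "(LINT y|\<nu>. (?s y)\<^sup>2 * eval_poly y g) - I = (LINT y|\<nu>. (?s y)\<^sup>2 * eval_poly y g - (h y)\<^sup>2 * eval_poly y g)"
    unfolding I_def by (intro Bochner_Integration.integral_diff[symmetric] int th tame_poly)
  also have "\<dots> \<le> (LINT y|\<nu>. \<bar>h y - ?s y\<bar> * \<bar>h y + ?s y\<bar> * eval_poly y (1 + g * g))"
  proof (rule integral_mono)
    have tabs: "tame (\<lambda>y. \<bar>f y\<bar>)" if "tame f" for f using that by (auto simp: tame_def)
    show "integrable \<nu> (\<lambda>y. \<bar>h y - ?s y\<bar> * \<bar>h y + ?s y\<bar> * eval_poly y (1 + g * g))"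
      by (intro integrable_tame tame_mult tame_poly tabs t1 t2)
    show "integrable \<nu> (\<lambda>y. (?s y)\<^sup>2 * eval_poly y g - (h y)\<^sup>2 * eval_poly y g)"
      by (intro Bochner_Integration.integrable_diff int th tame_poly)
    fix y
    let ?g = "eval_poly y g"
    have "\<bar>?g\<bar> \<le> 1 + ?g * ?g"
      using zero_le_power2[of "\<bar>?g\<bar> - 1 / 2"] by (simp add: power2_eq_square algebra_simps)
    have "(?s y)\<^sup>2 * ?g - (h y)\<^sup>2 * ?g = - ((h y - ?s y) * (h y + ?s y) * ?g)"
      by (simp add: power2_eq_square algebra_simps)
    also have "\<dots> \<le> \<bar>(h y - ?s y) * (h y + ?s y) * ?g\<bar>" by (rule abs_ge_minus_self)
    also have "\<dots> = \<bar>h y - ?s y\<bar> * \<bar>h y + ?s y\<bar> * \<bar>?g\<bar>" by (simp only: abs_mult)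
    also have "\<dots> \<le> \<bar>h y - ?s y\<bar> * \<bar>h y + ?s y\<bar> * eval_poly y (1 + g * g)"
      using \<open>\<bar>?g\<bar> \<le> 1 + ?g * ?g\<close> by (intro mult_left_mono) auto
    finally show "(?s y)\<^sup>2 * ?g - (h y)\<^sup>2 * ?g \<le> \<bar>h y - ?s y\<bar> * \<bar>h y + ?s y\<bar> * eval_poly y (1 + g * g)" .
  qed
  also have "\<dots> \<le> l2 (\<lambda>y. \<bar>h y - ?s y\<bar>) * l2 (\<lambda>y. \<bar>h y + ?s y\<bar>)"
  proof -
    have tabs: "tame (\<lambda>y. \<bar>f y\<bar>)" if "tame f" for f using that by (auto simp: tame_def)
    show ?thesis using l2_inner_le[OF tabs[OF t1] tabs[OF t2]] by linarith
  qed
  also have "\<dots> = l2 (\<lambda>y. h y - ?s y) * l2 (\<lambda>y. h y + ?s y)" by (simp add: l2_def)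
  also have "\<dots> \<le> e * K"
  proof (rule mult_mono)
    have "l2 (\<lambda>y. h y + ?s y) = l2 (\<lambda>y. 2 * h y + (- 1) * (h y - ?s y))" by simp
    also have "\<dots> \<le> l2 (\<lambda>y. 2 * h y) + l2 (\<lambda>y. (- 1) * (h y - ?s y))"
      by (intro l2_triangle tame_intros th)
    also have "\<dots> \<le> K" unfolding l2_scale K_def using s by (simp add: e_def)
    finally show "l2 (\<lambda>y. h y + ?s y) \<le> K" .
  qed (use s \<open>e > 0\<close> l2_nonneg in auto)
  also have "e * K \<le> - I / 2"
  proof -
    have "e * K \<le> (- I / (2 * K)) * K" using \<open>K \<ge> 1\<close> by (intro mult_right_mono) (auto simp: e_def)
    then show ?thesis using \<open>K \<ge> 1\<close> by simp
  qed
  finally have "(LINT y|\<nu>. (?s y)\<^sup>2 * eval_poly y g) < 0" using \<open>I < 0\<close> by simp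
  then show ?thesis ..
qed

section \<open>Support and moments\<close>

text \<open>
  Every point outside the support has an open neighbourhood of measure zero, and by Lindelof's theorem
  countably many of these cover the complement.
\<close>

lemma AE_in_measure_support:
  fixes \<nu> :: "(real ^ 'm::finite) measure"
  assumes sets: "sets \<nu> = sets borel"
  shows "AE y in \<nu>. y \<in> measure_support \<nu>"
proof -
  define \<U> where "\<U> = {U. open U \<and> emeasure \<nu> U = 0}"
  obtain \<V> where \<V>: "\<V> \<subseteq> \<U>" "countable \<V>" "\<Union>\<V> = \<Union>\<U>"
    by (rule Lindelof[of \<U>]) (auto simp: \<U>_def)
  have "U \<in> null_sets \<nu>" if "U \<in> \<V>" for U
    using that \<V>(1) sets by (auto simp: \<U>_def null_sets_def)
  then have "\<Union>\<V> \<in> null_sets \<nu>"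
    using null_sets_UN'[OF \<V>(2), of "\<lambda>U. U" \<nu>] by simp
  moreover have "y \<in> \<Union>\<V>" if "y \<notin> measure_support \<nu>" for y
    using that unfolding \<V>(3) by (auto simp: measure_support_def \<U>_def)
  ultimately show ?thesis
    by (intro AE_I'[of "\<Union>\<V>"]) auto
qed

text \<open>
  If the series with the enlarged moments converged, its terms would tend to zero and the moments would
  exceed one eventually. Then no moment vanishes, since one vanishing moment forces \<open>y\<^sub>l = 0\<close> almost
  everywhere; and the late terms of the original series are at most twice those with the enlarged
  moments, so it would converge as well.
\<close>

lemma carleman_not_summable:
  fixes \<nu> :: "(real ^ 'm::finite) measure" and l :: 'm
  assumes int: "\<And>n. integrable \<nu> (\<lambda>y. (y $ l) ^ n)"
    and carl: "suminf (\<lambda>n. inverse (ennreal ((LINT y|\<nu>. (y $ l) ^ (2 * Suc n)) powr (1 / real (2 * Suc n))))) = \<infinity>"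
  shows "\<not> summable (\<lambda>n. ((LINT y|\<nu>. (y $ l) ^ (2 * Suc n)) + 1) powr (- 1 / real (2 * Suc n)))"
proof
  define m where "m n = (LINT y|\<nu>. (y $ l) ^ (2 * Suc n))" for n
  define e where "e n = 1 / real (2 * Suc n)" for n
  have m0: "m n \<ge> 0" for n
    unfolding m_def by (intro Bochner_Integration.integral_nonneg zero_le_even_power) simp
  have e: "0 < e n" "e n \<le> 1" for n by (auto simp: e_def)
  assume "summable (\<lambda>n. ((LINT y|\<nu>. (y $ l) ^ (2 * Suc n)) + 1) powr (- 1 / real (2 * Suc n)))"
  moreover have "- 1 / real (2 * Suc n) = - e n" for n by (simp add: e_def)
  ultimately have sm: "summable (\<lambda>n. (m n + 1) powr (- e n))"
    by (simp only: m_def)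
  then have "(\<lambda>n. (m n + 1) powr (- e n)) \<longlonglongrightarrow> 0" by (rule summable_LIMSEQ_zero)
  then have "\<forall>\<^sub>F n in sequentially. (m n + 1) powr (- e n) < 1 / 2" by (rule order_tendstoD) simp
  then obtain n0 where n0: "\<And>n. n \<ge> n0 \<Longrightarrow> (m n + 1) powr (- e n) < 1 / 2"
    unfolding eventually_sequentially by blast
  have large: "m n > 1" if "n \<ge> n0" for n
  proof (rule ccontr)
    assume "\<not> m n > 1"
    then have "(m n + 1) powr e n \<le> 2 powr 1"
      using m0[of n] e[of n] by (intro powr_mono_both) auto
    moreover have "(m n + 1) powr e n > 0" using m0[of n] by simp
    ultimately have "1 / 2 \<le> (m n + 1) powr (- e n)"
      by (simp add: powr_minus_divide frac_le)
    then show False using n0[OF that] by simp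
  qed
  have pos: "m n > 0" for n
  proof (rule ccontr)
    assume "\<not> m n > 0"
    then have "m n = 0" using m0[of n] by simp
    moreover have "AE y in \<nu>. 0 \<le> (y $ l) ^ (2 * Suc n)"
      by (intro AE_I2 zero_le_even_power) simp
    ultimately have "AE y in \<nu>. (y $ l) ^ (2 * Suc n) = 0"
      using integral_nonneg_eq_0_iff_AE[OF int[of "2 * Suc n"]] by (simp only: m_def)
    then have "AE y in \<nu>. (y $ l) ^ (2 * Suc n0) = 0" by eventually_elim auto
    then have "m n0 = (LINT y|\<nu>. 0)"
      unfolding m_def using int[of "2 * Suc n0"] by (intro integral_cong_AE) auto
    then show False using large[of n0] by simp
  qed
  have "summable (\<lambda>n. m n powr (- e n))"
  proof (rule summable_comparison_test'[of "\<lambda>n. 2 * (m n + 1) powr (- e n)" n0])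
    show "summable (\<lambda>n. 2 * (m n + 1) powr (- e n))" using sm by (rule summable_mult)
    fix n assume "n \<ge> n0"
    have "m n powr (- e n) \<le> ((m n + 1) / 2) powr (- e n)"
      using large[OF \<open>n \<ge> n0\<close>] e[of n] by (intro powr_mono2') auto
    also have "\<dots> = (m n + 1) powr (- e n) * 2 powr e n"
      using m0[of n] by (simp add: powr_divide powr_minus_divide)
    also have "\<dots> \<le> (m n + 1) powr (- e n) * 2 powr 1"
      using e[of n] by (intro mult_left_mono powr_mono) auto
    finally show "norm (m n powr (- e n)) \<le> 2 * (m n + 1) powr (- e n)" by simp
  qed
  moreover have "inverse (ennreal (m n powr e n)) = ennreal (m n powr (- e n))" for n
    using pos[of n] by (simp add: inverse_ennreal powr_minus)
  ultimately have "suminf (\<lambda>n. inverse (ennreal (m n powr e n))) < \<infinity>"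
    by (simp add: suminf_ennreal2 less_top)
  then show False using carl unfolding m_def e_def by simp
qed

theorem theoremA:
  fixes Y :: "(real ^ 'm::finite) set"
    and G :: "('n::finite, 'm) poly_xy ^ 'q::finite ^ 'q"
    and \<nu> :: "(real ^ 'm) measure"
    and F :: "'n rpoly ^ 'p::finite ^ 'p"
    and X :: "(real ^ 'n) set"
  assumes "closed Y"
    and "sym_mat G"
    and X_def: "X = {x. \<forall>y\<in>Y. psd (map_mat (eval_xy x y) G)}"
    and "sets \<nu> = sets borel"
    and "measure_support \<nu> = Y"
    and "\<And>h :: 'm rpoly. (\<integral>\<^sup>+y\<in>Y. ennreal \<bar>eval_poly y h\<bar> \<partial>\<nu>) < \<infinity>"
    and archimedean: "\<exists>C>0. (\<chi> i j. Const C - (\<Sum>k\<in>UNIV. (Var k)\<^sup>2))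
                        \<in> (Qmod Y G \<nu> :: ('n rpoly ^ 1 ^ 1) set)"
    and "\<And>j. carleman Y \<nu> j"
    and "sym_mat F"
    and "\<And>x. x \<in> X \<Longrightarrow> pos_def (map_mat (eval_poly x) F)"
  shows "F \<in> Qmod Y G \<nu>"
proof -
  note [measurable_cong] = \<open>sets \<nu> = sets borel\<close>
  have Y [measurable]: "Y \<in> sets borel" using \<open>closed Y\<close> by (rule borel_closed)
  have supp: "AE y in \<nu>. y \<in> Y"
    using AE_in_measure_support[OF \<open>sets \<nu> = sets borel\<close>] \<open>measure_support \<nu> = Y\<close> by simp
  have set_int: "set_integrable \<nu> Y (\<lambda>y. eval_poly y h)" for h :: "'m rpoly"
    unfolding set_integrable_def
  proof (rule integrableI_bounded)
    have "(\<integral>\<^sup>+y. ennreal (norm (indicator Y y *\<^sub>R eval_poly y h)) \<partial>\<nu>)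
        = (\<integral>\<^sup>+y\<in>Y. ennreal \<bar>eval_poly y h\<bar> \<partial>\<nu>)"
      by (intro nn_integral_cong) (auto simp: indicator_def)
    then show "(\<integral>\<^sup>+y. ennreal (norm (indicator Y y *\<^sub>R eval_poly y h)) \<partial>\<nu>) < \<infinity>"
      using assms(6) by simp
  qed measurable
  have set_lint: "(LINT y:Y|\<nu>. eval_poly y h) = (LINT y|\<nu>. eval_poly y h)" for h :: "'m rpoly"
    unfolding set_lebesgue_integral_def
    by (intro integral_cong_AE) (use supp in \<open>auto elim!: eventually_mono\<close>)
  have int: "integrable \<nu> (\<lambda>y. eval_poly y h)" for h :: "'m rpoly"
  proof -
    have "integrable \<nu> (\<lambda>y. indicator Y y *\<^sub>R eval_poly y h)"
      using set_int by (simp add: set_integrable_def)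
    then show ?thesis
      by (rule integrable_cong_AE_imp) (use supp in \<open>auto elim!: eventually_mono\<close>)
  qed
  have set_lint_power: "(LINT y:Y|\<nu>. (y $ l) ^ n) = (LINT y|\<nu>. (y $ l) ^ n)" for l n
    using set_lint[of "Var l ^ n"] by simp
  have int_power: "integrable \<nu> (\<lambda>y. (y $ l) ^ n)" for l n
    using int[of "Var l ^ n"] by simp
  have div: "\<not> summable (\<lambda>n. ((LINT y|\<nu>. (y $ l) ^ (2 * Suc n)) + 1) powr (- 1 / real (2 * Suc n)))" for l
  proof (rule carleman_not_summable[OF int_power])
    show "suminf (\<lambda>n. inverse (ennreal ((LINT y|\<nu>. (y $ l) ^ (2 * Suc n)) powr (1 / real (2 * Suc n))))) = \<infinity>"
      using assms(8)[of l] unfolding carleman_def set_lint_power .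
  qed
  obtain C where C: "C > 0" "ball_poly C \<in> Qpoly Y G \<nu>"
    using archimedean unfolding Qpoly_def ball_poly_def by auto
  show ?thesis
  proof (rule Qmod_positivstellensatz[OF C \<open>sym_mat F\<close>])
    fix x :: "real ^ 'n"
    show "pos_def (map_mat (eval_poly x) F) \<or> (\<exists>q\<in>Qpoly Y G \<nu>. eval_poly x q < 0)"
    proof (cases "x \<in> X")
      case True
      then show ?thesis using assms(10) by blast
    next
      case False
      then obtain y v where y: "y \<in> Y" and v: "v \<bullet> (map_mat (eval_xy x y) G *v v) < 0"
        using sym_mat_map_mat[OF \<open>sym_mat G\<close>] by (auto simp: X_def psd_def not_le)
      define g where "g = spec_x x (\<Sum>a\<in>UNIV. \<Sum>b\<in>UNIV. Const (Const (v $ a * v $ b)) * G $ a $ b)"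
      have g: "eval_poly y g = v \<bullet> (map_mat (eval_xy x y) G *v v)" for y
        by (simp add: g_def eval_poly_spec_x inner_vec_def matrix_vector_mult_def map_mat_def
            sum_distrib_left mult_ac)
      have "emeasure \<nu> U > 0" if "open U" "y \<in> U" for U
        using y that \<open>measure_support \<nu> = Y\<close> by (auto simp: measure_support_def)
      then obtain s where s: "(LINT y|\<nu>. (eval_poly y s)\<^sup>2 * eval_poly y g) < 0"
        using exists_poly_square_integral_neg[OF \<open>sets \<nu> = sets borel\<close> int div, of y g] v unfolding g by blast
      obtain q where q: "q \<in> Qpoly Y G \<nu>"
        and qx: "eval_poly x q = (LINT y:Y|\<nu>. (eval_poly y s)\<^sup>2 * (v \<bullet> (map_mat (eval_xy x y) G *v v)))"
        using Qpoly_quadratic_form[OF set_int] by blast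
      have "eval_poly x q < 0"
        using s set_lint[of "s\<^sup>2 * g"] unfolding qx by (simp add: g)
      with q show ?thesis by blast
    qed
  qed
qed

end
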